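(* For $n\ge 1$ and $\lambda,\mu\in\mathcal P_n$ consider the following three lists of assertions. List A: (A1) For every $x\in[0,\infty)^n$, $\ \dfrac{P_\lambda(x;\tau)}{P_\lambda(\mathbf 1;\tau)}-\dfrac{P_\mu(x;\tau)}{P_\mu(\mathbf 1;\tau)}\in\mathbb F_{\ge0}^{\mathbb R}$. (A2) For every $\tau_0\in[0,\infty]$ and every $x\in[0,\infty)^n$, $\ \dfrac{P_\lambda(x;\tau_0)}{P_\lambda(\mathbf 1;\tau_0)}-\dfrac{P_\mu(x;\tau_0)}{P_\mu(\mathbf 1;\tau_0)}\ge 0$. (A3) For some $\tau_0\in[0,\infty]$, one has for every $x\in(0,1)^n\cup(1,\infty)^n$: $\ \dfrac{P_\lambda(x;\tau_0)}{P_\lambda(\mathbf 1;\tau_0)}-\dfrac{P_\mu(x;\tau_0)}{P_\mu(\mathbf 1;\tau_0)}\ge 0$. (A4) $\lambda$ majorizes $\mu$. List B: (B1) For every $x\in[0,\infty)^n$, $\ \dfrac{P_\lambda(x+\mathbf 1;\tau)}{P_\lambda(\mathbf 1;\tau)}-\dfrac{P_\mu(x+\mathbf 1;\tau)}{P_\mu(\mathbf 1;\tau)}\in\mathbb F_{\ge0}^{\mathbb R}$. (B2) For every $\tau_0\in[0,\infty]$ and every $x\in[0,\infty)^n$, $\ \dfrac{P_\lambda(x+\mathbf 1;\tau_0)}{P_\lambda(\mathbf 1;\tau_0)}-\dfrac{P_\mu(x+\mathbf 1;\tau_0)}{P_\mu(\mathbf 1;\tau_0)}\ge 0$. (B3)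 For some $\tau_0\in[0,\infty]$, one has for every $x\in[0,\infty)^n$: $\ \dfrac{P_\lambda(x+\mathbf 1;\tau_0)}{P_\lambda(\mathbf 1;\tau_0)}-\dfrac{P_\mu(x+\mathbf 1;\tau_0)}{P_\mu(\mathbf 1;\tau_0)}\ge 0$. (B4) $\lambda$ weakly majorizes $\mu$. List C: (C1) $\dfrac{P_\lambda(x;\tau)}{P_\lambda(\mathbf 1;\tau)}-\dfrac{P_\mu(x;\tau)}{P_\mu(\mathbf 1;\tau)}\in\mathcal M_S(\mathbb F_{\ge0})$. (C2) For every $\tau_0\in[0,\infty]$, $\ \dfrac{P_\lambda(x;\tau_0)}{P_\lambda(\mathbf 1;\tau_0)}-\dfrac{P_\mu(x;\tau_0)}{P_\mu(\mathbf 1;\tau_0)}\in\mathcal M_S(\mathbb R_{\ge0})$. (C3) For some $\tau_0\in[0,\infty]$, $\ \dfrac{P_\lambda(x;\tau_0)}{P_\lambda(\mathbf 1;\tau_0)}-\dfrac{P_\mu(x;\tau_0)}{P_\mu(\mathbf 1;\tau_0)}\in\mathcal M_S(\mathbb R_{\ge0})$. (C4) $\lambda$ majorizes $\mu$. Then: (i) For any $n\ge1$ and any $\lambda\in\mathcal P_n$ with $|\lambda|\le n$, if $\mu=(1^{|\lambda|})$, then (A1)--(A4) are equivalent, (B1)--(B4) are equivalent, and (C1)--(C4) are equivalent. (ii) If $n=2$, then for all $\lambda,\mu\in\mathcal P_2$ the assertions (C1)--(C4) are equivalent.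
   Context: $\mathcal P_n$ is the set of partitions $\lambda=(\lambda_1\ge\dots\ge\lambda_n\ge0)$ of length at most $n$ (integer entries, padded by zeros); $|\lambda|=\sum_i\lambda_i$; $(1^k)$ is the partition with $k$ parts equal to $1$. $\mathbf 1=(1,\dots,1)\in\mathbb R^n$. For $\lambda,\mu\in\mathcal P_n$: $\lambda$ weakly majorizes $\mu$ if $\sum_{i=1}^k\lambda_i\ge\sum_{i=1}^k\mu_i$ for $k=1,\dots,n$; $\lambda$ majorizes $\mu$ ($\lambda\succcurlyeq\mu$) if moreover $|\lambda|=|\mu|$. Jack polynomials: let $\tau$ be an indeterminate. On the ring of symmetric functions over $\mathbb Q(\tau)$ in infinitely many variables define $\langle p_\lambda,p_\mu\rangle=\delta_{\lambda\mu}z_\lambda\tau^{-\ell(\lambda)}$, where $p_\lambda$ are power sums, $\ell(\lambda)$ is the number of nonzero parts, $z_\lambda=\prod_{i}i^{m_i}m_i!$ with $m_i$ the number of parts equal to $i$. The Jack symmetric functions $P_\lambda$ are the unique pairwise orthogonal family of the form $P_\lambda=m_\lambda+\sum_{\mu\ne\lambda,\ \lambda\succcurlyeq\mu}K_{\lambda\mu}(\tau)m_\mu$ ($m_\mu$ the monomial symmetric functions), and $P_\lambda(x;\tau)$ is the restriction of $P_\lambda$ to $n$ variables $x=(x_1,\dots,x_n)$ (Macdonald's $P_\lambda^{(\alpha)}$ with $\alpha=1/\tau$). For $\tau_0\in[0,\infty]$, $P_\lambda(x;\tau_0)$ is the coefficientwise specialization $\tau=\tau_0$ (limit $\tau\to\infty$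 if $\tau_0=\infty$); thus $\tau_0=0,1,\infty$ give the monomial symmetric polynomial $m_\lambda$, the Schur polynomial $s_\lambda$, and the elementary symmetric polynomial $e_{\lambda'}$ ($\lambda'$ the conjugate partition) respectively. $\mathbb F_{\ge0}=\{f/g : f,g\in\mathbb Z_{\ge0}[\tau],\ g\ne0\}$ and $\mathbb F_{\ge0}^{\mathbb R}=\{f/g : f,g\in\mathbb R_{\ge0}[\tau],\ g\ne0\}$; for a fixed real vector $x$, expressions such as $P_\lambda(x;\tau)/P_\lambda(\mathbf 1;\tau)$ are regarded as elements of $\mathbb R(\tau)$. Muirhead semiring: $M_\lambda(x)=m_\lambda(x)/m_\lambda(\mathbf 1)$ for $\lambda\in\mathcal P_n$, where $m_\lambda(x)$ is the monomial symmetric polynomial in $n$ variables. For a cone $\mathcal C$ of scalars, $\mathcal M_S(\mathcal C)$ is the set of (finite) $\mathcal C$-linear combinations of products of polynomials from $\{M_\lambda-M_\mu : \lambda\succcurlyeq\mu\}\cup\{M_\lambda : \lambda\in\mathcal P_n\}$. *)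

theory Defs
  imports
    "HOL-Analysis.Analysis"
    "HOL-Computational_Algebra.Computational_Algebra"
    "HOL-Computational_Algebra.Field_as_Ring"
    "HOL-Library.Poly_Mapping"
begin

abbreviation lookup :: "('a \<Rightarrow>\<^sub>0 'b::zero) \<Rightarrow> 'a \<Rightarrow> 'b" where
  "lookup \<equiv> Poly_Mapping.lookup"

abbreviation keys :: "('a \<Rightarrow>\<^sub>0 'b::zero) \<Rightarrow> 'a set" where
  "keys \<equiv> Poly_Mapping.keys"


section \<open>Partitions\<close>

text \<open>
  A partition is a weakly decreasing, finitely supported sequence of naturals, indexed from 0;
  so \<open>lookup l i\<close> is the part usually called \<open>\<lambda>\<^sub>i\<^sub>+\<^sub>1\<close>.  Partitions thus share their type with
  exponent vectors of monomials in the variables \<open>x\<^sub>0, x\<^sub>1, \<dots>\<close>.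
\<close>

type_synonym expo = "nat \<Rightarrow>\<^sub>0 nat"

definition int_partitions :: "expo set" where
  "int_partitions = {l. antimono (lookup l)}"

definition partitions_upto :: "nat \<Rightarrow> expo set" where
  "partitions_upto n = {l \<in> int_partitions. keys l \<subseteq> {..<n}}"

definition partition_size :: "expo \<Rightarrow> nat" where
  "partition_size l = (\<Sum>i\<in>keys l. lookup l i)"

definition partition_length :: "expo \<Rightarrow> nat" where
  "partition_length l = card (keys l)"

definition part_mult :: "expo \<Rightarrow> nat \<Rightarrow> nat" where
  "part_mult l i = card {j. lookup l j = i}"

definition one_column :: "nat \<Rightarrow> expo" where
  "one_column k = (\<Sum>i<k. Poly_Mapping.single i 1)"

text \<open>
  The partial sums of a partition with at most \<open>n\<close> parts are constant from index \<open>n\<close> on, so for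
  such partitions it makes no difference whether \<open>k\<close> is bounded by \<open>n\<close>.
\<close>

definition weakly_majorizes :: "expo \<Rightarrow> expo \<Rightarrow> bool" where
  "weakly_majorizes l m \<longleftrightarrow> (\<forall>k. (\<Sum>i<k. lookup m i) \<le> (\<Sum>i<k. lookup l i))"

definition majorizes :: "expo \<Rightarrow> expo \<Rightarrow> bool" where
  "majorizes l m \<longleftrightarrow> weakly_majorizes l m \<and> partition_size l = partition_size m"


section \<open>Symmetric functions in infinitely many variables\<close>

text \<open>
  A formal series in \<open>x\<^sub>0, x\<^sub>1, \<dots>\<close> is given by its coefficient function; a symmetric function is
  a finite linear combination of the series \<open>sf_monomial l\<close> below.
\<close>

type_synonym 'a series = "expo \<Rightarrow> 'a"

definition series_one :: "'a::comm_semiring_1 series" where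
  "series_one = (\<lambda>a. if a = 0 then 1 else 0)"

definition series_times :: "'a::comm_semiring_1 series \<Rightarrow> 'a series \<Rightarrow> 'a series" where
  "series_times F G = (\<lambda>a. \<Sum>(b, c)\<in>{(b, c). b + c = a}. F b * G c)"

definition sf_monomial :: "expo \<Rightarrow> 'a::comm_semiring_1 series" where
  "sf_monomial l =
     (\<lambda>a. if \<exists>\<pi>. bij \<pi> \<and> (\<forall>i. lookup a i = lookup l (\<pi> i)) then 1 else 0)"

definition sf_power_sum1 :: "nat \<Rightarrow> 'a::comm_semiring_1 series" where
  "sf_power_sum1 r = (\<lambda>a. if \<exists>i. a = Poly_Mapping.single i r then 1 else 0)"

definition sf_power_sum :: "expo \<Rightarrow> 'a::comm_semiring_1 series" where
  "sf_power_sum l =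
     foldr (\<lambda>i F. series_times (sf_power_sum1 (lookup l i)) F) [0..<partition_length l] series_one"

definition zee :: "expo \<Rightarrow> nat" where
  "zee l = (\<Prod>i\<in>{1..partition_size l}. i ^ part_mult l i * fact (part_mult l i))"


section \<open>Jack symmetric functions\<close>

type_synonym ratfun = "rat poly fract"

definition tau :: ratfun where
  "tau = Fract [:0, 1:] 1"

text \<open>Coordinates of a symmetric function in the basis of power sums.\<close>

definition power_sum_coords :: "ratfun series \<Rightarrow> expo \<Rightarrow>\<^sub>0 ratfun" where
  "power_sum_coords F =
     (THE c. keys c \<subseteq> int_partitions \<and>
        F = (\<lambda>a. \<Sum>l\<in>keys c. lookup c l * sf_power_sum l a))"

text \<open>The bilinear form with \<open>\<langle>p\<^sub>\<lambda>, p\<^sub>\<mu>\<rangle> = \<delta>\<^sub>\<lambda>\<^sub>\<mu> z\<^sub>\<lambda> \<tau>\<close> to the power \<open>-\<ell>(\<lambda>)\<close>.\<close>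

definition jack_form :: "ratfun series \<Rightarrow> ratfun series \<Rightarrow> ratfun" where
  "jack_form F G =
     (\<Sum>l\<in>keys (power_sum_coords F).
        lookup (power_sum_coords F) l * lookup (power_sum_coords G) l *
        of_nat (zee l) * inverse tau ^ partition_length l)"

definition is_jack_family :: "(expo \<Rightarrow> ratfun series) \<Rightarrow> bool" where
  "is_jack_family P \<longleftrightarrow>
     (\<forall>l\<in>int_partitions. \<exists>K. P l = (\<lambda>a. sf_monomial l a +
        (\<Sum>m\<in>{m \<in> int_partitions. m \<noteq> l \<and> majorizes l m}. K m * sf_monomial m a))) \<and>
     (\<forall>l\<in>int_partitions. \<forall>m\<in>int_partitions. l \<noteq> m \<longrightarrow> jack_form (P l) (P m) = 0)"

text \<open>
  The family is unique on partitions only (its values at other arguments are unconstrained), so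
  the description operator is applied to each member rather than to the whole family.
\<close>

definition jack :: "expo \<Rightarrow> ratfun series" where
  "jack l = (THE F. \<exists>P. is_jack_family P \<and> F = P l)"


section \<open>Polynomials in finitely many variables\<close>

type_synonym 'a mvpoly = "expo \<Rightarrow>\<^sub>0 'a"

text \<open>Setting \<open>x\<^sub>i = 0\<close> for \<open>i \<ge> n\<close>; applied to series of bounded degree only.\<close>

definition restrict_vars :: "nat \<Rightarrow> 'a::comm_semiring_1 series \<Rightarrow> 'a mvpoly" where
  "restrict_vars n F = Abs_poly_mapping (\<lambda>a. if keys a \<subseteq> {..<n} then F a else 0)"

definition mv_eval :: "(nat \<Rightarrow> 'a) \<Rightarrow> 'a::comm_semiring_1 mvpoly \<Rightarrow> 'a" where
  "mv_eval x f = (\<Sum>a\<in>keys f. lookup f a * (\<Prod>i\<in>keys a. x i ^ lookup a i))"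

definition mv_const :: "'a::comm_semiring_1 \<Rightarrow> 'a mvpoly" where
  "mv_const c = Poly_Mapping.single 0 c"

definition normalize_at_one :: "'a::field mvpoly \<Rightarrow> 'a mvpoly" where
  "normalize_at_one f = mv_const (1 / mv_eval (\<lambda>_. 1) f) * f"

definition jack_poly :: "nat \<Rightarrow> expo \<Rightarrow> ratfun mvpoly" where
  "jack_poly n l = restrict_vars n (jack l)"


section \<open>Specialization of the parameter\<close>

type_synonym real_ratfun = "real poly fract"

definition ratfun_to_real :: "ratfun \<Rightarrow> real_ratfun" where
  "ratfun_to_real f =
     (case quot_of_fract f of (p, q) \<Rightarrow> Fract (map_poly of_rat p) (map_poly of_rat q))"

definition real_const :: "real \<Rightarrow> real_ratfun" where
  "real_const c = Fract [:c:] 1"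

text \<open>
  Numerator and denominator given by \<open>quot_of_fract\<close> are coprime, so the following is the value
  of \<open>f\<close> at every \<open>t\<close> that is not a pole.
\<close>

definition ratfun_value :: "ratfun \<Rightarrow> real \<Rightarrow> real" where
  "ratfun_value f t =
     (case quot_of_fract f of (p, q) \<Rightarrow>
        poly (map_poly of_rat p) t / poly (map_poly of_rat q) t)"

definition ratfun_spec :: "ennreal \<Rightarrow> ratfun \<Rightarrow> real" where
  "ratfun_spec t f =
     (if t = \<infinity> then Lim at_top (ratfun_value f) else ratfun_value f (enn2real t))"

definition jack_poly_real :: "nat \<Rightarrow> expo \<Rightarrow> real_ratfun mvpoly" where
  "jack_poly_real n l = Poly_Mapping.map ratfun_to_real (jack_poly n l)"

definition jack_poly_at :: "nat \<Rightarrow> ennreal \<Rightarrow> expo \<Rightarrow> real mvpoly" where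
  "jack_poly_at n t l = Poly_Mapping.map (ratfun_spec t) (jack_poly n l)"


section \<open>Cones and the Muirhead semiring\<close>

definition F_nonneg :: "ratfun set" where
  "F_nonneg = {Fract f g | f g. (\<forall>i. coeff f i \<in> \<nat>) \<and> (\<forall>i. coeff g i \<in> \<nat>) \<and> g \<noteq> 0}"

definition F_nonneg_real :: "real_ratfun set" where
  "F_nonneg_real = {Fract f g | f g. (\<forall>i. coeff f i \<ge> 0) \<and> (\<forall>i. coeff g i \<ge> 0) \<and> g \<noteq> 0}"

definition muirhead_mean :: "nat \<Rightarrow> expo \<Rightarrow> 'a::field mvpoly" where
  "muirhead_mean n l = normalize_at_one (restrict_vars n (sf_monomial l))"

definition muirhead_generators :: "nat \<Rightarrow> 'a::field mvpoly set" where
  "muirhead_generators n =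
     {muirhead_mean n l - muirhead_mean n m | l m.
        l \<in> partitions_upto n \<and> m \<in> partitions_upto n \<and> majorizes l m} \<union>
     {muirhead_mean n l | l. l \<in> partitions_upto n}"

definition muirhead_semiring :: "nat \<Rightarrow> 'a::field set \<Rightarrow> 'a mvpoly set" where
  "muirhead_semiring n C =
     {\<Sum>j<k. mv_const (c j) * prod_list (gs j) | (k::nat) c gs.
        \<forall>j<k. c j \<in> C \<and> set (gs j) \<subseteq> muirhead_generators n}"


section \<open>The assertions\<close>

text \<open>A point of \<open>\<real>\<^sup>n\<close> is a function on \<open>nat\<close> of which only the values below \<open>n\<close> matter.\<close>

definition diff_generic :: "nat \<Rightarrow> expo \<Rightarrow> expo \<Rightarrow> (nat \<Rightarrow> real) \<Rightarrow> real_ratfun" where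
  "diff_generic n l m x =
     mv_eval (\<lambda>i. real_const (x i)) (jack_poly_real n l) / mv_eval (\<lambda>_. 1) (jack_poly_real n l) -
     mv_eval (\<lambda>i. real_const (x i)) (jack_poly_real n m) / mv_eval (\<lambda>_. 1) (jack_poly_real n m)"

definition diff_at :: "nat \<Rightarrow> ennreal \<Rightarrow> expo \<Rightarrow> expo \<Rightarrow> (nat \<Rightarrow> real) \<Rightarrow> real" where
  "diff_at n t l m x =
     mv_eval x (jack_poly_at n t l) / mv_eval (\<lambda>_. 1) (jack_poly_at n t l) -
     mv_eval x (jack_poly_at n t m) / mv_eval (\<lambda>_. 1) (jack_poly_at n t m)"

definition A1 :: "nat \<Rightarrow> expo \<Rightarrow> expo \<Rightarrow> bool" where
  "A1 n l m \<longleftrightarrow> (\<forall>x. (\<forall>i<n. 0 \<le> x i) \<longrightarrow> diff_generic n l m x \<in> F_nonneg_real)"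

definition A2 :: "nat \<Rightarrow> expo \<Rightarrow> expo \<Rightarrow> bool" where
  "A2 n l m \<longleftrightarrow> (\<forall>t x. (\<forall>i<n. 0 \<le> x i) \<longrightarrow> 0 \<le> diff_at n t l m x)"

definition A3 :: "nat \<Rightarrow> expo \<Rightarrow> expo \<Rightarrow> bool" where
  "A3 n l m \<longleftrightarrow>
     (\<exists>t. \<forall>x. (\<forall>i<n. 0 < x i \<and> x i < 1) \<or> (\<forall>i<n. 1 < x i) \<longrightarrow> 0 \<le> diff_at n t l m x)"

definition A4 :: "nat \<Rightarrow> expo \<Rightarrow> expo \<Rightarrow> bool" where
  "A4 n l m \<longleftrightarrow> majorizes l m"

definition B1 :: "nat \<Rightarrow> expo \<Rightarrow> expo \<Rightarrow> bool" where
  "B1 n l m \<longleftrightarrow>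
     (\<forall>x. (\<forall>i<n. 0 \<le> x i) \<longrightarrow> diff_generic n l m (\<lambda>i. x i + 1) \<in> F_nonneg_real)"

definition B2 :: "nat \<Rightarrow> expo \<Rightarrow> expo \<Rightarrow> bool" where
  "B2 n l m \<longleftrightarrow> (\<forall>t x. (\<forall>i<n. 0 \<le> x i) \<longrightarrow> 0 \<le> diff_at n t l m (\<lambda>i. x i + 1))"

definition B3 :: "nat \<Rightarrow> expo \<Rightarrow> expo \<Rightarrow> bool" where
  "B3 n l m \<longleftrightarrow> (\<exists>t. \<forall>x. (\<forall>i<n. 0 \<le> x i) \<longrightarrow> 0 \<le> diff_at n t l m (\<lambda>i. x i + 1))"

definition B4 :: "nat \<Rightarrow> expo \<Rightarrow> expo \<Rightarrow> bool" where
  "B4 n l m \<longleftrightarrow> weakly_majorizes l m"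

definition C1 :: "nat \<Rightarrow> expo \<Rightarrow> expo \<Rightarrow> bool" where
  "C1 n l m \<longleftrightarrow>
     normalize_at_one (jack_poly n l) - normalize_at_one (jack_poly n m)
       \<in> muirhead_semiring n F_nonneg"

definition C2 :: "nat \<Rightarrow> expo \<Rightarrow> expo \<Rightarrow> bool" where
  "C2 n l m \<longleftrightarrow>
     (\<forall>t. normalize_at_one (jack_poly_at n t l) - normalize_at_one (jack_poly_at n t m)
       \<in> muirhead_semiring n {c. 0 \<le> c})"

definition C3 :: "nat \<Rightarrow> expo \<Rightarrow> expo \<Rightarrow> bool" where
  "C3 n l m \<longleftrightarrow>
     (\<exists>t. normalize_at_one (jack_poly_at n t l) - normalize_at_one (jack_poly_at n t m)
       \<in> muirhead_semiring n {c. 0 \<le> c})"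

definition C4 :: "nat \<Rightarrow> expo \<Rightarrow> expo \<Rightarrow> bool" where
  "C4 n l m \<longleftrightarrow> majorizes l m"

end

theory Submission
  imports Defs
begin

text \<open>The Jack functions are joint eigenfunctions of the operators \<open>\<Sum>\<^sub>i Z\<^sub>i\<^sup>k x\<^sub>i \<partial>\<^sub>i\<close>,
  where \<open>Z\<^sub>i\<close> is the Heckman operator. On products of power sums these operators act by explicit
  matrices that are self-adjoint for the Jack inner product; on monomial functions they are triangular
  for dominance. Modulo \<open>\<tau>\<close> the eigenvalue at \<open>\<lambda>\<close> is \<open>\<Sum>\<^sub>i \<lambda>\<^sub>i\<^bsup>k+1\<^esup>\<close>, and a single large \<open>k\<close>
  separates all partitions of a given size, which yields existence and uniqueness of the Jack functions.
  The case \<open>k = 1\<close> gives a recursion for the coefficients \<open>K\<^bsub>\<lambda>\<mu>\<^esub>\<close> in which all terms are positive and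
  have no pole in \<open>[0, \<infinity>]\<close>. Hence a normalized Jack polynomial is a convex combination of Muirhead
  means \<open>M\<^sub>\<mu>\<close>, each of which dominates \<open>M\<^bsub>(1^|\<lambda>|)\<^esub>\<close>, so in part (i) all twelve assertions are true.

  For \<open>n = 2\<close> the normalized one-row Jack polynomials \<open>Q\<^sub>r\<close> satisfy
  \<open>Q\<^bsub>r+2\<^esub> - x y Q\<^sub>r = c\<^sub>r (M\<^bsub>(2)\<^esub> - M\<^bsub>(1,1)\<^esub>) Q\<^sub>r'\<close> with \<open>c\<^sub>r = (\<tau> + r + 1) / (2\<tau> + 1)\<close> and \<open>Q\<^sub>r'\<close>
  the polynomial \<open>Q\<^sub>r\<close> at \<open>\<tau> + 1\<close>; telescoping expresses the difference for \<open>\<lambda> \<succcurlyeq> \<mu>\<close> in the Muirhead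
  semiring. Conversely, growth of the values at \<open>(s, s)\<close> and \<open>(s, 1)\<close> forces majorization.\<close>

section \<open>Heckman operators on coefficient functions\<close>

text \<open>The exponent k = 1 cannot give orthogonality: its eigenvalue is
  \<open>square_sum\<close> minus 2 tau times \<open>weight_sum\<close>, and the incomparable
  partitions (4,1,1) and (3,3) agree in both. As orthogonality is demanded of all pairs, a large
  exponent has to separate them; k = 1 returns for the coefficients, because along strict dominance
  both statistics change strictly. The field Q(tau) is linearly ordered by leading coefficients,
  with tau above every constant. In this order the Jack form is positive definite and
  \<open>F_nonneg\<close> consists of nonnegative elements, so arguments over an arbitrary ordered
  field cover generic tau and real values together. Values at points of [0, infinity] are handled as
  limits, which respect sums and products; only the absence of poles has to be tracked. For n = 2
  the one-row polynomials are homogeneous Gegenbauer polynomials and M_(2) - M_(1,1) is (x - y)^2 /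
  2. The differences telescoped there are divisible by (x - y)^2, and the quotient lies in the
  family with parameter tau + 1, whose coefficients have no pole at tau = 0.\<close>

text \<open>Coefficient functions treat \<open>x\<^sub>0\<close> as a marked variable: \<open>mulp r\<close> is multiplication by the power sum
  \<open>p\<^sub>r\<close>, \<open>sh i r\<close> is multiplication by \<open>x\<^sub>i\<^sup>r\<close>, \<open>ddiff j\<close> is \<open>x\<^sub>0 / (x\<^sub>0 - x\<^sub>j) (1 - s\<^bsub>0j\<^esub>)\<close>, and \<open>dunkl t\<close> is
  the Heckman operator \<open>x\<^sub>0 \<partial>\<^sub>0 + t \<Sum>\<^sub>j (ddiff j - 1)\<close>. For other variables \<open>x\<^sub>j\<close> than those occurring in the
  monomial, the summand vanishes on functions divisible by \<open>x\<^sub>0\<close>, the only ones considered.\<close>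

definition sh :: "nat \<Rightarrow> nat \<Rightarrow> 'a::comm_ring_1 series \<Rightarrow> 'a series" where
  "sh i r f = (\<lambda>a. if r \<le> lookup a i then f (a - Poly_Mapping.single i r) else 0)"

definition mulp :: "nat \<Rightarrow> 'a::comm_ring_1 series \<Rightarrow> 'a series" where
  "mulp r f = (\<lambda>a. if r = 0 then 0 else \<Sum>i\<in>keys a. sh i r f a)"

definition theta :: "'a::comm_ring_1 series \<Rightarrow> 'a series" where
  "theta f = (\<lambda>a. of_nat (lookup a 0) * f a)"

definition pairup :: "nat \<Rightarrow> nat \<Rightarrow> nat \<Rightarrow> expo \<Rightarrow> expo" where
  "pairup j u v b = Poly_Mapping.update 0 u (Poly_Mapping.update j v b)"

text \<open>Read off from x_0 / (x_0 - x_j) (x_0^u x_j^v - x_0^v x_j^u), which for v < u is the sum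
  of x_0^i x_j^(u+v-i) over v < i \<le> u. The exponent \<open>lookup b 0\<close> occurs in it
  exactly when u is at least \<open>lookup b 0\<close> and at least \<open>lookup b j + 1\<close>;
  the transposed monomial contributes with the opposite sign.\<close>

definition ddiff :: "nat \<Rightarrow> 'a::comm_ring_1 series \<Rightarrow> 'a series" where
  "ddiff j f = (\<lambda>b. \<Sum>u\<in>{max (lookup b 0) (lookup b j + 1)..lookup b 0 + lookup b j}.
     f (pairup j u (lookup b 0 + lookup b j - u) b) - f (pairup j (lookup b 0 + lookup b j - u) u b))"

definition dunkl :: "'a::comm_ring_1 \<Rightarrow> 'a series \<Rightarrow> 'a series" where
  "dunkl t f = (\<lambda>b. of_nat (lookup b 0) * f b + t * (\<Sum>j\<in>keys b - {0}. ddiff j f b - f b))"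

definition perm :: "(nat \<Rightarrow> nat) \<Rightarrow> expo \<Rightarrow> expo" where
  "perm \<pi> a = Poly_Mapping.map_key \<pi> a"

abbreviation swap0 :: "nat \<Rightarrow> expo \<Rightarrow> expo" where
  "swap0 i \<equiv> perm (Transposition.transpose 0 i)"

text \<open>The sum of the images of f under exchanging x_0 and x_i, over all i. For f divisible by
  x_0 the sum may stop at \<open>keys b\<close>, since \<open>swap0 i b\<close> has exponent
  \<open>lookup b i\<close> at x_0.\<close>

definition symmetrize :: "'a::comm_ring_1 series \<Rightarrow> 'a series" where
  "symmetrize f = (\<lambda>b. \<Sum>i\<in>keys b. f (swap0 i b))"

definition symmetric :: "'a series \<Rightarrow> bool" where
  "symmetric f \<longleftrightarrow> (\<forall>\<pi> a. bij \<pi> \<longrightarrow> f (perm \<pi> a) = f a)"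

lemma lookup_perm: "bij \<pi> \<Longrightarrow> lookup (perm \<pi> a) i = lookup a (\<pi> i)"
  by (simp add: perm_def map_key.rep_eq bij_is_inj)

lemma lookup_swap0 [simp]: "lookup (swap0 j a) i = lookup a (Transposition.transpose 0 j i)"
  by (simp add: lookup_perm)

lemma keys_perm: "bij \<pi> \<Longrightarrow> keys (perm \<pi> a) = \<pi> -` keys a"
  by (auto simp: in_keys_iff lookup_perm)

lemma lookup_pairup: "j \<noteq> 0 \<Longrightarrow> lookup (pairup j u v b) i = (if i = 0 then u else if i = j then v else lookup b i)"
  by (simp add: pairup_def lookup_update)

lemma lookup_expo_minus: "lookup (a - b) i = lookup (a::expo) i - lookup b i"
  by (simp add: lookup_minus)

lemma sh_commute: "sh i r (sh j s f) = sh j s (sh i r f)"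
proof (rule ext)
  fix a
  have "a - Poly_Mapping.single i r - Poly_Mapping.single j s =
    a - Poly_Mapping.single j s - Poly_Mapping.single i r"
    by (rule poly_mapping_eqI) (simp add: lookup_expo_minus)
  then show "sh i r (sh j s f) a = sh j s (sh i r f) a"
    by (auto simp: sh_def lookup_expo_minus lookup_single when_def)
qed

lemma sh_sh: "sh i r (sh i s f) = sh i (r + s) f"
proof (rule ext)
  fix a
  have "a - Poly_Mapping.single i r - Poly_Mapping.single i s = a - Poly_Mapping.single i (r + s)"
    by (rule poly_mapping_eqI) (simp add: lookup_expo_minus lookup_single when_def)
  then show "sh i r (sh i s f) a = sh i (r + s) f a"
    by (auto simp: sh_def lookup_expo_minus)
qed

lemma sh_0 [simp]: "sh i 0 f = f"
  by (auto simp: sh_def)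

lemma sh_add: "sh i r (\<lambda>a. f a + g a) = (\<lambda>a. sh i r f a + sh i r g a)"
  by (auto simp: sh_def)

lemma sh_sum: "sh i r (\<lambda>a. \<Sum>x\<in>I. f x a) = (\<lambda>a. \<Sum>x\<in>I. sh i r (f x) a)"
  by (auto simp: sh_def)

lemma sh_eq_0: "i \<notin> keys a \<Longrightarrow> r \<noteq> 0 \<Longrightarrow> sh i r f a = 0"
  by (auto simp: sh_def in_keys_iff)

lemma mulp_superset:
  assumes "r \<noteq> 0" "finite I" "keys a \<subseteq> I"
  shows "mulp r f a = (\<Sum>i\<in>I. sh i r f a)"
  using assms by (auto simp: mulp_def sh_eq_0 intro!: sum.mono_neutral_left)

lemma mulp_0: "mulp 0 f = (\<lambda>a. 0)" "mulp r (\<lambda>a. 0) = (\<lambda>a. 0)"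
  by (auto simp: mulp_def sh_def)

lemma mulp_sh: "mulp r (sh i s f) = sh i s (mulp r f)"
proof (rule ext)
  fix a
  show "mulp r (sh i s f) a = sh i s (mulp r f) a"
  proof (cases "r = 0")
    case True
    then show ?thesis by (simp add: mulp_def sh_def)
  next
    case False
    have k: "keys (a - Poly_Mapping.single i s) \<subseteq> keys a"
      by (auto simp: in_keys_iff lookup_expo_minus)
    have "mulp r (sh i s f) a = (\<Sum>j\<in>keys a. sh i s (sh j r f) a)"
      using False by (simp add: mulp_def sh_commute)
    also have "\<dots> = sh i s (mulp r f) a"
      using mulp_superset[OF False finite_keys k, of f] by (simp add: sh_def[of i s])
    finally show ?thesis .
  qed
qed

lemma mulp_commute: "mulp r (mulp s f) = mulp s (mulp r f)"
proof (rule ext)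
  fix a
  have "mulp r (mulp s f) a = mulp s (mulp r f) a" if "r \<noteq> 0" "s \<noteq> 0"
  proof -
    have "mulp r (mulp s f) a = (\<Sum>i\<in>keys a. mulp s (sh i r f) a)"
      using that by (simp add: mulp_def[of r] mulp_sh)
    also have "\<dots> = (\<Sum>i\<in>keys a. \<Sum>j\<in>keys a. sh j s (sh i r f) a)"
      using that by (simp add: mulp_def)
    also have "\<dots> = (\<Sum>j\<in>keys a. \<Sum>i\<in>keys a. sh i r (sh j s f) a)"
      by (subst sum.swap) (simp add: sh_commute)
    also have "\<dots> = (\<Sum>j\<in>keys a. mulp r (sh j s f) a)"
      using that by (simp add: mulp_def)
    also have "\<dots> = mulp s (mulp r f) a"
      using that by (simp add: mulp_def[of s] mulp_sh)
    finally show ?thesis .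
  qed
  then show "mulp r (mulp s f) a = mulp s (mulp r f) a"
    by (cases "r = 0 \<or> s = 0") (auto simp: mulp_0)
qed

lemma mulp_add: "mulp r (\<lambda>a. f a + g a) = (\<lambda>a. mulp r f a + mulp r g a)"
  by (auto simp: mulp_def sh_add sum.distrib)

lemma mulp_cmult: "mulp r (\<lambda>a. c * f a) = (\<lambda>a. c * mulp r f a)"
  by (rule ext) (auto simp: mulp_def sh_def sum_distrib_left intro!: sum.cong)

lemma theta_sh: "theta (sh 0 j f) = (\<lambda>a. sh 0 j (theta f) a + of_nat j * sh 0 j f a)"
  by (auto simp: theta_def sh_def lookup_expo_minus of_nat_diff algebra_simps)

lemma theta_mulp:
  assumes "r \<noteq> 0"
  shows "theta (mulp r f) = (\<lambda>a. mulp r (theta f) a + of_nat r * sh 0 r f a)"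
proof (rule ext)
  fix a
  have *: "of_nat (lookup a 0) * sh i r f a =
    sh i r (theta f) a + (if i = 0 then of_nat r * sh 0 r f a else 0)" for i
    by (auto simp: theta_def sh_def lookup_expo_minus lookup_single of_nat_diff algebra_simps)
  have "theta (mulp r f) a = (\<Sum>i\<in>insert 0 (keys a). of_nat (lookup a 0) * sh i r f a)"
    by (subst sum_distrib_left[symmetric], subst mulp_superset[symmetric])
      (use assms in \<open>auto simp: theta_def\<close>)
  also have "\<dots> = mulp r (theta f) a + of_nat r * sh 0 r f a"
    unfolding * sum.distrib by (subst mulp_superset[of r "insert 0 (keys a)"]) (use assms in auto)
  finally show "theta (mulp r f) a = mulp r (theta f) a + of_nat r * sh 0 r f a" .
qed

lemma symmetric_mulp: "symmetric f \<Longrightarrow> symmetric (mulp r f)"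
  unfolding symmetric_def
proof (intro allI impI)
  fix \<pi> :: "nat \<Rightarrow> nat" and a
  assume f: "\<forall>\<pi> a. bij \<pi> \<longrightarrow> f (perm \<pi> a) = f a" and b: "bij \<pi>"
  have "sh i r f (perm \<pi> a) = sh (\<pi> i) r f a" for i
  proof -
    have "perm \<pi> a - Poly_Mapping.single i r = perm \<pi> (a - Poly_Mapping.single (\<pi> i) r)"
      by (rule poly_mapping_eqI) (use b in \<open>auto simp: lookup_perm lookup_expo_minus lookup_single when_def bij_def inj_def\<close>)
    then show ?thesis using f b by (simp add: sh_def lookup_perm)
  qed
  moreover have "bij_betw \<pi> (keys (perm \<pi> a)) (keys a)"
    unfolding bij_betw_def keys_perm[OF b] surj_image_vimage_eq[OF bij_is_surj[OF b]]
    using inj_on_subset[OF bij_is_inj[OF b]] by auto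
  ultimately show "mulp r f (perm \<pi> a) = mulp r f a"
    by (auto simp: mulp_def intro: sum.reindex_bij_betw)
qed

lemma symmetric_one: "symmetric series_one"
proof -
  have "perm \<pi> a = 0 \<longleftrightarrow> a = 0" if "bij \<pi>" for \<pi> a
    using that by (metis keys_eq_empty keys_perm bij_is_surj surj_image_vimage_eq image_empty vimage_empty)
  then show ?thesis
    by (auto simp: symmetric_def series_one_def)
qed

text \<open>Product rule: with s exchanging x_0 and x_j, x_0 f - x_j s(f) = x_0 (f - s(f)) + (x_0 -
  x_j) s(f).\<close>

lemma ddiff_sh1:
  assumes "j \<noteq> 0"
  shows "ddiff j (sh 0 1 f) = sh 0 1 (\<lambda>b. ddiff j f b + f (swap0 j b))"
proof (rule ext)
  fix b
  show "ddiff j (sh 0 1 f) b = sh 0 1 (\<lambda>b. ddiff j f b + f (swap0 j b)) b"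
  proof (cases "lookup b 0")
    case 0
    then show ?thesis by (simp add: ddiff_def sh_def)
  next
    case (Suc m)
    define n where "n = lookup b j"
    define G where "G u v = f (pairup j u v b)" for u v
    define b' where "b' = b - Poly_Mapping.single 0 (Suc 0)"
    have l': "lookup b' 0 = m" "lookup b' j = n"
      using assms Suc by (auto simp: b'_def n_def lookup_expo_minus lookup_single)
    have p': "pairup j u v b' = pairup j u v b" for u v
      by (rule poly_mapping_eqI) (use assms in \<open>auto simp: lookup_pairup b'_def lookup_expo_minus lookup_single\<close>)
    have s': "swap0 j b' = pairup j n m b"
      by (rule poly_mapping_eqI)
        (use assms Suc in \<open>auto simp: lookup_pairup b'_def n_def lookup_expo_minus lookup_single Transposition.transpose_def when_def\<close>)
    have sG: "sh 0 1 f (pairup j u v b) = (if 1 \<le> u then G (u - 1) v else 0)" for u v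
    proof -
      have "pairup j u v b - Poly_Mapping.single 0 1 = pairup j (u - 1) v b"
        by (rule poly_mapping_eqI) (use assms in \<open>auto simp: lookup_pairup lookup_expo_minus lookup_single\<close>)
      then show ?thesis using assms by (simp add: sh_def G_def lookup_pairup)
    qed
    \<comment> \<open>Division by x_0 lowers the first index of \<open>G\<close>; in the negative
      sum it also removes the top term, where x_0 has exponent 0.\<close>
    have "ddiff j (sh 0 1 f) b = (\<Sum>u\<in>{max (Suc m) (n+1)..m+n+1}. G (u-1) (m+n+1-u)) -
       (\<Sum>u\<in>{max (Suc m) (n+1)..m+n+1}. if 1 \<le> m+n+1-u then G (m+n+1-u-1) u else 0)"
      unfolding ddiff_def sG Suc n_def[symmetric] sum_subtractf by (auto intro!: sum.cong arg_cong2[where f="(-)"])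
    also have "(\<Sum>u\<in>{max (Suc m) (n+1)..m+n+1}. G (u-1) (m+n+1-u)) = (\<Sum>u\<in>{max m n..m+n}. G u (m+n-u))"
      by (rule sum.reindex_bij_witness[of _ Suc "\<lambda>u. u - 1"]) auto
    also have "(\<Sum>u\<in>{max (Suc m) (n+1)..m+n+1}. if 1 \<le> m+n+1-u then G (m+n+1-u-1) u else 0) =
      (\<Sum>u\<in>{max (Suc m) (n+1)..m+n}. G (m+n-u) u)"
      by (rule sum.mono_neutral_cong_right) auto
    finally have 1: "ddiff j (sh 0 1 f) b = (\<Sum>u\<in>{max m n..m+n}. G u (m+n-u)) -
      (\<Sum>u\<in>{max (Suc m) (n+1)..m+n}. G (m+n-u) u)" .
    have 2: "sh 0 1 (\<lambda>b. ddiff j f b + f (swap0 j b)) b =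
      (\<Sum>u\<in>{max m (n+1)..m+n}. G u (m+n-u)) - (\<Sum>u\<in>{max m (n+1)..m+n}. G (m+n-u) u) + G n m"
      using Suc l' by (simp add: sh_def b'_def[symmetric] s' ddiff_def p' G_def sum_subtractf)
    \<comment> \<open>The summation ranges of 1 and 2 differ in a single index, whose term is
      \<open>G n m\<close>: u = n in the positive sum if m \<le> n, and u = m in the negative sum
      otherwise.\<close>
    show ?thesis
    proof (cases "m \<le> n")
      case True
      have "{max m n..m+n} = insert n {max m (n+1)..m+n}" using True by auto
      then have "(\<Sum>u\<in>{max m n..m+n}. G u (m+n-u)) = G n m + (\<Sum>u\<in>{max m (n+1)..m+n}. G u (m+n-u))"
        by simp
      moreover have "max (Suc m) (n+1) = max m (n+1)" using True by auto
      ultimately show ?thesis unfolding 1 2 by simp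
    next
      case False
      have "{max m (n+1)..m+n} = insert m {max (Suc m) (n+1)..m+n}" using False by auto
      then have "(\<Sum>u\<in>{max m (n+1)..m+n}. G (m+n-u) u) = G n m + (\<Sum>u\<in>{max (Suc m) (n+1)..m+n}. G (m+n-u) u)"
        by simp
      moreover have "max m n = max m (n+1)" using False by auto
      ultimately show ?thesis unfolding 1 2 by simp
    qed
  qed
qed

lemma symmetric_swap0: "symmetric f \<Longrightarrow> f (swap0 j b) = f b"
  by (simp add: symmetric_def)

lemma ddiff_symmetric:
  assumes "symmetric g" "j \<noteq> 0"
  shows "ddiff j g b = 0"
proof -
  have p: "pairup j v u b = swap0 j (pairup j u v b)" for u v
    by (rule poly_mapping_eqI) (use assms in \<open>auto simp: lookup_pairup Transposition.transpose_def\<close>)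
  have "g (pairup j v u b) = g (pairup j u v b)" for u v
    unfolding p[of v u] by (rule symmetric_swap0[OF assms(1)])
  then show ?thesis unfolding ddiff_def by (intro sum.neutral) simp
qed

lemma sh_swap0:
  assumes "symmetric g"
  shows "sh i k g (swap0 j b) = sh (Transposition.transpose 0 j i) k g b"
proof -
  have "swap0 j b - Poly_Mapping.single i k = swap0 j (b - Poly_Mapping.single (Transposition.transpose 0 j i) k)"
    by (rule poly_mapping_eqI) (auto simp: lookup_expo_minus lookup_single when_def Transposition.transpose_def split: if_splits)
  then show ?thesis using symmetric_swap0[OF assms] by (simp add: sh_def)
qed

text \<open>The geometric sum x_0 (x_0^k - x_j^k) / (x_0 - x_j), obtained by iterating the product
  rule; the symmetric factor g passes through.\<close>

lemma ddiff_sh: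
  assumes "symmetric g" "j \<noteq> 0"
  shows "ddiff j (sh 0 k g) = (\<lambda>b. \<Sum>l<k. sh 0 (k - l) (sh j l g) b)"
proof (induction k)
  case 0
  then show ?case using assms by (auto simp: ddiff_symmetric)
next
  case (Suc k)
  have "ddiff j (sh 0 (Suc k) g) = ddiff j (sh 0 1 (sh 0 k g))"
    by (simp add: sh_sh)
  also have "\<dots> = sh 0 1 (\<lambda>b. ddiff j (sh 0 k g) b + sh 0 k g (swap0 j b))"
    by (rule ddiff_sh1[OF assms(2)])
  also have "\<dots> = (\<lambda>b. (\<Sum>l<k. sh 0 1 (sh 0 (k - l) (sh j l g)) b) + sh 0 1 (sh j k g) b)"
    by (simp add: Suc sh_swap0[OF assms(1)] sh_add sh_sum)
  also have "\<dots> = (\<lambda>b. \<Sum>l<Suc k. sh 0 (Suc k - l) (sh j l g) b)"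
    by (auto simp: sh_sh Suc_diff_le)
  finally show ?case .
qed

lemma symmetrize_sh:
  assumes "symmetric g" "j \<noteq> 0"
  shows "symmetrize (sh 0 j g) = mulp j g"
  using assms by (auto simp: symmetrize_def mulp_def sh_swap0)

text \<open>Subtracting 1 in each summand of the Heckman operator cancels the term l = 0 of the
  geometric sum. The sum over j then yields power sums: x_j^l summed over j \<noteq> 0 is p_l -
  x_0^l, and the k - 1 corrections x_0^l collect in the coefficient of x_0^k g.\<close>

lemma dunkl_sh:
  assumes "symmetric g" "k \<noteq> 0"
  shows "dunkl t (sh 0 k g) = (\<lambda>b. sh 0 k (theta g) b + (of_nat k - t * of_nat (k - 1)) * sh 0 k g b
     + t * (\<Sum>l\<in>{1..<k}. sh 0 (k - l) (mulp l g) b))"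
proof (rule ext)
  fix b
  have k: "{..<k} = insert 0 {1..<k}" using assms(2) by auto
  have "ddiff j (sh 0 k g) b - sh 0 k g b = (\<Sum>l\<in>{1..<k}. sh 0 (k - l) (sh j l g) b)" if "j \<noteq> 0" for j
    unfolding ddiff_sh[OF assms(1) that] k by simp
  then have "(\<Sum>j\<in>keys b - {0}. ddiff j (sh 0 k g) b - sh 0 k g b) =
     (\<Sum>j\<in>keys b - {0}. \<Sum>l\<in>{1..<k}. sh 0 (k - l) (sh j l g) b)"
    by (auto intro!: sum.cong)
  also have "\<dots> = (\<Sum>l\<in>{1..<k}. \<Sum>j\<in>keys b - {0}. sh j l (sh 0 (k - l) g) b)"
    by (subst sum.swap) (simp add: sh_commute)
  also have "\<dots> = (\<Sum>l\<in>{1..<k}. mulp l (sh 0 (k - l) g) b - sh 0 k g b)"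
  proof (rule sum.cong[OF refl])
    fix l assume l: "l \<in> {1..<k}"
    have "mulp l (sh 0 (k - l) g) b = (\<Sum>j\<in>insert 0 (keys b - {0}). sh j l (sh 0 (k - l) g) b)"
      using l by (intro mulp_superset) auto
    also have "\<dots> = sh 0 k g b + (\<Sum>j\<in>keys b - {0}. sh j l (sh 0 (k - l) g) b)"
      using l by (subst sum.insert) (auto simp: sh_sh)
    finally show "(\<Sum>j\<in>keys b - {0}. sh j l (sh 0 (k - l) g) b) = mulp l (sh 0 (k - l) g) b - sh 0 k g b"
      by simp
  qed
  also have "\<dots> = (\<Sum>l\<in>{1..<k}. sh 0 (k - l) (mulp l g) b) - of_nat (k - 1) * sh 0 k g b"
    by (simp add: sum_subtractf mulp_sh)
  finally have *: "(\<Sum>j\<in>keys b - {0}. ddiff j (sh 0 k g) b - sh 0 k g b) = \<dots>" .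
  have th: "of_nat (lookup b 0) * sh 0 k g b = sh 0 k (theta g) b + of_nat k * sh 0 k g b"
    using theta_sh[of k g, THEN fun_cong, of b] by (simp only: theta_def)
  show "dunkl t (sh 0 k g) b = sh 0 k (theta g) b + (of_nat k - t * of_nat (k - 1)) * sh 0 k g b
     + t * (\<Sum>l\<in>{1..<k}. sh 0 (k - l) (mulp l g) b)"
    unfolding dunkl_def * th by (simp add: algebra_simps)
qed

section \<open>Action on products of power sums\<close>

lemma sum_mset_eq_sum_count:
  fixes f :: "'b \<Rightarrow> 'a::comm_semiring_1"
  assumes "finite A" "set_mset M \<subseteq> A"
  shows "(\<Sum>x\<in>#M. f x) = (\<Sum>x\<in>A. of_nat (count M x) * f x)"
  using assms(2)
proof (induction M)
  case (add y M)
  have "(\<Sum>x\<in>A. of_nat (count (add_mset y M) x) * f x) =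
    (\<Sum>x\<in>A. (if x = y then f x else 0) + of_nat (count M x) * f x)"
    by (intro sum.cong) (auto simp: algebra_simps)
  then show ?case using add assms(1) by (simp add: sum.distrib)
qed simp

lemma sh_cmult: "sh i r (\<lambda>a. c * f a) = (\<lambda>a. c * sh i r f a)"
  by (auto simp: sh_def)

text \<open>The convention that \<open>mulp 0\<close> is zero makes the multiplications commute for
  all indices, so that \<open>psum\<close> can fold over a multiset without side conditions.\<close>

lemma comp_fun_commute_mulp: "comp_fun_commute mulp"
  by standard (auto simp: fun_eq_iff mulp_commute)

definition psum :: "nat multiset \<Rightarrow> 'a::comm_ring_1 series" where
  "psum M = fold_mset mulp series_one M"

lemma psum_empty [simp]: "psum {#} = series_one"
  by (simp add: psum_def)

lemma psum_add [simp]: "psum (add_mset r M) = mulp r (psum M)"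
  by (simp add: psum_def comp_fun_commute.fold_mset_add_mset[OF comp_fun_commute_mulp])

lemma symmetric_psum: "symmetric (psum M)"
  by (induction M) (simp_all add: symmetric_one symmetric_mulp)

text \<open>Leibniz rule for x_0 d/dx_0, which sends p_r to r x_0^r and so turns one factor at a
  time into a power of the marked variable.\<close>

lemma theta_psum:
  assumes "0 \<notin># M"
  shows "theta (psum M :: 'a::comm_ring_1 series) = (\<lambda>a. \<Sum>r\<in>#M. of_nat r * sh 0 r (psum (M - {#r#})) a)"
  using assms
proof (induction M)
  case empty
  then show ?case by (auto simp: theta_def series_one_def)
next
  case (add x M)
  have sm: "mulp x (\<lambda>a. \<Sum>r\<in>#N. g r a) = (\<lambda>a. \<Sum>r\<in>#N. mulp x (g r) a)" for N and g :: "nat \<Rightarrow> 'a series"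
    by (induction N) (simp_all add: mulp_0 mulp_add)
  have "theta (psum (add_mset x M) :: 'a series) = (\<lambda>a. mulp x (theta (psum M)) a + of_nat x * sh 0 x (psum M) a)"
    using add.prems by (simp add: theta_mulp)
  also have "\<dots> = (\<lambda>a. (\<Sum>r\<in>#M. of_nat r * sh 0 r (psum (add_mset x (M - {#r#}))) a) + of_nat x * sh 0 x (psum M) a)"
    using add by (simp add: sm mulp_cmult mulp_sh)
  also have "\<dots> = (\<lambda>a. (\<Sum>r\<in>#M. of_nat r * sh 0 r (psum (add_mset x M - {#r#})) a) + of_nat x * sh 0 x (psum M) a)"
    by (rule ext, rule arg_cong2[where f="(+)"], rule arg_cong[where f=sum_mset], rule image_mset_cong) auto
  finally show ?case by (simp add: add.commute)
qed

definition mparts :: "nat \<Rightarrow> nat multiset set" where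
  "mparts d = {M. 0 \<notin># M \<and> sum_mset M = d}"

definition marked :: "nat \<Rightarrow> (nat \<times> nat multiset) set" where
  "marked d = {(j, M). 1 \<le> j \<and> 0 \<notin># M \<and> j + sum_mset M = d}"

lemma finite_mparts: "finite (mparts d)"
proof -
  have "mparts d \<subseteq> mset ` {xs. set xs \<subseteq> {..d} \<and> length xs \<le> d}"
  proof
    fix M assume M: "M \<in> mparts d"
    obtain xs where xs: "M = mset xs" by (metis ex_mset)
    have "0 \<notin> set xs \<Longrightarrow> length xs \<le> sum_list xs" by (induction xs) auto
    moreover have "set xs \<subseteq> {..d}"
      using M xs member_le_sum_list by (auto simp: mparts_def sum_mset_sum_list)
    ultimately show "M \<in> mset ` {xs. set xs \<subseteq> {..d} \<and> length xs \<le> d}"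
      using M xs by (auto simp: mparts_def sum_mset_sum_list)
  qed
  then show ?thesis
    by (rule finite_subset) (intro finite_imageI finite_lists_length_le, simp)
qed

lemma finite_marked: "finite (marked d)"
proof -
  have "marked d \<subseteq> (\<lambda>(j, M). (j, M)) ` ({..d} \<times> (\<Union>e\<le>d. mparts e))"
    by (auto simp: marked_def mparts_def image_iff)
  then show ?thesis
    by (rule finite_subset) (auto intro!: finite_imageI finite_mparts)
qed

text \<open>Matrix entries on the basis \<open>x\<^sub>0\<^sup>j p\<^sub>M\<close>, encoded by \<open>(j, M)\<close>: \<open>beta M\<close> lists the coordinates of
  \<open>x\<^sub>0 \<partial>\<^sub>0 p\<^sub>M\<close>, and \<open>ell t x\<close> those of the Heckman operator applied to the basis element \<open>x\<close>.\<close>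

definition tmark :: "nat \<times> nat multiset \<Rightarrow> 'a::comm_ring_1 series" where
  "tmark x = sh 0 (fst x) (psum (snd x))"

definition unmark :: "nat \<times> nat multiset \<Rightarrow> nat multiset" where
  "unmark x = add_mset (fst x) (snd x)"

definition beta :: "nat multiset \<Rightarrow> nat \<times> nat multiset \<Rightarrow> 'a::comm_ring_1" where
  "beta M x = (if M = unmark x then of_nat (fst x * count M (fst x)) else 0)"

definition ell :: "'a::comm_ring_1 \<Rightarrow> nat \<times> nat multiset \<Rightarrow> nat \<times> nat multiset \<Rightarrow> 'a" where
  "ell t x y = (if fst x < fst y then beta (snd x) (fst y - fst x, snd y)
     else if fst y < fst x then (if snd y = add_mset (fst x - fst y) (snd x) then t else 0)
     else if x = y then of_nat (fst x) - t * of_nat (fst x - 1) else 0)"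

lemma theta_psum_marked:
  assumes "M \<in> mparts d"
  shows "theta (psum M) = (\<lambda>a. \<Sum>x\<in>marked d. beta M x * tmark x a)"
proof (rule ext)
  fix a
  have "theta (psum M) a = (\<Sum>r\<in>set_mset M. of_nat (count M r) * (of_nat r * tmark (r, M - {#r#}) a))"
    using assms by (simp add: theta_psum mparts_def sum_mset_eq_sum_count[of "set_mset M"] tmark_def)
  also have "\<dots> = (\<Sum>x\<in>{x\<in>marked d. M = unmark x}. of_nat (fst x * count M (fst x)) * tmark x a)"
    using assms by (intro sum.reindex_bij_witness[of _ fst "\<lambda>r. (r, M - {#r#})"])
      (auto simp: mparts_def marked_def unmark_def algebra_simps in_diff_count dest!: multi_member_split)
  also have "\<dots> = (\<Sum>x\<in>marked d. beta M x * tmark x a)"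
    using finite_marked by (intro sum.mono_neutral_cong_left) (auto simp: beta_def)
  finally show "theta (psum M) a = (\<Sum>x\<in>marked d. beta M x * tmark x a)" .
qed

text \<open>The three summands of \<open>dunkl_sh\<close> match three ranges of
  \<open>fst y\<close>: the derivative turns a factor p_r into r x_0^r and raises the exponent of
  x_0, the power sums p_l lower it by l, and the remaining term is diagonal.\<close>

lemma dunkl_tmark:
  assumes x: "x \<in> marked d"
  shows "dunkl t (tmark x :: 'a::comm_ring_1 series) = (\<lambda>a. \<Sum>y\<in>marked d. ell t x y * tmark y a)"
proof (rule ext)
  fix a
  obtain j N where xe: "x = (j, N)" and j: "1 \<le> j" and N: "0 \<notin># N" and d: "j + sum_mset N = d"
    using x by (auto simp: marked_def)
  have 1: "sh 0 j (theta (psum N)) a = (\<Sum>y\<in>{y\<in>marked d. j < fst y}. ell t x y * tmark y a)"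
  proof -
    have "theta (psum N :: 'a series) = (\<lambda>a. \<Sum>r\<in>set_mset N. of_nat (count N r * r) * sh 0 r (psum (N - {#r#})) a)"
      using N by (simp add: theta_psum sum_mset_eq_sum_count[of "set_mset N"] algebra_simps)
    then have "sh 0 j (theta (psum N) :: 'a series) a =
        (\<Sum>r\<in>set_mset N. of_nat (count N r * r) * tmark (j + r, N - {#r#}) a)"
      by (simp only: sh_sum sh_cmult sh_sh tmark_def fst_conv snd_conv)
    also have "\<dots> = (\<Sum>y\<in>{y\<in>marked d. j < fst y \<and> N = add_mset (fst y - j) (snd y)}. ell t x y * tmark y a)"
      using N j d by (intro sum.reindex_bij_witness[of _ "\<lambda>y. fst y - j" "\<lambda>r. (j + r, N - {#r#})"])
        (auto simp: marked_def xe ell_def beta_def unmark_def algebra_simps dest!: multi_member_split)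
    also have "\<dots> = (\<Sum>y\<in>{y\<in>marked d. j < fst y}. ell t x y * tmark y a)"
      using finite_marked by (intro sum.mono_neutral_left) (auto simp: xe ell_def beta_def unmark_def)
    finally show ?thesis .
  qed
  have 2: "t * (\<Sum>l\<in>{1..<j}. sh 0 (j - l) (mulp l (psum N)) a) =
     (\<Sum>y\<in>{y\<in>marked d. fst y < j}. ell t x y * tmark y a)"
  proof -
    have "t * (\<Sum>l\<in>{1..<j}. sh 0 (j - l) (mulp l (psum N)) a) =
      (\<Sum>l\<in>{1..<j}. t * tmark (j - l, add_mset l N) a)"
      by (simp add: tmark_def sum_distrib_left)
    also have "\<dots> = (\<Sum>y\<in>{y\<in>marked d. fst y < j \<and> snd y = add_mset (j - fst y) N}. ell t x y * tmark y a)"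
      using N j d by (intro sum.reindex_bij_witness[of _ "\<lambda>y. j - fst y" "\<lambda>l. (j - l, add_mset l N)"])
        (auto simp: marked_def xe ell_def)
    also have "\<dots> = (\<Sum>y\<in>{y\<in>marked d. fst y < j}. ell t x y * tmark y a)"
      using finite_marked by (intro sum.mono_neutral_left) (auto simp: xe ell_def)
    finally show ?thesis .
  qed
  have 3: "(of_nat j - t * of_nat (j - 1)) * sh 0 j (psum N) a =
     (\<Sum>y\<in>{y\<in>marked d. fst y = j}. ell t x y * tmark y a)"
  proof -
    have "(\<Sum>y\<in>{y\<in>marked d. fst y = j}. ell t x y * tmark y a) = (\<Sum>y\<in>{x}. ell t x y * tmark y a)"
      using finite_marked x by (intro sum.mono_neutral_right) (auto simp: xe ell_def)
    then show ?thesis by (simp add: xe ell_def tmark_def)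
  qed
  have "dunkl t (tmark x) a = (\<Sum>y\<in>{y\<in>marked d. j < fst y}. ell t x y * tmark y a) +
     (\<Sum>y\<in>{y\<in>marked d. fst y = j}. ell t x y * tmark y a) + (\<Sum>y\<in>{y\<in>marked d. fst y < j}. ell t x y * tmark y a)"
    using dunkl_sh[OF symmetric_psum, of j t N] j 1 2 3 by (simp add: xe tmark_def)
  also have "\<dots> = (\<Sum>y\<in>marked d. (if j < fst y then ell t x y * tmark y a else 0) +
      (if fst y = j then ell t x y * tmark y a else 0) + (if fst y < j then ell t x y * tmark y a else 0))"
    by (simp only: sum.distrib sum.inter_filter[OF finite_marked])
  also have "\<dots> = (\<Sum>y\<in>marked d. ell t x y * tmark y a)"
    by (rule sum.cong) auto
  finally show "dunkl t (tmark x) a = (\<Sum>y\<in>marked d. ell t x y * tmark y a)" .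
qed

lemma symmetrize_tmark: "x \<in> marked d \<Longrightarrow> symmetrize (tmark x) = psum (unmark x)"
  by (auto simp: tmark_def unmark_def marked_def symmetrize_sh symmetric_psum)

section \<open>Linearity and the matrices of the operators on power sums\<close>

definition lin :: "('a::comm_ring_1 series \<Rightarrow> 'a series) \<Rightarrow> bool" where
  "lin A \<longleftrightarrow> (\<forall>f g. A (\<lambda>a. f a + g a) = (\<lambda>a. A f a + A g a)) \<and> (\<forall>c f. A (\<lambda>a. c * f a) = (\<lambda>a. c * A f a))"

lemma lin_sum:
  assumes "lin A" "finite I"
  shows "A (\<lambda>a. \<Sum>i\<in>I. c i * f i a) = (\<lambda>a. \<Sum>i\<in>I. c i * A (f i) a)"
  using assms(2)
proof (induction I rule: finite_induct)
  case empty
  have "A (\<lambda>a. 0 * g a) = (\<lambda>a. 0 * A g a)" for g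
    using assms(1) unfolding lin_def by blast
  then show ?case by simp
next
  case (insert x I)
  then show ?case using assms(1) by (simp add: lin_def)
qed

lemma lin_comp: "lin A \<Longrightarrow> lin B \<Longrightarrow> lin (\<lambda>f. A (B f))"
  by (simp add: lin_def)

lemma lin_theta: "lin theta"
  by (auto simp: lin_def theta_def algebra_simps)

lemma lin_symmetrize: "lin symmetrize"
  by (auto simp: lin_def symmetrize_def sum.distrib sum_distrib_left)

lemma ddiff_add: "ddiff j (\<lambda>a. f a + g a) = (\<lambda>a. ddiff j f a + ddiff j g a)"
  by (auto simp: ddiff_def sum.distrib[symmetric] algebra_simps)

lemma ddiff_cmult: "ddiff j (\<lambda>a. c * f a) = (\<lambda>a. c * ddiff j f a)"
  by (simp add: ddiff_def sum_distrib_left algebra_simps)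

lemma lin_dunkl: "lin (dunkl t)"
  unfolding lin_def dunkl_def ddiff_add ddiff_cmult
  by (auto simp: fun_eq_iff algebra_simps sum.distrib sum_subtractf sum_distrib_left)

lemma lin_funpow: "lin A \<Longrightarrow> lin (A ^^ k)"
  by (induction k) (auto simp: lin_def)

text \<open>In variables \<open>x\<^sub>i\<close>, \<open>jop t k\<close> is the sum over \<open>i\<close> of the \<open>k\<close>-th power of the Heckman
  operator at \<open>i\<close> applied to the Euler operator at \<open>i\<close>.\<close>

definition jop :: "'a::comm_ring_1 \<Rightarrow> nat \<Rightarrow> 'a series \<Rightarrow> 'a series" where
  "jop t k f = symmetrize ((dunkl t ^^ k) (theta f))"

lemma lin_jop: "lin (jop t k)"
proof -
  have "jop t k = (\<lambda>f. symmetrize ((dunkl t ^^ k) (theta f)))"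
    by (auto simp: jop_def)
  then show ?thesis
    by (simp only:) (intro lin_comp[OF lin_symmetrize] lin_comp[OF lin_funpow[OF lin_dunkl]] lin_theta)
qed

text \<open>Row vectors of coordinates, multiplied by the matrix \<open>ell t\<close> from the right
  once for each application of \<open>dunkl t\<close>; fixing the degree d makes the index set
  finite.\<close>

fun ellpow :: "'a::comm_ring_1 \<Rightarrow> nat \<Rightarrow> nat \<Rightarrow> (nat \<times> nat multiset \<Rightarrow> 'a) \<Rightarrow> nat \<times> nat multiset \<Rightarrow> 'a" where
  "ellpow t d 0 u = u"
| "ellpow t d (Suc k) u = (\<lambda>y. \<Sum>x\<in>marked d. ellpow t d k u x * ell t x y)"

lemma dunkl_pow_marked:
  "(dunkl t ^^ k) (\<lambda>a. \<Sum>x\<in>marked d. u x * tmark x a) = (\<lambda>a. \<Sum>x\<in>marked d. ellpow t d k u x * tmark x a)"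
proof (induction k)
  case (Suc k)
  have "(dunkl t ^^ Suc k) (\<lambda>a. \<Sum>x\<in>marked d. u x * tmark x a) =
    dunkl t (\<lambda>a. \<Sum>x\<in>marked d. ellpow t d k u x * tmark x a)"
    using Suc by simp
  also have "\<dots> = (\<lambda>a. \<Sum>x\<in>marked d. ellpow t d k u x * dunkl t (tmark x) a)"
    by (rule lin_sum[OF lin_dunkl finite_marked])
  also have "\<dots> = (\<lambda>a. \<Sum>x\<in>marked d. ellpow t d k u x * (\<Sum>y\<in>marked d. ell t x y * tmark y a))"
    by (intro ext sum.cong) (auto simp: dunkl_tmark)
  also have "\<dots> = (\<lambda>a. \<Sum>y\<in>marked d. ellpow t d (Suc k) u y * tmark y a)"
    by (rule ext) (simp add: sum_distrib_left sum_distrib_right mult.assoc, rule sum.swap)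
  finally show ?case .
qed simp

text \<open>\<open>symmetrize\<close> sends the basis element x to the power sums of
  \<open>unmark x\<close>, so coordinates are collected along the fibres of
  \<open>unmark\<close>.\<close>

definition jmat :: "'a::comm_ring_1 \<Rightarrow> nat \<Rightarrow> nat \<Rightarrow> nat multiset \<Rightarrow> nat multiset \<Rightarrow> 'a" where
  "jmat t d k M M' = (\<Sum>x\<in>{x\<in>marked d. unmark x = M'}. ellpow t d k (beta M) x)"

lemma unmark_in: "x \<in> marked d \<Longrightarrow> unmark x \<in> mparts d"
  by (auto simp: marked_def unmark_def mparts_def)

lemma jop_psum:
  assumes "M \<in> mparts d"
  shows "jop t k (psum M) = (\<lambda>a. \<Sum>M'\<in>mparts d. jmat t d k M M' * psum M' a)"
proof (rule ext)
  fix a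
  have "jop t k (psum M) a = (\<Sum>x\<in>marked d. ellpow t d k (beta M) x * symmetrize (tmark x) a)"
    unfolding jop_def theta_psum_marked[OF assms] dunkl_pow_marked lin_sum[OF lin_symmetrize finite_marked] ..
  also have "\<dots> = (\<Sum>x\<in>marked d. ellpow t d k (beta M) x * psum (unmark x) a)"
    by (intro sum.cong) (auto simp: symmetrize_tmark)
  also have "\<dots> = (\<Sum>M'\<in>mparts d. \<Sum>x\<in>{x\<in>marked d. unmark x = M'}. ellpow t d k (beta M) x * psum (unmark x) a)"
    by (rule sum.group[symmetric]) (auto simp: finite_marked finite_mparts unmark_in)
  also have "\<dots> = (\<Sum>M'\<in>mparts d. jmat t d k M M' * psum M' a)"
    by (auto simp: jmat_def sum_distrib_right intro!: sum.cong)
  finally show "jop t k (psum M) a = (\<Sum>M'\<in>mparts d. jmat t d k M M' * psum M' a)" .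
qed

section \<open>Self-adjointness for the Jack inner product\<close>

definition pnorm :: "'a::field_char_0 \<Rightarrow> nat multiset \<Rightarrow> 'a" where
  "pnorm t M = of_nat (\<Prod>r\<in>set_mset M. r ^ count M r * fact (count M r)) * inverse t ^ size M"

lemma pnorm_superset:
  assumes "finite A" "set_mset M \<subseteq> A"
  shows "pnorm t M = of_nat (\<Prod>r\<in>A. r ^ count M r * fact (count M r)) * inverse t ^ size M"
  using assms unfolding pnorm_def
  by (subst prod.mono_neutral_left[of A "set_mset M"]) (auto simp: not_in_iff)

lemma pnorm_add:
  "pnorm t (add_mset r M) = pnorm t M * of_nat (r * count (add_mset r M) r) * inverse t"
proof -
  let ?A = "set_mset (add_mset r M)"
  have "(\<Prod>s\<in>?A. s ^ count (add_mset r M) s * fact (count (add_mset r M) s)) =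
     (\<Prod>s\<in>?A. (if s = r then r * Suc (count M r) else 1) * (s ^ count M s * fact (count M s)))"
    by (intro prod.cong) (auto simp: algebra_simps)
  also have "\<dots> = r * Suc (count M r) * (\<Prod>s\<in>?A. s ^ count M s * fact (count M s))"
    by (subst prod.distrib) simp
  finally show ?thesis
    by (simp add: pnorm_def[of t "add_mset r M"] pnorm_superset[of ?A M] subset_insertI)
qed

text \<open>If the marked basis element x is given the squared norm \<open>pnorm t (snd x)\<close>,
  then x_0 d/dx_0 is t times the adjoint of \<open>symmetrize\<close>: the factor in
  \<open>beta\<close> is exactly the one by which \<open>pnorm\<close> grows in
  \<open>pnorm_add\<close>.\<close>

lemma beta_pnorm:
  assumes "t \<noteq> 0"
  shows "beta M x * pnorm t (snd x) = (if M = unmark x then t * pnorm t M else 0)"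
  using assms by (auto simp: beta_def unmark_def pnorm_add)

text \<open>A transition that raises the exponent of x_0 has a value of \<open>beta\<close> as its
  entry, and the reverse transition has entry t; \<open>beta_pnorm\<close> balances the two. Thus
  the Heckman operator is self-adjoint on the marked space.\<close>

lemma ell_pnorm:
  assumes "t \<noteq> 0"
  shows "ell t x y * pnorm t (snd y) = ell t y x * pnorm t (snd x)"
proof -
  have *: "ell t x y * pnorm t (snd y) = ell t y x * pnorm t (snd x)" if "fst x < fst y" for x y
    using that beta_pnorm[OF assms, of "snd x" "(fst y - fst x, snd y)"]
    unfolding ell_def unmark_def by simp
  show ?thesis
  proof (cases "fst x" "fst y" rule: linorder_cases)
    case less
    then show ?thesis by (rule *)
  next
    case equal
    then show ?thesis by (cases "x = y") (simp_all add: ell_def)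
  next
    case greater
    then show ?thesis by (rule *[symmetric])
  qed
qed

lemma ellpow_adjoint:
  assumes "t \<noteq> 0"
  shows "(\<Sum>x\<in>marked d. ellpow t d k u x * v x * pnorm t (snd x)) =
    (\<Sum>x\<in>marked d. u x * ellpow t d k v x * pnorm t (snd x))"
proof -
  have step: "(\<Sum>y\<in>marked d. (\<Sum>x\<in>marked d. u x * ell t x y) * v y * pnorm t (snd y)) =
    (\<Sum>x\<in>marked d. u x * (\<Sum>y\<in>marked d. v y * ell t y x) * pnorm t (snd x))" for u v
  proof -
    have "(\<Sum>y\<in>marked d. (\<Sum>x\<in>marked d. u x * ell t x y) * v y * pnorm t (snd y)) =
       (\<Sum>y\<in>marked d. \<Sum>x\<in>marked d. u x * v y * (ell t x y * pnorm t (snd y)))"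
      by (simp add: sum_distrib_left sum_distrib_right mult_ac)
    also have "\<dots> = (\<Sum>x\<in>marked d. \<Sum>y\<in>marked d. u x * v y * (ell t y x * pnorm t (snd x)))"
      by (subst sum.swap) (simp add: ell_pnorm[OF assms])
    finally show ?thesis by (simp add: sum_distrib_left sum_distrib_right mult_ac)
  qed
  have comm: "ellpow t d k (\<lambda>y. \<Sum>x\<in>marked d. w x * ell t x y) = (\<lambda>y. \<Sum>x\<in>marked d. ellpow t d k w x * ell t x y)" for k w
    by (induction k) auto
  show ?thesis
  proof (induction k arbitrary: u v)
    case (Suc k)
    show ?case using Suc[of u "\<lambda>y. \<Sum>x\<in>marked d. v x * ell t x y"] by (simp add: step comm)
  qed simp
qed

text \<open>The operator is S D^k T with D self-adjoint and T equal to t times the adjoint of S.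
  Hence t times its form on p_M, p_M' is the marked form on D^k T p_M, T p_M', which is symmetric in
  M and M'.\<close>

lemma jmat_adjoint:
  assumes t: "t \<noteq> 0"
  shows "jmat t d k M M' * pnorm t M' = jmat t d k M' M * pnorm t M"
proof -
  have *: "t * (jmat t d k M M' * pnorm t M') =
     (\<Sum>x\<in>marked d. ellpow t d k (beta M) x * beta M' x * pnorm t (snd x))" for M M'
  proof -
    have "(\<Sum>x\<in>marked d. ellpow t d k (beta M) x * beta M' x * pnorm t (snd x)) =
       (\<Sum>x\<in>marked d. if unmark x = M' then ellpow t d k (beta M) x * (t * pnorm t M') else 0)"
      unfolding mult.assoc beta_pnorm[OF t] by (intro sum.cong) auto
    also have "\<dots> = (\<Sum>x\<in>{x\<in>marked d. unmark x = M'}. ellpow t d k (beta M) x * (t * pnorm t M'))"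
      using finite_marked by (simp add: sum.inter_filter)
    finally show ?thesis by (simp add: jmat_def sum_distrib_left sum_distrib_right mult_ac)
  qed
  have "t * (jmat t d k M M' * pnorm t M') = t * (jmat t d k M' M * pnorm t M)"
    unfolding * by (subst ellpow_adjoint[OF t]) (simp add: mult_ac)
  then show ?thesis using t by simp
qed

section \<open>Monomial functions and dominance\<close>

text \<open>A complete invariant of exponent vectors under permutations of the variables; zeros are
  left out, so the number of variables does not enter.\<close>

definition parts :: "expo \<Rightarrow> nat multiset" where
  "parts a = image_mset (lookup a) (mset_set (keys a))"

lemma zero_notin_parts [simp]: "0 \<notin># parts a"
  by (auto simp: parts_def in_keys_iff)

lemma size_parts: "size (parts a) = partition_length a"
  by (simp add: parts_def partition_length_def)

lemma sum_parts: "sum_mset (parts a) = partition_size a"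
  by (simp add: parts_def partition_size_def sum_unfold_sum_mset)

lemma parts_in_mparts: "parts a \<in> mparts (partition_size a)"
  by (simp add: mparts_def sum_parts)

lemma parts_0 [simp]: "parts 0 = {#}"
  by (simp add: parts_def)

lemma parts_eq_empty [simp]: "parts a = {#} \<longleftrightarrow> a = 0"
  by (simp add: parts_def mset_set_empty_iff)

lemma parts_perm:
  assumes "bij \<pi>"
  shows "parts (perm \<pi> a) = parts a"
proof -
  have "bij_betw \<pi> (keys (perm \<pi> a)) (keys a)"
    unfolding bij_betw_def keys_perm[OF assms] surj_image_vimage_eq[OF bij_is_surj[OF assms]]
    using inj_on_subset[OF bij_is_inj[OF assms]] by auto
  then have "mset_set (keys a) = image_mset \<pi> (mset_set (keys (perm \<pi> a)))"
    by (simp add: image_mset_mset_set bij_betw_def)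
  moreover have "lookup (perm \<pi> a) = lookup a \<circ> \<pi>"
    by (auto simp: lookup_perm assms)
  ultimately show ?thesis
    unfolding parts_def by (simp add: multiset.map_comp)
qed

lemma parts_superset:
  assumes "finite A" "keys a \<subseteq> A"
  shows "image_mset (lookup a) (mset_set A) = parts a + replicate_mset (card A - card (keys a)) 0"
proof -
  have "mset_set A = mset_set (keys a) + mset_set (A - keys a)"
    using assms by (metis Diff_disjoint Un_Diff_cancel finite_Diff finite_keys mset_set_Union sup.absorb2)
  moreover have "image_mset (lookup a) (mset_set (A - keys a)) = image_mset (\<lambda>_. 0) (mset_set (A - keys a))"
    using assms by (intro image_mset_cong) (auto simp: in_keys_iff)
  ultimately show ?thesis
    using assms by (simp add: parts_def image_mset_const_eq card_Diff_subset)
qed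

text \<open>Padding with zeros makes the two multisets of values equal on the union of the supports.
  The permutation fixes everything outside this union, which in \<open>orbit_mean\<close> keeps it
  within the first n variables.\<close>

lemma parts_eq_imp_permutes:
  assumes "parts a = parts b"
  shows "\<exists>\<pi>. \<pi> permutes (keys a \<union> keys b) \<and> a = perm \<pi> b"
proof -
  let ?A = "keys a \<union> keys b"
  have "card (keys a) = card (keys b)"
    using assms size_parts by (metis partition_length_def)
  then have eq: "image_mset (lookup a) (mset_set ?A) = image_mset (lookup b) (mset_set ?A)"
    using parts_superset[of ?A a] parts_superset[of ?A b] assms by simp
  obtain p where p: "p permutes ?A" "\<forall>x\<in>?A. lookup a x = lookup b (p x)"
    by (rule image_mset_eq_implies_permutes[of ?A "lookup a" "lookup b"]) (simp_all add: eq)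
  have "bij p" using p(1) by (rule permutes_bij)
  moreover have "a = perm p b"
  proof (rule poly_mapping_eqI)
    fix k
    show "lookup a k = lookup (perm p b) k"
    proof (cases "k \<in> ?A")
      case True
      then show ?thesis using p(2) by (simp add: lookup_perm[OF \<open>bij p\<close>])
    next
      case False
      then have "lookup a k = 0" "lookup b k = 0" by (simp_all add: in_keys_iff)
      then show ?thesis using permutes_not_in[OF p(1) False] by (simp add: lookup_perm[OF \<open>bij p\<close>])
    qed
  qed
  ultimately show ?thesis using p(1) by blast
qed

lemma parts_eq_imp_perm: "parts a = parts b \<Longrightarrow> \<exists>\<pi>. bij \<pi> \<and> a = perm \<pi> b"
  using parts_eq_imp_permutes permutes_bij by blast

lemma symmetric_parts: "symmetric f \<Longrightarrow> parts a = parts b \<Longrightarrow> f a = f b"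
  using parts_eq_imp_perm[of a b] by (auto simp: symmetric_def)

lemma sf_monomial_parts: "sf_monomial l a = (if parts a = parts l then 1 else 0)"
proof -
  have "(\<exists>\<pi>. bij \<pi> \<and> (\<forall>i. lookup a i = lookup l (\<pi> i))) \<longleftrightarrow> (\<exists>\<pi>. bij \<pi> \<and> a = perm \<pi> l)"
    by (metis lookup_perm poly_mapping_eqI)
  then show ?thesis
    unfolding sf_monomial_def using parts_eq_imp_perm[of a l] parts_perm by auto
qed

lemma partition_keys:
  assumes "l \<in> int_partitions"
  shows "keys l = {..<partition_length l}"
proof -
  have 1: "i \<in> keys l" if "j \<in> keys l" "i \<le> j" for i j
    using that assms antimonoD[of "lookup l" i j] by (auto simp: int_partitions_def in_keys_iff)
  define n where "n = (LEAST n. n \<notin> keys l)"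
  have 2: "n \<notin> keys l"
    using ex_new_if_finite[OF infinite_UNIV_nat finite_keys[of l]] unfolding n_def by (rule LeastI_ex)
  have 3: "i \<in> keys l" if "i < n" for i
    using not_less_Least[OF that[unfolded n_def]] by simp
  have "keys l = {..<n}"
  proof (rule set_eqI)
    fix i
    show "i \<in> keys l \<longleftrightarrow> i \<in> {..<n}"
      using 1[of i n] 2 3[of i] by (cases "i < n") auto
  qed
  then show ?thesis by (simp add: partition_length_def)
qed

lemma partition_list:
  assumes "l \<in> int_partitions"
  shows "map (lookup l) [0..<partition_length l] = rev (sorted_list_of_multiset (parts l))"
proof -
  let ?xs = "rev (map (lookup l) [0..<partition_length l])"
  have "sorted ?xs"
    using assms by (auto simp: sorted_iff_nth_mono rev_nth int_partitions_def antimono_def)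
  moreover have "mset ?xs = parts l"
    unfolding parts_def partition_keys[OF assms] lessThan_atLeast0 by simp
  ultimately have "?xs = sorted_list_of_multiset (parts l)"
    by (metis sorted_list_of_multiset_mset sorted_sort_id)
  then show ?thesis by (metis rev_rev_ident)
qed

lemma parts_inj:
  assumes "l \<in> int_partitions" "m \<in> int_partitions" "parts l = parts m"
  shows "l = m"
proof (rule poly_mapping_eqI)
  fix k
  have len: "partition_length l = partition_length m"
    using assms(3) size_parts by metis
  have e: "map (lookup l) [0..<partition_length l] = map (lookup m) [0..<partition_length l]"
    using partition_list[OF assms(1)] partition_list[OF assms(2)] assms(3) len by simp
  show "lookup l k = lookup m k"
  proof (cases "k < partition_length l")
    case True
    then show ?thesis using e by (simp add: map_eq_conv)
  next
    case False
    then have "k \<notin> keys l" "k \<notin> keys m"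
      using partition_keys[OF assms(1)] partition_keys[OF assms(2)] len by auto
    then show ?thesis by (simp add: in_keys_iff)
  qed
qed

lemma parts_surj:
  assumes "0 \<notin># M"
  shows "\<exists>l\<in>int_partitions. parts l = M"
proof -
  define xs where "xs = rev (sorted_list_of_multiset M)"
  define l where "l = Poly_Mapping.nth xs"
  have z: "0 \<notin> set xs" using assms by (simp add: xs_def)
  have ll: "lookup l i = (if i < length xs then xs ! i else 0)" for i
    by (simp add: l_def nth_default_def)
  have s: "sorted (rev xs)" by (simp add: xs_def)
  have "antimono (lookup l)"
    using s by (auto simp: antimono_def ll sorted_rev_iff_nth_mono)
  then have li: "l \<in> int_partitions" by (simp add: int_partitions_def)
  have "xs ! i \<noteq> 0" if "i < length xs" for i
    using z nth_mem[OF that] by metis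
  then have k: "keys l = {..<length xs}"
    by (auto simp: in_keys_iff ll split: if_splits)
  have "parts l = image_mset (\<lambda>i. xs ! i) (mset_set {..<length xs})"
    unfolding parts_def k by (intro image_mset_cong) (auto simp: ll)
  also have "\<dots> = mset (map (\<lambda>i. xs ! i) [0..<length xs])"
    by (simp only: mset_map lessThan_atLeast0 mset_upt)
  also have "\<dots> = M"
    by (simp only: map_nth xs_def mset_rev mset_sorted_list_of_multiset)
  finally show ?thesis using li by blast
qed

definition parts_of_size :: "nat \<Rightarrow> expo set" where
  "parts_of_size d = {l \<in> int_partitions. partition_size l = d}"

lemma bij_parts: "bij_betw parts (parts_of_size d) (mparts d)"
  unfolding bij_betw_def
proof
  show "inj_on parts (parts_of_size d)"
    by (auto simp: inj_on_def parts_of_size_def parts_inj)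
  show "parts ` parts_of_size d = mparts d"
  proof
    show "parts ` parts_of_size d \<subseteq> mparts d"
      using parts_in_mparts by (auto simp: parts_of_size_def)
    show "mparts d \<subseteq> parts ` parts_of_size d"
    proof
      fix M assume M: "M \<in> mparts d"
      then obtain l where "l \<in> int_partitions" "parts l = M"
        using parts_surj by (auto simp: mparts_def)
      then show "M \<in> parts ` parts_of_size d"
        using M sum_parts[of l] by (auto simp: parts_of_size_def mparts_def)
    qed
  qed
qed

lemma finite_parts_of_size: "finite (parts_of_size d)"
  using bij_parts finite_mparts bij_betw_finite by blast

lemma sort_expo: "\<exists>l\<in>parts_of_size (partition_size a). parts l = parts a"
  using bij_parts[of "partition_size a"] parts_in_mparts[of a] by (metis bij_betw_imp_surj_on imageE)

lemma symmetric_expansion: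
  fixes f :: "'a::comm_ring_1 series"
  assumes "symmetric f" "\<And>a. f a \<noteq> 0 \<Longrightarrow> partition_size a = d"
  shows "f = (\<lambda>a. \<Sum>l\<in>parts_of_size d. f l * sf_monomial l a)"
proof (rule ext)
  fix a
  have *: "(\<Sum>l\<in>parts_of_size d. f l * sf_monomial l a) = (\<Sum>l\<in>{l\<in>parts_of_size d. parts l = parts a}. f l)"
    using finite_parts_of_size by (intro sum.mono_neutral_cong_right) (auto simp: sf_monomial_parts)
  show "f a = (\<Sum>l\<in>parts_of_size d. f l * sf_monomial l a)"
  proof (cases "partition_size a = d")
    case True
    then obtain m where m: "m \<in> parts_of_size d" "parts m = parts a"
      using sort_expo[of a] by blast
    then have "{l\<in>parts_of_size d. parts l = parts a} = {m}"
      using parts_inj by (auto simp: parts_of_size_def)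
    then show ?thesis using * symmetric_parts[OF assms(1) m(2)] by simp
  next
    case False
    then have "{l\<in>parts_of_size d. parts l = parts a} = {}"
      using sum_parts by (auto simp: parts_of_size_def) metis
    moreover have "f a = 0" using assms(2) False by blast
    ultimately show ?thesis using * by (simp only: sum.empty)
  qed
qed

lemma symmetric_sf_monomial: "symmetric (sf_monomial l)"
  by (simp add: symmetric_def sf_monomial_parts parts_perm)

text \<open>Division by x_i^r either removes a part r or shrinks a part and keeps the number of
  parts; this dichotomy drives \<open>psum_support\<close>.\<close>

lemma parts_remove:
  assumes "r \<noteq> 0" "r \<le> lookup a i"
  shows "parts a = (if lookup a i = r then add_mset r (parts (a - Poly_Mapping.single i r))
     else add_mset (lookup a i) (parts (a - Poly_Mapping.single i r) - {#lookup a i - r#}))"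
    and "card (keys a) = (if lookup a i = r then Suc else (\<lambda>x. x)) (card (keys (a - Poly_Mapping.single i r)))"
    and "partition_size a = partition_size (a - Poly_Mapping.single i r) + r"
proof -
  let ?b = "a - Poly_Mapping.single i r"
  have i: "i \<in> keys a" using assms by (auto simp: in_keys_iff)
  have b: "lookup ?b j = (if j = i then lookup a i - r else lookup a j)" for j
    by (auto simp: lookup_expo_minus lookup_single)
  have ka: "keys a = insert i (keys ?b - {i})" using i by (auto simp: in_keys_iff b split: if_splits)
  have pa: "parts a = add_mset (lookup a i) (image_mset (lookup ?b) (mset_set (keys ?b - {i})))"
  proof -
    have "parts a = add_mset (lookup a i) (image_mset (lookup a) (mset_set (keys ?b - {i})))"
      unfolding parts_def by (subst ka, subst mset_set.insert) auto
    also have "image_mset (lookup a) (mset_set (keys ?b - {i})) = image_mset (lookup ?b) (mset_set (keys ?b - {i}))"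
      by (intro image_mset_cong) (auto simp: b)
    finally show ?thesis .
  qed
  have kb: "i \<in> keys ?b \<longleftrightarrow> lookup a i \<noteq> r" using assms by (auto simp: in_keys_iff b)
  have pb: "parts ?b = (if lookup a i = r then image_mset (lookup ?b) (mset_set (keys ?b - {i}))
     else add_mset (lookup a i - r) (image_mset (lookup ?b) (mset_set (keys ?b - {i}))))"
  proof (cases "lookup a i = r")
    case True
    then show ?thesis using kb by (simp add: parts_def)
  next
    case False
    then have "mset_set (keys ?b) = add_mset i (mset_set (keys ?b - {i}))"
      using kb by (subst mset_set.remove[of _ i]) auto
    then have "parts ?b = image_mset (lookup ?b) (add_mset i (mset_set (keys ?b - {i})))"
      unfolding parts_def by (rule arg_cong)
    then show ?thesis using False by (simp add: b)
  qed
  show pa': "parts a = (if lookup a i = r then add_mset r (parts ?b)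
     else add_mset (lookup a i) (parts ?b - {#lookup a i - r#}))"
    unfolding pa pb by auto
  show "card (keys a) = (if lookup a i = r then Suc else (\<lambda>x. x)) (card (keys ?b))"
  proof -
    have "card (keys a) = Suc (card (keys ?b - {i}))"
      by (subst ka, subst card_insert_disjoint) auto
    then show ?thesis using kb card_Suc_Diff1[of "keys ?b" i] by (cases "i \<in> keys ?b") auto
  qed
  have "sum_mset (parts a) = sum_mset (parts ?b) + r"
    unfolding pa pb using assms by auto
  then show "partition_size a = partition_size ?b + r" by (simp only: sum_parts)
qed

lemma psum_nonneg: "0 \<le> (psum M a :: 'a::linordered_idom)"
  by (induction M arbitrary: a) (auto simp: series_one_def mulp_def sh_def intro!: sum_nonneg)

text \<open>Exponents in a product of power sums are sums of groups of the parts of M. Factors that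
  fall on the same variable merge, so the number of variables drops unless every factor has a
  variable of its own.\<close>

lemma psum_support:
  assumes "0 \<notin># M" "psum M a \<noteq> (0::'a::comm_ring_1)"
  shows "partition_size a = sum_mset M \<and> card (keys a) \<le> size M \<and> (card (keys a) = size M \<longrightarrow> parts a = M)"
  using assms
proof (induction M arbitrary: a)
  case empty
  then show ?case by (auto simp: series_one_def partition_size_def split: if_splits)
next
  case (add r M)
  then have r: "r \<noteq> 0" by auto
  have "(\<Sum>i\<in>keys a. sh i r (psum M) a) \<noteq> (0::'a)"
    using add.prems r by (simp add: mulp_def)
  then obtain i where "sh i r (psum M) a \<noteq> (0::'a)"
    by (meson sum.not_neutral_contains_not_neutral)
  then have i: "r \<le> lookup a i" "psum M (a - Poly_Mapping.single i r) \<noteq> (0::'a)"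
    by (auto simp: sh_def split: if_splits)
  then show ?case
    using add.IH[of "a - Poly_Mapping.single i r"] add.prems(1) parts_remove[OF r i(1)] by (auto split: if_splits)
qed

text \<open>Diagonal entry of the triangular system of \<open>psum_support\<close>: some term gives
  each factor its own variable, and all terms are nonnegative.\<close>

lemma psum_pos:
  assumes "0 \<notin># M" "parts a = M"
  shows "0 < (psum M a :: 'a::linordered_idom)"
  using assms
proof (induction M arbitrary: a)
  case empty
  then show ?case by (auto simp: series_one_def)
next
  case (add r M)
  then have r: "r \<noteq> 0" by auto
  have "r \<in># parts a" using add.prems by simp
  then obtain i where i: "i \<in> keys a" "lookup a i = r" by (auto simp: parts_def)
  have "parts (a - Poly_Mapping.single i r) = M"
    using parts_remove(1)[OF r, of a i] i(2) add.prems(2) by simp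
  then have "0 < (psum M (a - Poly_Mapping.single i r) :: 'a)"
    using add by auto
  then have "0 < sh i r (psum M :: 'a series) a" using i by (simp add: sh_def)
  then have "0 < (\<Sum>i\<in>keys a. sh i r (psum M :: 'a series) a)"
    using i(1) by (intro sum_pos2[of _ i]) (auto simp: sh_def psum_nonneg)
  then show ?case using r by (simp add: mulp_def)
qed

lemma finite_expo_pairs: "finite {(b, c). b + c = (a :: expo)}"
proof -
  have "{(b, c). b + c = a} \<subseteq> (\<lambda>b. (b, a - b)) ` {b. \<forall>i. lookup b i \<le> lookup a i}"
    by (auto simp: image_iff lookup_add)
  moreover have "finite {b. \<forall>i. lookup b i \<le> lookup a i}"
  proof -
    have "lookup ` {b. \<forall>i. lookup b i \<le> lookup a i} \<subseteq>
      {f. \<forall>i. (i \<in> keys a \<longrightarrow> f i \<in> {..(\<Sum>i\<in>keys a. lookup a i)}) \<and> (i \<notin> keys a \<longrightarrow> f i = 0)}"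
    proof (clarify, intro conjI impI)
      fix b i assume b: "\<forall>i. lookup b i \<le> lookup a i"
      show "lookup b i \<in> {..\<Sum>i\<in>keys a. lookup a i}" if "i \<in> keys a"
        using b[rule_format, of i] member_le_sum[OF that, of "lookup a"] by simp
      show "lookup b i = 0" if "i \<notin> keys a"
        using b[rule_format, of i] that by (simp add: in_keys_iff)
    qed
    then have "finite (lookup ` {b. \<forall>i. lookup b i \<le> lookup a i})"
      by (rule finite_subset) (intro finite_set_of_finite_funs, auto)
    then show ?thesis by (rule finite_imageD) (auto simp: inj_on_def poly_mapping_eqI)
  qed
  ultimately show ?thesis using finite_subset by blast
qed

lemma series_times_power_sum1:
  assumes "r \<noteq> 0"
  shows "series_times (sf_power_sum1 r) F = mulp r F"
proof (rule ext)
  fix a :: expo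
  let ?I = "{i\<in>keys a. r \<le> lookup a i}"
  let ?g = "\<lambda>i. (Poly_Mapping.single i r, a - Poly_Mapping.single i r)"
  let ?P = "{(b, c). b + c = a}"
  have le: "lookup b i \<le> lookup a i" if "b + c = a" for b c i
    using that by (auto simp: lookup_add)
  have sub: "?g ` ?I = {(b, c). b + c = a \<and> (\<exists>i. b = Poly_Mapping.single i r)}"
  proof -
    have "b + (a - b) = a" if "b = Poly_Mapping.single i r" "r \<le> lookup a i" for b i
      using that by (intro poly_mapping_eqI) (auto simp: lookup_add lookup_expo_minus lookup_single when_def)
    moreover have "c = a - b" if "b + c = a" for b c :: expo using that by auto
    moreover have "i \<in> ?I" if "b + c = a" "b = Poly_Mapping.single i r" for b c i
      using le[OF that(1), of i] that assms by (auto simp: in_keys_iff)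
    ultimately show ?thesis by (auto simp: image_iff)
  qed
  have fin: "finite ?P" by (rule finite_expo_pairs)
  have inj: "inj_on ?g ?I"
  proof (rule inj_onI)
    fix i j assume "?g i = ?g j"
    then have "lookup (Poly_Mapping.single i r) i = lookup (Poly_Mapping.single j r) i" by simp
    then show "i = j" using assms by (simp add: lookup_single when_def split: if_splits)
  qed
  have "series_times (sf_power_sum1 r) F a = (\<Sum>(b, c)\<in>?g ` ?I. F c)"
    unfolding series_times_def sub using fin
    by (intro sum.mono_neutral_cong_right) (auto simp: sf_power_sum1_def split: if_splits)
  also have "\<dots> = (\<Sum>i\<in>?I. F (a - Poly_Mapping.single i r))"
    by (subst sum.reindex[OF inj]) (simp add: case_prod_beta)
  also have "\<dots> = mulp r F a"
    using assms by (simp add: mulp_def sh_def sum.inter_filter)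
  finally show "series_times (sf_power_sum1 r) F a = mulp r F a" .
qed

lemma sf_power_sum_psum:
  assumes "l \<in> int_partitions"
  shows "sf_power_sum l = psum (parts l)"
proof -
  have "foldr (\<lambda>i F. series_times (sf_power_sum1 (lookup l i)) F) is series_one =
     psum (mset (map (lookup l) is))" if "\<forall>i\<in>set is. lookup l i \<noteq> 0" for "is"
    using that by (induction "is") (auto simp: series_times_power_sum1)
  moreover have "\<forall>i\<in>set [0..<partition_length l]. lookup l i \<noteq> 0"
    using partition_keys[OF assms] by (metis atLeastLessThan_upt atLeastLessThan_iff in_keys_iff lessThan_iff)
  moreover have "mset (map (lookup l) [0..<partition_length l]) = parts l"
    unfolding partition_list[OF assms] by simp
  ultimately show ?thesis unfolding sf_power_sum_def by metis
qed

lemma count_parts: "i \<noteq> 0 \<Longrightarrow> count (parts l) i = part_mult l i"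
proof -
  assume i: "i \<noteq> 0"
  have "count (parts l) i = card {j \<in> keys l. lookup l j = i}"
  proof -
    have "count (parts l) i = (\<Sum>x | x \<in> keys l \<and> i = lookup l x. count (mset_set (keys l)) x)"
      by (simp add: parts_def count_image_mset')
    also have "\<dots> = (\<Sum>x | x \<in> keys l \<and> lookup l x = i. 1)"
      by (intro sum.cong) auto
    finally show ?thesis by simp
  qed
  also have "{j \<in> keys l. lookup l j = i} = {j. lookup l j = i}"
    using i by (auto simp: in_keys_iff)
  finally show ?thesis by (simp add: part_mult_def)
qed

lemma pnorm_zee: "pnorm t (parts l) = of_nat (zee l) * inverse t ^ partition_length l"
proof -
  have "set_mset (parts l) \<subseteq> {1..partition_size l}"
  proof
    fix x assume x: "x \<in># parts l"
    then have "x \<le> partition_size l"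
      unfolding sum_parts[symmetric] by (auto dest!: multi_member_split)
    moreover have "x \<noteq> 0" using x zero_notin_parts[of l] by metis
    ultimately show "x \<in> {1..partition_size l}" by simp
  qed
  then have "pnorm t (parts l) = of_nat (\<Prod>r\<in>{1..partition_size l}. r ^ count (parts l) r * fact (count (parts l) r)) * inverse t ^ size (parts l)"
    by (intro pnorm_superset) auto
  also have "(\<Prod>r\<in>{1..partition_size l}. r ^ count (parts l) r * fact (count (parts l) r)) = zee l"
    unfolding zee_def by (intro prod.cong) (auto simp: count_parts)
  finally show ?thesis by (simp add: size_parts)
qed

section \<open>Triangularity for the dominance order\<close>

lemma sum_le_initial:
  assumes "antimono f" "finite S"
  shows "sum f S \<le> (\<Sum>i<card S. (f i :: nat))"
  using assms(2)
proof (induction S rule: finite_linorder_max_induct)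
  case (insert b A)
  have "A \<subseteq> {..<b}" using insert by auto
  then have "card A \<le> b" using card_mono[of "{..<b}" A] by simp
  then have "f b \<le> f (card A)" using antimonoD[OF assms(1)] by blast
  moreover have "b \<notin> A" using insert by auto
  ultimately show ?case using insert by simp
qed simp

lemma partition_size_superset:
  assumes "finite A" "keys a \<subseteq> A"
  shows "partition_size a = (\<Sum>i\<in>A. lookup a i)"
  unfolding partition_size_def using assms by (intro sum.mono_neutral_left) (auto simp: in_keys_iff)

text \<open>Dominance for exponent vectors that need not be sorted: arbitrary finite index sets
  replace initial segments on the side of \<open>b\<close>, which makes the notion invariant under
  permutations of the variables.\<close>

definition dominated :: "expo \<Rightarrow> expo \<Rightarrow> bool" where
  "dominated l b \<longleftrightarrow> partition_size b = partition_size l \<and>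
     (\<forall>S. finite S \<longrightarrow> (\<Sum>i\<in>S. lookup b i) \<le> (\<Sum>i<card S. lookup l i))"

lemma dominated_refl: "l \<in> int_partitions \<Longrightarrow> dominated l l"
  using sum_le_initial by (auto simp: dominated_def int_partitions_def)

lemma dominated_parts:
  assumes "dominated l b" "parts a = parts b"
  shows "dominated l a"
proof -
  obtain \<pi> where \<pi>: "bij \<pi>" "a = perm \<pi> b" using parts_eq_imp_perm[OF assms(2)] by blast
  have "partition_size a = partition_size b" using sum_parts[of a] sum_parts[of b] assms(2) by simp
  moreover have "(\<Sum>i\<in>S. lookup a i) \<le> (\<Sum>i<card S. lookup l i)" if "finite S" for S
  proof -
    have "inj_on \<pi> S" using \<pi>(1) by (meson bij_is_inj inj_on_subset subset_UNIV)
    then have "(\<Sum>i\<in>S. lookup a i) = (\<Sum>i\<in>\<pi> ` S. lookup b i)" "card (\<pi> ` S) = card S"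
      using \<pi> by (simp_all add: sum.reindex lookup_perm card_image)
    then show ?thesis using assms(1) that by (metis dominated_def finite_imageI)
  qed
  ultimately show ?thesis using assms(1) by (simp add: dominated_def)
qed

lemma dominated_imp_majorizes: "dominated l m \<Longrightarrow> majorizes l m"
  unfolding dominated_def majorizes_def weakly_majorizes_def by (metis card_lessThan finite_lessThan)

text \<open>Convexity: compared with \<open>pairup j u v b\<close>, the entries of b at 0 and j have
  the same sum and are no farther apart. Only sets S containing exactly one of the two positions are
  critical, and there that position is traded for the one carrying the larger of u and v.\<close>

lemma dominated_line:
  assumes j: "j \<noteq> 0" and dom: "dominated l (pairup j u v b)"
    and uv: "u + v = lookup b 0 + lookup b j" "lookup b 0 \<le> max u v" "lookup b j \<le> max u v"
  shows "dominated l b"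
proof -
  define c where "c = pairup j u v b"
  have c: "lookup c i = (if i = 0 then u else if i = j then v else lookup b i)" for i
    unfolding c_def using j by (rule lookup_pairup)
  have eq: "(\<Sum>i\<in>S. lookup b i) = (\<Sum>i\<in>S. lookup c i)" if S: "finite S" "0 \<in> S" "j \<in> S" for S
  proof -
    have S': "S = insert 0 (insert j (S - {0, j}))" using S by auto
    have "(\<Sum>i\<in>S - {0, j}. lookup b i) = (\<Sum>i\<in>S - {0, j}. lookup c i)"
      by (rule sum.cong) (auto simp: c)
    then show ?thesis using S(1) j uv(1) by (subst (1 2) S') (simp add: c)
  qed
  let ?A = "insert 0 (insert j (keys b \<union> keys c))"
  have A: "finite ?A" "keys b \<subseteq> ?A" "keys c \<subseteq> ?A" by auto
  have "partition_size b = partition_size c"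
    using partition_size_superset[OF A(1,2)] partition_size_superset[OF A(1,3)] eq[OF A(1)] by simp
  moreover have "(\<Sum>i\<in>S. lookup b i) \<le> (\<Sum>i<card S. lookup l i)" if S: "finite S" for S
  proof -
    have dc: "(\<Sum>i\<in>T. lookup c i) \<le> (\<Sum>i<card T. lookup l i)" if "finite T" for T
      using dom that by (simp add: dominated_def c_def)
    have one: "(\<Sum>i\<in>S. lookup b i) \<le> (\<Sum>i<card S. lookup l i)"
      if p: "p \<in> S" "q \<notin> S" "{p, q} = {0, j}" for p q
    proof -
      let ?R = "S - {p}"
      define r where "r = (if u \<le> v then j else 0)"
      have "p = 0 \<or> p = j" "r = p \<or> r = q"
        using p(3) by (auto simp: r_def doubleton_eq_iff)
      then have r: "r \<in> {p, q}" "lookup b p \<le> lookup c r"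
        using uv j by (auto simp: c r_def)
      have "(\<Sum>i\<in>S. lookup b i) = lookup b p + (\<Sum>i\<in>?R. lookup b i)"
        using S p by (simp add: sum.remove)
      also have "(\<Sum>i\<in>?R. lookup b i) = (\<Sum>i\<in>?R. lookup c i)"
        using p by (intro sum.cong) (auto simp: c doubleton_eq_iff)
      also have "lookup b p + \<dots> \<le> (\<Sum>i\<in>insert r ?R. lookup c i)"
        using S r p by (subst sum.insert) auto
      also have "\<dots> \<le> (\<Sum>i<card (insert r ?R). lookup l i)"
        using S by (intro dc) auto
      also have "card (insert r ?R) = card S"
        using S r p card_Suc_Diff1[OF S p(1)] by (subst card_insert_disjoint) auto
      finally show ?thesis .
    qed
    consider "0 \<in> S" "j \<in> S" | "0 \<notin> S" "j \<notin> S" | "0 \<in> S" "j \<notin> S" | "j \<in> S" "0 \<notin> S" by blast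
    then show ?thesis
    proof cases
      case 1
      then show ?thesis using eq S dc by simp
    next
      case 2
      then have "(\<Sum>i\<in>S. lookup b i) = (\<Sum>i\<in>S. lookup c i)"
        by (intro sum.cong) (auto simp: c)
      then show ?thesis using S dc by simp
    next
      case 3
      then show ?thesis by (rule one) auto
    next
      case 4
      then show ?thesis by (rule one) auto
    qed
  qed
  ultimately show ?thesis using dom by (simp add: dominated_def c_def)
qed

text \<open>Every monomial that the geometric sum creates from an exponent vector lies on the
  segment between this vector and its transposed copy.\<close>

lemma ddiff_dominated:
  assumes "\<And>b. f b \<noteq> 0 \<Longrightarrow> dominated l b" "j \<noteq> 0" "ddiff j f b \<noteq> 0"
  shows "dominated l b"
proof -
  let ?s = "lookup b 0 + lookup b j"
  obtain u where u: "max (lookup b 0) (lookup b j + 1) \<le> u" "u \<le> ?s"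
      "f (pairup j u (?s - u) b) - f (pairup j (?s - u) u b) \<noteq> 0"
    using assms(3) unfolding ddiff_def by (auto elim!: sum.not_neutral_contains_not_neutral)
  then have "f (pairup j u (?s - u) b) \<noteq> 0 \<or> f (pairup j (?s - u) u b) \<noteq> 0" by auto
  then consider "dominated l (pairup j u (?s - u) b)" | "dominated l (pairup j (?s - u) u b)"
    using assms(1) by blast
  then show ?thesis
    by cases (use u assms(2) in \<open>auto elim!: dominated_line[rotated]\<close>)
qed

lemma jop_dominated:
  assumes f: "\<And>b. f b \<noteq> 0 \<Longrightarrow> dominated l b" and ne: "jop t k f b \<noteq> 0"
  shows "dominated l b"
proof -
  have d: "dominated l b" if "(dunkl t ^^ k) (theta f) b \<noteq> 0" for b
    using that
  proof (induction k arbitrary: b)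
    case 0
    then have "f b \<noteq> 0" by (auto simp: theta_def)
    then show ?case by (rule f)
  next
    case (Suc k)
    let ?g = "(dunkl t ^^ k) (theta f)"
    have "?g b \<noteq> 0 \<or> (\<exists>j\<in>keys b - {0}. ddiff j ?g b - ?g b \<noteq> 0)"
    proof (rule ccontr)
      assume "\<not> ?thesis"
      then have "?g b = 0" "(\<Sum>j\<in>keys b - {0}. ddiff j ?g b - ?g b) = 0"
        by (auto intro!: sum.neutral)
      then have "dunkl t ?g b = 0" by (subst dunkl_def) simp
      then show False using Suc.prems by simp
    qed
    then have "?g b \<noteq> 0 \<or> (\<exists>j. j \<noteq> 0 \<and> ddiff j ?g b \<noteq> 0)" by auto
    then show ?case using Suc.IH ddiff_dominated[of ?g l] by blast
  qed
  obtain i where "(dunkl t ^^ k) (theta f) (swap0 i b) \<noteq> 0"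
    using ne unfolding jop_def symmetrize_def by (auto elim!: sum.not_neutral_contains_not_neutral)
  then have "dominated l (swap0 i b)" by (rule d)
  then show ?thesis by (rule dominated_parts) (simp add: parts_perm)
qed

section \<open>The span of the power sums of one degree\<close>

definition inspan :: "nat \<Rightarrow> 'a::comm_ring_1 series \<Rightarrow> bool" where
  "inspan d F \<longleftrightarrow> (\<exists>c. F = (\<lambda>a. \<Sum>M\<in>mparts d. c M * psum M a))"

lemma inspan_psum: "M \<in> mparts d \<Longrightarrow> inspan d (psum M)"
  unfolding inspan_def
  by (rule exI[of _ "\<lambda>N. if N = M then 1 else 0"]) (auto simp: finite_mparts if_distrib[of "\<lambda>x. x * _"] cong: if_cong)

lemma inspan_0: "inspan d (\<lambda>a. 0)"
  unfolding inspan_def by (rule exI[of _ "\<lambda>N. 0"]) simp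

lemma inspan_add: "inspan d F \<Longrightarrow> inspan d G \<Longrightarrow> inspan d (\<lambda>a. F a + G a)"
  unfolding inspan_def
proof (elim exE)
  fix c c' assume "F = (\<lambda>a. \<Sum>M\<in>mparts d. c M * psum M a)" "G = (\<lambda>a. \<Sum>M\<in>mparts d. c' M * psum M a)"
  then show "\<exists>c. (\<lambda>a. F a + G a) = (\<lambda>a. \<Sum>M\<in>mparts d. c M * psum M a)"
    by (intro exI[of _ "\<lambda>M. c M + c' M"]) (simp add: algebra_simps sum.distrib)
qed

lemma inspan_cmult: "inspan d F \<Longrightarrow> inspan d (\<lambda>a. x * F a)"
  unfolding inspan_def
proof (elim exE)
  fix c assume "F = (\<lambda>a. \<Sum>M\<in>mparts d. c M * psum M a)"
  then show "\<exists>c. (\<lambda>a. x * F a) = (\<lambda>a. \<Sum>M\<in>mparts d. c M * psum M a)"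
    by (intro exI[of _ "\<lambda>M. x * c M"]) (simp add: sum_distrib_left mult.assoc)
qed

lemma inspan_sum: "(\<And>i. i \<in> I \<Longrightarrow> inspan d (F i)) \<Longrightarrow> inspan d (\<lambda>a. \<Sum>i\<in>I. c i * F i a)"
proof (induction I rule: infinite_finite_induct)
  case (insert x I)
  then show ?case
    using inspan_add[OF inspan_cmult[of d "F x" "c x"], of "\<lambda>a. \<Sum>i\<in>I. c i * F i a"] by simp
qed (simp_all add: inspan_0)

lemma inspan_symmetric: "inspan d F \<Longrightarrow> symmetric F"
  by (auto simp: inspan_def symmetric_def symmetric_psum[unfolded symmetric_def])

lemma inspan_size:
  assumes "inspan d F" "F a \<noteq> (0 :: 'a::comm_ring_1)"
  shows "partition_size a = d"
proof -
  obtain c where F: "F = (\<lambda>a. \<Sum>M\<in>mparts d. c M * psum M a)" using assms(1) by (auto simp: inspan_def)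
  then obtain M where M: "M \<in> mparts d" "c M * psum M a \<noteq> 0"
    using assms(2) by (auto elim!: sum.not_neutral_contains_not_neutral)
  then have "psum M a \<noteq> (0 :: 'a)" by auto
  with M show ?thesis using psum_support[of M a] by (auto simp: mparts_def)
qed

lemma inspan_expansion: "inspan d F \<Longrightarrow> F = (\<lambda>a. \<Sum>l\<in>parts_of_size d. F l * sf_monomial l a)"
  by (rule symmetric_expansion) (auto intro: inspan_symmetric inspan_size)

lemma inspan_jop:
  assumes "inspan d F"
  shows "inspan d (jop t k F)"
proof -
  obtain c where F: "F = (\<lambda>a. \<Sum>M\<in>mparts d. c M * psum M a)" using assms by (auto simp: inspan_def)
  show ?thesis
    unfolding F lin_sum[OF lin_jop finite_mparts]
    by (intro inspan_sum) (simp add: jop_psum, intro inspan_sum inspan_psum)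
qed

text \<open>Inversion of a triangular system: \<open>psum (parts l)\<close> is a nonzero multiple of
  \<open>sf_monomial l\<close> plus monomial functions of partitions with strictly fewer
  parts.\<close>

lemma inspan_monomial:
  assumes "l \<in> parts_of_size d"
  shows "inspan d (sf_monomial l :: 'a::linordered_field series)"
  using assms
proof (induction "card (keys l)" arbitrary: l rule: less_induct)
  case less
  let ?R = "\<lambda>m. psum (parts l) m :: 'a"
  have l: "l \<in> int_partitions" "partition_size l = d" using less.prems by (auto simp: parts_of_size_def)
  have pos: "?R l \<noteq> 0" using psum_pos[of "parts l" l, where 'a='a] by simp
  have sp: "inspan d ?R" using l parts_in_mparts[of l] by (simp add: inspan_psum)
  let ?S = "{m \<in> parts_of_size d. m \<noteq> l \<and> ?R m \<noteq> 0}"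
  have S: "inspan d (sf_monomial m :: 'a series)" if "m \<in> ?S" for m
  proof (rule less.hyps)
    show "m \<in> parts_of_size d" using that by simp
    have "card (keys m) \<le> size (parts l)" "card (keys m) = size (parts l) \<Longrightarrow> parts m = parts l"
      using psum_support[of "parts l" m, where 'a='a] that by auto
    moreover have "parts m \<noteq> parts l" using that l parts_inj by (auto simp: parts_of_size_def)
    ultimately show "card (keys m) < card (keys l)" by (auto simp: size_parts partition_length_def le_less)
  qed
  have "?R = (\<lambda>a. \<Sum>m\<in>parts_of_size d. ?R m * sf_monomial m a)" by (rule inspan_expansion[OF sp])
  also have "\<dots> = (\<lambda>a. \<Sum>m\<in>insert l ?S. ?R m * sf_monomial m a)"
    using finite_parts_of_size less.prems by (intro ext sum.mono_neutral_right) auto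
  also have "\<dots> = (\<lambda>a. ?R l * sf_monomial l a + (\<Sum>m\<in>?S. ?R m * sf_monomial m a))"
    using finite_parts_of_size by (subst sum.insert) auto
  finally have "sf_monomial l a = inverse (?R l) * (?R a + (-1) * (\<Sum>m\<in>?S. ?R m * sf_monomial m a))" for a
    using pos by (metis (no_types, lifting) add_diff_cancel_right' left_inverse mult.assoc mult_1 mult_minus1 uminus_add_conv_diff add.commute)
  then have "sf_monomial l = (\<lambda>a. inverse (?R l) * (?R a + (-1) * (\<Sum>m\<in>?S. ?R m * sf_monomial m a)))"
    by blast
  moreover have "inspan d \<dots>"
    by (intro inspan_cmult inspan_add sp inspan_sum S)
  ultimately show ?case by simp
qed

text \<open>Among the multisets with nonzero coefficient take one of maximal size and evaluate at an
  exponent vector with these parts; by \<open>psum_support\<close> the other products with nonzero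
  coefficient vanish there.\<close>

lemma psum_independent:
  fixes c :: "nat multiset \<Rightarrow> 'a::linordered_field"
  assumes "finite I" "\<And>M. M \<in> I \<Longrightarrow> 0 \<notin># M" "(\<lambda>a. \<Sum>M\<in>I. c M * psum M a) = (\<lambda>a. 0)" "M \<in> I"
  shows "c M = 0"
proof (rule ccontr)
  assume "c M \<noteq> 0"
  let ?N = "{M \<in> I. c M \<noteq> 0}"
  have N: "finite (size ` ?N)" "size ` ?N \<noteq> {}" using assms \<open>c M \<noteq> 0\<close> by auto
  obtain M0 where M0: "M0 \<in> ?N" "size M0 = Max (size ` ?N)" using Max_in[OF N] by auto
  have max: "size M \<le> size M0" if "M \<in> ?N" for M using that N M0 by simp
  obtain l where l: "parts l = M0" using parts_surj[of M0] M0 assms(2) by auto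
  have "(\<Sum>M\<in>I. c M * psum M l) = (\<Sum>M\<in>{M0}. c M * psum M l)"
  proof (rule sum.mono_neutral_right[OF assms(1)])
    show "\<forall>M\<in>I - {M0}. c M * psum M l = 0"
    proof (rule ballI, rule ccontr)
      fix M assume M: "M \<in> I - {M0}" "c M * psum M l \<noteq> 0"
      then have "card (keys l) \<le> size M" "card (keys l) = size M \<longrightarrow> parts l = M"
        using psum_support[of M l] assms(2) by auto
      moreover have "size M \<le> card (keys l)"
        using max[of M] M l size_parts[of l] by (auto simp: partition_length_def)
      ultimately show False using M l by auto
    qed
  qed (use M0 in auto)
  moreover have "(\<Sum>M\<in>I. c M * psum M l) = 0" using assms(3) by metis
  moreover have "psum M0 l > (0::'a)" using psum_pos[of M0 l] l M0 assms(2) by simp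
  ultimately show False using M0 by simp
qed

section \<open>The dominance order and two strictly monotone statistics\<close>

lemma majorizes_refl: "majorizes l l"
  by (simp add: majorizes_def weakly_majorizes_def)

lemma majorizes_trans: "majorizes l m \<Longrightarrow> majorizes m k \<Longrightarrow> majorizes l k"
  by (auto simp: majorizes_def weakly_majorizes_def intro: order_trans)

lemma majorizes_size: "majorizes l m \<Longrightarrow> partition_size m = partition_size l"
  by (simp add: majorizes_def)

lemma majorizes_antisym:
  assumes "majorizes l m" "majorizes m l"
  shows "l = m"
proof (rule poly_mapping_eqI)
  fix k
  have "(\<Sum>i<k. lookup m i) = (\<Sum>i<k. lookup l i)" for k
    using assms by (auto simp: majorizes_def weakly_majorizes_def intro: antisym)
  from this[of "Suc k"] this[of k] show "lookup l k = lookup m k" by simp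
qed

text \<open>The statistic usually written n(\<lambda>), with rows counted from 0; together with
  \<open>square_sum\<close> it forms the eigenvalue in \<open>jop1_diag\<close>.\<close>

definition weight_sum :: "expo \<Rightarrow> nat" where
  "weight_sum l = (\<Sum>i\<in>keys l. i * lookup l i)"

definition square_sum :: "expo \<Rightarrow> nat" where
  "square_sum l = (\<Sum>i\<in>keys l. (lookup l i)\<^sup>2)"

lemma summation_by_parts:
  fixes c x :: "nat \<Rightarrow> int"
  shows "(\<Sum>i<N. c i * x i) = c N * (\<Sum>i<N. x i) + (\<Sum>i<N. (c i - c (Suc i)) * (\<Sum>j<Suc i. x j))"
  by (induction N) (simp_all add: algebra_simps)

text \<open>Summation by parts with the partial sums D of x = l - m, which are nonnegative and
  vanish at N. The weights change by minus the sum of the values of D. For squares, |l|^2 = |m|^2 +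
  2 <m, x> + |x|^2, and <m, x> is nonnegative because m decreases.\<close>

lemma majorizes_strict:
  assumes m: "m \<in> int_partitions" and maj: "majorizes l m" and ne: "l \<noteq> m"
  shows "weight_sum l < weight_sum m" and "square_sum m < square_sum l"
proof -
  obtain N where N: "keys l \<union> keys m \<subseteq> {..<N}"
    using finite_nat_bounded[of "keys l \<union> keys m"] by auto
  define x where "x i = int (lookup l i) - int (lookup m i)" for i
  define D where "D k = (\<Sum>i<k. x i)" for k
  have D: "D k = int (\<Sum>i<k. lookup l i) - int (\<Sum>i<k. lookup m i)" for k
    by (simp add: D_def x_def sum_subtractf)
  have D0: "D k \<ge> 0" for k
    using maj by (simp add: D majorizes_def weakly_majorizes_def flip: of_nat_sum)
  have DN: "D N = 0"
    using maj N partition_size_superset[of "{..<N}" l] partition_size_superset[of "{..<N}" m]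
    by (simp add: D majorizes_def)
  have "\<exists>k<N. D (Suc k) \<noteq> 0"
  proof (rule ccontr)
    assume *: "\<not> ?thesis"
    have "D k = 0" if "k \<le> N" for k using * that by (cases k) (auto simp: D_def)
    then have "x k = 0" if "k < N" for k
      using that by (metis D_def Suc_leI add_0 less_imp_le sum.lessThan_Suc)
    moreover have "x k = 0" if "\<not> k < N" for k
    proof -
      have "k \<notin> keys l" "k \<notin> keys m" using that N by auto
      then show ?thesis by (simp add: x_def in_keys_iff)
    qed
    ultimately have "l = m" by (intro poly_mapping_eqI) (auto simp: x_def)
    then show False using ne by simp
  qed
  then obtain k where k: "k < N" "D (Suc k) > 0" using D0 by (metis order_le_less)
  have "(\<Sum>i<N. int i * x i) = - (\<Sum>i<N. D (Suc i))"
    unfolding summation_by_parts[of int x N] using DN by (simp add: D_def sum_negf[symmetric] algebra_simps)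
  moreover have "(\<Sum>i<N. D (Suc i)) > 0"
    using k D0 by (intro sum_pos2[of _ k]) auto
  moreover have w: "int (weight_sum a) = (\<Sum>i<N. int i * int (lookup a i))" if "keys a \<subseteq> {..<N}" for a
    unfolding weight_sum_def of_nat_sum of_nat_mult using that
    by (intro sum.mono_neutral_left) (auto simp: in_keys_iff)
  ultimately have "int (weight_sum l) < int (weight_sum m)"
    using N by (simp add: w x_def right_diff_distrib sum_subtractf)
  then show "weight_sum l < weight_sum m" by simp
  have "(\<Sum>i<N. int (lookup m i) * x i) = (\<Sum>i<N. (int (lookup m i) - int (lookup m (Suc i))) * D (Suc i))"
    unfolding summation_by_parts[of "\<lambda>i. int (lookup m i)" x N] using DN by (simp add: D_def)
  also have "\<dots> \<ge> 0"
    using m D0 by (intro sum_nonneg mult_nonneg_nonneg) (auto simp: int_partitions_def antimono_def)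
  finally have 1: "(\<Sum>i<N. int (lookup m i) * x i) \<ge> 0" .
  have "\<exists>i<N. x i \<noteq> 0"
  proof (rule ccontr)
    assume "\<not> ?thesis"
    then have "D (Suc k) = 0" using k(1) by (auto simp: D_def intro!: sum.neutral)
    then show False using k by simp
  qed
  then obtain i where "i < N" "x i \<noteq> 0" by blast
  then have 2: "(\<Sum>i<N. (x i)\<^sup>2) > 0"
    by (intro sum_pos2[of _ i]) auto
  have s: "int (square_sum a) = (\<Sum>i<N. (int (lookup a i))\<^sup>2)" if "keys a \<subseteq> {..<N}" for a
    unfolding square_sum_def of_nat_sum of_nat_power using that
    by (intro sum.mono_neutral_left) (auto simp: in_keys_iff)
  have "(\<Sum>i<N. (int (lookup l i))\<^sup>2) = (\<Sum>i<N. (int (lookup m i))\<^sup>2) + 2 * (\<Sum>i<N. int (lookup m i) * x i) + (\<Sum>i<N. (x i)\<^sup>2)"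
    by (simp add: x_def sum.distrib[symmetric] sum_distrib_left power2_eq_square algebra_simps)
  then have "int (square_sum m) < int (square_sum l)"
    using 1 2 N by (simp add: s)
  then show "square_sum m < square_sum l" by simp
qed

section \<open>Matrix entries of the operator with k = 1\<close>

lemma square_sum_parts: "square_sum a = (\<Sum>x\<in>#parts a. x\<^sup>2)"
  by (simp add: square_sum_def parts_def sum_unfold_sum_mset multiset.map_comp comp_def)

lemma square_sum_superset:
  assumes "finite A" "keys a \<subseteq> A"
  shows "square_sum a = (\<Sum>i\<in>A. (lookup a i)\<^sup>2)"
  unfolding square_sum_def using assms by (intro sum.mono_neutral_left) (auto simp: in_keys_iff)

text \<open>Equal parts force equal sums of squares; with u + v fixed this becomes (u - b_0)(u -
  b_j) = 0.\<close>

lemma pairup_parts: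
  assumes j: "j \<noteq> 0" and uv: "u + v = lookup b 0 + lookup b j" and p: "parts (pairup j u v b) = parts b"
  shows "u = lookup b 0 \<or> u = lookup b j"
proof -
  let ?c = "pairup j u v b"
  let ?B = "keys b \<union> keys ?c - {0, j}"
  let ?A = "insert 0 (insert j ?B)"
  have A: "finite ?A" "keys b \<subseteq> ?A" "keys ?c \<subseteq> ?A" by auto
  have "(\<Sum>i\<in>?A. (lookup ?c i)\<^sup>2) = (\<Sum>i\<in>?A. (lookup b i)\<^sup>2)"
    using p square_sum_superset[OF A(1,2)] square_sum_superset[OF A(1,3)] by (simp add: square_sum_parts)
  moreover have "(\<Sum>i\<in>?B. (lookup ?c i)\<^sup>2) = (\<Sum>i\<in>?B. (lookup b i)\<^sup>2)"
    using j by (intro sum.cong) (auto simp: lookup_pairup)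
  ultimately have "u\<^sup>2 + v\<^sup>2 = (lookup b 0)\<^sup>2 + (lookup b j)\<^sup>2"
    using j by (simp add: lookup_pairup)
  then have "(int u)\<^sup>2 + (int v)\<^sup>2 = (int (lookup b 0))\<^sup>2 + (int (lookup b j))\<^sup>2"
    by (metis of_nat_add of_nat_power)
  moreover have "int v = int (lookup b 0) + int (lookup b j) - int u" using uv by simp
  ultimately have "2 * ((int u - int (lookup b 0)) * (int u - int (lookup b j))) = 0"
    by (simp add: power2_eq_square algebra_simps)
  then show ?thesis by auto
qed

text \<open>The two values of f in each summand agree by symmetry, and the weights u and s - u from
  the derivative, s being the sum of both exponents, leave 2 u - s. This is positive on the whole
  range and is the source of all positivity below.\<close>

lemma ddiff_theta_symmetric:
  assumes "symmetric f" "j \<noteq> 0"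
  shows "ddiff j (theta f) b = (\<Sum>u\<in>{max (lookup b 0) (lookup b j + 1)..lookup b 0 + lookup b j}.
     of_nat (2 * u - (lookup b 0 + lookup b j)) * f (pairup j u (lookup b 0 + lookup b j - u) b))"
  unfolding ddiff_def
proof (rule sum.cong[OF refl])
  fix u assume u: "u \<in> {max (lookup b 0) (lookup b j + 1)..lookup b 0 + lookup b j}"
  let ?s = "lookup b 0 + lookup b j"
  have "pairup j (?s - u) u b = swap0 j (pairup j u (?s - u) b)"
    by (rule poly_mapping_eqI) (use assms in \<open>auto simp: lookup_pairup Transposition.transpose_def\<close>)
  then have "f (pairup j (?s - u) u b) = f (pairup j u (?s - u) b)"
    using symmetric_swap0[OF assms(1)] by metis
  moreover have "2 * u - ?s = u - (?s - u)" "?s - u \<le> u" using u by auto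
  ultimately show "theta f (pairup j u (?s - u) b) - theta f (pairup j (?s - u) u b) =
     of_nat (2 * u - ?s) * f (pairup j u (?s - u) b)"
    using assms(2) by (simp add: theta_def lookup_pairup of_nat_diff algebra_simps)
qed

text \<open>By \<open>pairup_parts\<close> only u = \<open>lookup b 0\<close> and u =
  \<open>lookup b j\<close> could contribute. The second lies below the range; the first lies in it
  only if it is the larger exponent, and otherwise the truncated difference is 0.\<close>

lemma ddiff_theta_monomial:
  assumes "j \<noteq> 0" "parts b = parts l"
  shows "ddiff j (theta (sf_monomial l)) b = (of_nat (lookup b 0 - lookup b j) :: 'a::comm_ring_1)"
proof -
  let ?s = "lookup b 0 + lookup b j"
  let ?I = "{max (lookup b 0) (lookup b j + 1)..?s}"
  have z: "sf_monomial l (pairup j u (?s - u) b) = (0::'a)" if "u \<in> ?I" "u \<noteq> lookup b 0" for u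
    using pairup_parts[OF assms(1), of u "?s - u" b] that assms(2)
    by (auto simp: sf_monomial_parts)
  have z': "of_nat (2 * u - ?s) * sf_monomial l (pairup j u (?s - u) b) = (0::'a)"
    if "u \<in> ?I - ?I \<inter> {lookup b 0}" for u
    using z[of u] that by auto
  have e: "pairup j (lookup b 0) (?s - lookup b 0) b = b"
    by (rule poly_mapping_eqI) (use assms in \<open>auto simp: lookup_pairup\<close>)
  have "ddiff j (theta (sf_monomial l) :: 'a series) b = (\<Sum>u\<in>?I \<inter> {lookup b 0}.
     of_nat (2 * u - ?s) * sf_monomial l (pairup j u (?s - u) b))"
    unfolding ddiff_theta_symmetric[OF symmetric_sf_monomial assms(1)]
  proof (rule sum.mono_neutral_right)
    show "\<forall>u\<in>?I - ?I \<inter> {lookup b 0}. of_nat (2 * u - ?s) * sf_monomial l (pairup j u (?s - u) b) = (0::'a)"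
      using z' by blast
  qed auto
  also have "\<dots> = (of_nat (lookup b 0 - lookup b j) :: 'a)"
  proof (cases "lookup b j < lookup b 0")
    case True
    then have "?I \<inter> {lookup b 0} = {lookup b 0}" by auto
    then show ?thesis using e assms(2) by (simp add: sf_monomial_parts)
  next
    case False
    then have "?I \<inter> {lookup b 0} = {}" by auto
    then show ?thesis using False by simp
  qed
  finally show ?thesis .
qed

lemma of_nat_sf_monomial: "of_nat (sf_monomial l a) = sf_monomial l a"
  by (simp add: sf_monomial_parts)

text \<open>Off the orbit of l the function itself vanishes, so only the \<open>ddiff\<close> terms
  remain, and these are natural numbers by \<open>ddiff_theta_symmetric\<close>.\<close>

lemma jop1_offdiag:
  fixes t :: "'a::comm_ring_1"
  assumes "parts b \<noteq> parts l"
  shows "\<exists>n. jop t 1 (sf_monomial l) b = t * of_nat n"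
proof -
  have 1: "\<exists>n. ddiff j (theta (sf_monomial l)) b = (of_nat n :: 'a)" if "j \<noteq> 0" for j b
    unfolding ddiff_theta_symmetric[OF symmetric_sf_monomial that]
    by (rule exI[of _ "\<Sum>u\<in>{max (lookup b 0) (lookup b j + 1)..lookup b 0 + lookup b j}.
     (2 * u - (lookup b 0 + lookup b j)) * sf_monomial l (pairup j u (lookup b 0 + lookup b j - u) b)"])
      (simp add: of_nat_sf_monomial)
  have 2: "\<exists>n. dunkl t (theta (sf_monomial l)) c = t * of_nat n" if "parts c \<noteq> parts l" for c
  proof -
    have "\<forall>j. \<exists>n. j \<noteq> 0 \<longrightarrow> ddiff j (theta (sf_monomial l)) c = (of_nat n :: 'a)"
      using 1 by blast
    then obtain n where n: "\<And>j. j \<noteq> 0 \<Longrightarrow> ddiff j (theta (sf_monomial l)) c = (of_nat (n j) :: 'a)"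
      by metis
    have "theta (sf_monomial l) c = (0 :: 'a)" using that by (simp add: theta_def sf_monomial_parts)
    then have "dunkl t (theta (sf_monomial l)) c = t * of_nat (\<Sum>j\<in>keys c - {0}. n j)"
      using n by (simp add: dunkl_def)
    then show ?thesis by blast
  qed
  have "\<exists>n. dunkl t (theta (sf_monomial l)) (swap0 i b) = t * of_nat n" for i
    using assms by (intro 2) (simp add: parts_perm)
  then obtain n where "\<And>i. dunkl t (theta (sf_monomial l)) (swap0 i b) = t * of_nat (n i)" by metis
  then have "jop t 1 (sf_monomial l) b = t * of_nat (\<Sum>i\<in>keys b. n i)"
    by (simp add: jop_def symmetrize_def sum_distrib_left)
  then show ?thesis by blast
qed

text \<open>For i < j the minimum is \<open>f j\<close>; each pair is counted twice, and j has j
  smaller indices.\<close>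

lemma sum_min_antimono:
  fixes f :: "nat \<Rightarrow> nat"
  assumes "antimono f"
  shows "(\<Sum>i<n. \<Sum>j\<in>{..<n} - {i}. min (f i) (f j)) = 2 * (\<Sum>j<n. j * f j)"
proof (induction n)
  case (Suc n)
  have m: "min (f i) (f n) = f n" "min (f n) (f i) = f n" if "i < n" for i
    using antimonoD[OF assms, of i n] that by auto
  have "(\<Sum>j\<in>{..<Suc n} - {i}. min (f i) (f j)) = f n + (\<Sum>j\<in>{..<n} - {i}. min (f i) (f j))" if "i < n" for i
  proof -
    have "{..<Suc n} - {i} = insert n ({..<n} - {i})" using that by auto
    then show ?thesis using m that by simp
  qed
  then have "(\<Sum>i<n. \<Sum>j\<in>{..<Suc n} - {i}. min (f i) (f j)) = (\<Sum>i<n. f n + (\<Sum>j\<in>{..<n} - {i}. min (f i) (f j)))"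
    by (intro sum.cong) auto
  also have "\<dots> = n * f n + 2 * (\<Sum>j<n. j * f j)"
    using Suc by (simp add: sum.distrib)
  finally have 1: "(\<Sum>i<n. \<Sum>j\<in>{..<Suc n} - {i}. min (f i) (f j)) = n * f n + 2 * (\<Sum>j<n. j * f j)" .
  have "{..<Suc n} - {n} = {..<n}" by auto
  then have "(\<Sum>j\<in>{..<Suc n} - {n}. min (f n) (f j)) = n * f n"
    using m by simp
  then show ?case using 1 by simp
qed simp

text \<open>Eigenvalue of the Laplace-Beltrami operator. Position i contributes the square of its
  part, and every other position j costs t times the minimum of both parts, which is what remains of
  part i after the truncated difference in \<open>ddiff_theta_monomial\<close> is
  subtracted.\<close>

lemma jop1_diag:
  fixes t :: "'a::comm_ring_1"
  assumes "l \<in> int_partitions"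
  shows "jop t 1 (sf_monomial l) l = of_nat (square_sum l) - t * of_nat (2 * weight_sum l)"
proof -
  have d: "dunkl t (theta (sf_monomial l)) (swap0 i l) =
     of_nat ((lookup l i)\<^sup>2) - t * of_nat (\<Sum>j\<in>keys l - {i}. min (lookup l i) (lookup l j))" if i: "i \<in> keys l" for i
  proof -
    let ?b = "swap0 i l"
    let ?h = "theta (sf_monomial l) :: 'a series"
    let ?T = "Transposition.transpose 0 i"
    have th: "?h ?b = of_nat (lookup l i)"
      by (simp add: theta_def sf_monomial_parts parts_perm)
    have "ddiff j (?h) ?b - ?h ?b =
       - of_nat (min (lookup l i) (lookup l (?T j)))" if "j \<noteq> 0" for j
      using that by (subst ddiff_theta_monomial) (auto simp: parts_perm th min_def of_nat_diff)
    then have "(\<Sum>j\<in>keys ?b - {0}. ddiff j (?h) ?b - ?h ?b) =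
       (\<Sum>j\<in>keys ?b - {0}. - of_nat (min (lookup l i) (lookup l (?T j))))"
      by (intro sum.cong) auto
    also have "\<dots> = (\<Sum>j\<in>keys l - {i}. - of_nat (min (lookup l i) (lookup l j)))"
    proof (rule sum.reindex_bij_witness[of _ ?T ?T])
      fix j assume "j \<in> keys ?b - {0}"
      then show "?T j \<in> keys l - {i}" by (auto simp: in_keys_iff Transposition.transpose_def split: if_splits)
    next
      fix j assume "j \<in> keys l - {i}"
      then show "?T j \<in> keys ?b - {0}" by (auto simp: in_keys_iff Transposition.transpose_def split: if_splits)
    qed auto
    finally have "(\<Sum>j\<in>keys ?b - {0}. ddiff j (?h) ?b - ?h ?b) =
       - of_nat (\<Sum>j\<in>keys l - {i}. min (lookup l i) (lookup l j))" by (simp add: sum_negf)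
    then have "dunkl t (?h) ?b = of_nat (lookup ?b 0) * ?h ?b +
       t * (- of_nat (\<Sum>j\<in>keys l - {i}. min (lookup l i) (lookup l j)))"
      by (subst dunkl_def) (simp only:)
    then show ?thesis by (simp add: th power2_eq_square)
  qed
  have "jop t 1 (sf_monomial l) l = (\<Sum>i\<in>keys l. of_nat ((lookup l i)\<^sup>2) - t * of_nat (\<Sum>j\<in>keys l - {i}. min (lookup l i) (lookup l j)))"
    by (simp add: jop_def symmetrize_def d)
  also have "\<dots> = of_nat (square_sum l) - t * of_nat (\<Sum>i\<in>keys l. \<Sum>j\<in>keys l - {i}. min (lookup l i) (lookup l j))"
    by (simp add: sum_subtractf sum_distrib_left square_sum_def)
  also have "(\<Sum>i\<in>keys l. \<Sum>j\<in>keys l - {i}. min (lookup l i) (lookup l j)) = 2 * weight_sum l"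
    using sum_min_antimono[of "lookup l" "partition_length l"] assms
    by (simp add: int_partitions_def weight_sum_def partition_keys[OF assms])
  finally show ?thesis .
qed

section \<open>Diagonal entries modulo tau\<close>

definition is_poly :: "ratfun \<Rightarrow> bool" where
  "is_poly x \<longleftrightarrow> (\<exists>p. x = to_fract p)"

lemma is_poly_of_nat [simp]: "is_poly (of_nat n)"
proof -
  have "of_nat n = to_fract (of_nat n :: rat poly)" by (induction n) simp_all
  then show ?thesis unfolding is_poly_def by blast
qed

lemma is_poly_0 [simp]: "is_poly 0" and is_poly_1 [simp]: "is_poly 1"
  using is_poly_of_nat[of 0] is_poly_of_nat[of 1] by simp_all

lemma tau_to_fract: "tau = to_fract [:0, 1:]"
  by (simp add: tau_def to_fract_def)

lemma is_poly_tau [simp]: "is_poly tau"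
  unfolding is_poly_def tau_to_fract by blast

lemma is_poly_ops: "is_poly x \<Longrightarrow> is_poly y \<Longrightarrow> is_poly (x + y)"
  "is_poly x \<Longrightarrow> is_poly y \<Longrightarrow> is_poly (x - y)"
  "is_poly x \<Longrightarrow> is_poly y \<Longrightarrow> is_poly (x * y)"
  unfolding is_poly_def by (metis to_fract_add, metis to_fract_diff, metis to_fract_mult)

lemma is_poly_sum: "(\<And>i. i \<in> I \<Longrightarrow> is_poly (f i)) \<Longrightarrow> is_poly (\<Sum>i\<in>I. f i)"
  by (induction I rule: infinite_finite_induct) (auto intro: is_poly_ops)

text \<open>At tau = 0 the Heckman operator degenerates to x_0 d/dx_0. Its values stay in Q[tau], so
  the remainder is a genuine multiple of tau.\<close>

lemma dunkl_pow_mod_tau: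
  assumes "\<And>b. is_poly (f b)"
  shows "\<exists>x. is_poly x \<and> (dunkl tau ^^ k) f b = of_nat (lookup b 0 ^ k) * f b + tau * x"
proof (induction k arbitrary: b)
  case 0
  show ?case by (rule exI[of _ 0]) simp
next
  case (Suc k)
  let ?g = "(dunkl tau ^^ k) f"
  have g: "is_poly (?g b)" for b
    using Suc[of b] by (auto intro!: is_poly_ops assms simp del: of_nat_power)
  obtain x where x: "is_poly x" "?g b = of_nat (lookup b 0 ^ k) * f b + tau * x" using Suc by blast
  let ?y = "of_nat (lookup b 0) * x + (\<Sum>j\<in>keys b - {0}. ddiff j ?g b - ?g b)"
  have "is_poly ?y"
    by (intro is_poly_ops is_poly_sum g x(1) is_poly_of_nat) (auto simp: ddiff_def intro!: is_poly_sum is_poly_ops g)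
  moreover have "(dunkl tau ^^ Suc k) f b = of_nat (lookup b 0 ^ Suc k) * f b + tau * ?y"
  proof -
    have "(dunkl tau ^^ Suc k) f b = of_nat (lookup b 0) * ?g b + tau * (\<Sum>j\<in>keys b - {0}. ddiff j ?g b - ?g b)"
      by (simp only: funpow.simps comp_apply dunkl_def[of tau ?g])
    then show ?thesis unfolding x(2) by (simp add: algebra_simps)
  qed
  ultimately show ?case by blast
qed

lemma jop_diag_mod_tau:
  "\<exists>x. is_poly x \<and> jop tau k (sf_monomial l) l = of_nat (\<Sum>i\<in>keys l. lookup l i ^ Suc k) + tau * x"
proof -
  have "is_poly (theta (sf_monomial l) b)" for b
    by (auto simp: theta_def sf_monomial_parts)
  then have "\<exists>x. is_poly x \<and> (dunkl tau ^^ k) (theta (sf_monomial l)) (swap0 i l) =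
     of_nat (lookup l i ^ Suc k) + tau * x" for i
    using dunkl_pow_mod_tau[of "theta (sf_monomial l)" k "swap0 i l"]
    by (simp add: theta_def sf_monomial_parts parts_perm mult.commute)
  then obtain x where x: "\<And>i. is_poly (x i)" "\<And>i. (dunkl tau ^^ k) (theta (sf_monomial l)) (swap0 i l) =
     of_nat (lookup l i ^ Suc k) + tau * x i" by metis
  show ?thesis
    by (rule exI[of _ "\<Sum>i\<in>keys l. x i"])
      (simp add: jop_def symmetrize_def x is_poly_sum sum.distrib sum_distrib_left del: power_Suc)
qed

text \<open>Comparison of the constant coefficients of two polynomials in tau.\<close>

lemma jop_diag_distinct:
  assumes "(\<Sum>i\<in>keys l. lookup l i ^ Suc k) \<noteq> (\<Sum>i\<in>keys m. lookup m i ^ Suc k)"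
  shows "jop tau k (sf_monomial l) l \<noteq> jop tau k (sf_monomial m) m"
proof
  define a where "a = (\<Sum>i\<in>keys l. lookup l i ^ Suc k)"
  define b where "b = (\<Sum>i\<in>keys m. lookup m i ^ Suc k)"
  assume "jop tau k (sf_monomial l) l = jop tau k (sf_monomial m) m"
  moreover obtain x where x: "is_poly x" "jop tau k (sf_monomial l) l = of_nat a + tau * x"
    using jop_diag_mod_tau a_def by blast
  moreover obtain y where y: "is_poly y" "jop tau k (sf_monomial m) m = of_nat b + tau * y"
    using jop_diag_mod_tau b_def by blast
  moreover obtain p q where "x = to_fract p" "y = to_fract q" using x y by (auto simp: is_poly_def)
  moreover have n: "of_nat n = to_fract (of_nat n :: rat poly)" for n by (induction n) simp_all
  ultimately have "to_fract (of_nat a + [:0, 1:] * p) = to_fract (of_nat b + [:0, 1:] * q)"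
    by (simp only: to_fract_add to_fract_mult n tau_to_fract)
  then have "of_nat a + [:0, 1:] * p = of_nat b + [:0, 1:] * q" by (simp only: to_fract_eq_iff)
  then have "coeff (of_nat a + [:0, 1:] * p) 0 = coeff (of_nat b + [:0, 1:] * q) 0" by simp
  then have "a = b" by (simp add: of_nat_poly)
  then show False using assms by (simp add: a_def b_def)
qed

section \<open>Existence and uniqueness of Jack functions\<close>

text \<open>Bernoulli's inequality (1 + 1/v)^k \<ge> 1 + k/v, cleared of denominators.\<close>

lemma bernoulli_nat: "v ^ k * (v + k) \<le> v * (v + 1) ^ (k::nat)" for v :: nat
proof (induction k)
  case (Suc k)
  have "v ^ Suc k * (v + Suc k) \<le> v ^ k * (v + k) * (v + 1)" by (simp add: algebra_simps)
  also have "\<dots> \<le> v * (v + 1) ^ k * (v + 1)" using Suc by (rule mult_right_mono) simp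
  finally show ?case by (simp add: algebra_simps)
qed simp

text \<open>With v = \<open>g i\<close> at the first index where the sequences differ, f contributes
  at least (v + 1)^k, and the tail of g at most d v^k. Bernoulli's inequality makes the latter
  smaller as soon as d v < v + k, which the bound on k ensures.\<close>

lemma power_sum_less:
  fixes f g :: "nat \<Rightarrow> nat"
  assumes g: "antimono g" "\<And>j. g j \<le> d" and i: "i < d" "g i < f i" and eq: "\<And>j. j < i \<Longrightarrow> f j = g j"
    and k: "d * d < k"
  shows "(\<Sum>j<d. g j ^ k) < (\<Sum>j<d. f j ^ k)"
proof -
  let ?v = "g i"
  have s: "{..<d} = {..<i} \<union> {i..<d}" "{..<i} \<inter> {i..<d} = {}" using i by auto
  have "(\<Sum>j\<in>{i..<d}. g j ^ k) \<le> (\<Sum>j\<in>{i..<d}. ?v ^ k)"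
    using antimonoD[OF g(1)] by (intro sum_mono power_mono) auto
  also have "\<dots> \<le> d * ?v ^ k" by simp
  also have "\<dots> < (?v + 1) ^ k"
  proof (cases "?v = 0")
    case True
    then show ?thesis using k by simp
  next
    case False
    have "?v * d \<le> d * d" using g(2)[of i] by (rule mult_right_mono) simp
    then have "?v * d < ?v + k" using k by linarith
    then have "?v ^ k * (?v * d) < ?v ^ k * (?v + k)" using False by (intro mult_strict_left_mono) auto
    then have "?v * (d * ?v ^ k) < ?v ^ k * (?v + k)" by (simp add: mult_ac)
    also have "?v ^ k * (?v + k) \<le> ?v * (?v + 1) ^ k" by (rule bernoulli_nat)
    finally show ?thesis by simp
  qed
  also have "\<dots> \<le> f i ^ k" using i by (intro power_mono) auto
  also have "\<dots> \<le> (\<Sum>j\<in>{i..<d}. f j ^ k)" using i by (intro member_le_sum) auto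
  finally have "(\<Sum>j\<in>{i..<d}. g j ^ k) < (\<Sum>j\<in>{i..<d}. f j ^ k)" .
  moreover have "(\<Sum>j<i. g j ^ k) = (\<Sum>j<i. f j ^ k)" using eq by simp
  ultimately show ?thesis unfolding s(1) by (subst (1 2) sum.union_disjoint) auto
qed

lemma partition_length_le: "partition_length l \<le> partition_size l"
  unfolding partition_length_def partition_size_def card_eq_sum
  by (intro sum_mono) (auto simp: in_keys_iff Suc_le_eq)

lemma lookup_le_size: "lookup l i \<le> partition_size l"
  by (cases "i \<in> keys l") (auto simp: partition_size_def in_keys_iff intro: member_le_sum)

lemma power_sums_separate:
  assumes l: "l \<in> parts_of_size d" and m: "m \<in> parts_of_size d" and ne: "l \<noteq> m" and k: "d * d < k"
  shows "(\<Sum>i\<in>keys l. lookup l i ^ k) \<noteq> (\<Sum>i\<in>keys m. lookup m i ^ k)"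
proof -
  have keys: "keys l \<subseteq> {..<d}" if "l \<in> parts_of_size d" for l
    using that partition_keys[of l] partition_length_le[of l] by (auto simp: parts_of_size_def)
  have sup: "(\<Sum>i\<in>keys l. lookup l i ^ k) = (\<Sum>i<d. lookup l i ^ k)" if "l \<in> parts_of_size d" for l
    using keys[OF that] k by (intro sum.mono_neutral_left) (auto simp: in_keys_iff)
  define i where "i = (LEAST i. lookup l i \<noteq> lookup m i)"
  have ex: "\<exists>i. lookup l i \<noteq> lookup m i" using ne by (metis poly_mapping_eqI)
  have i: "lookup l i \<noteq> lookup m i" unfolding i_def using ex by (rule LeastI_ex)
  have less: "lookup l j = lookup m j" if "j < i" for j
    using not_less_Least[of j "\<lambda>i. lookup l i \<noteq> lookup m i"] that by (auto simp: i_def)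
  have id: "i < d"
  proof (rule ccontr)
    assume "\<not> i < d"
    then have "i \<notin> keys l" "i \<notin> keys m" using keys[OF l] keys[OF m] by auto
    then show False using i by (simp add: in_keys_iff)
  qed
  have p: "antimono (lookup l)" "lookup l j \<le> d" if "l \<in> parts_of_size d" for l j
    using that lookup_le_size[of l j] by (auto simp: parts_of_size_def int_partitions_def)
  have "lookup l i < lookup m i \<or> lookup m i < lookup l i" using i by linarith
  then show ?thesis
    unfolding sup[OF l] sup[OF m]
  proof
    assume "lookup l i < lookup m i"
    from power_sum_less[OF p[OF l] id this less[symmetric] k] show "(\<Sum>i<d. lookup l i ^ k) \<noteq> (\<Sum>i<d. lookup m i ^ k)"
      by simp
  next
    assume "lookup m i < lookup l i"
    from power_sum_less[OF p[OF m] id this less k] show "(\<Sum>i<d. lookup l i ^ k) \<noteq> (\<Sum>i<d. lookup m i ^ k)"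
      by simp
  qed
qed

text \<open>Signs in Q(tau) are those of leading coefficients. All positivity statements over this
  field refer to that order.\<close>

lemma tau_pos: "0 < tau"
  unfolding tau_def by (simp add: zero_less_Fract_iff less_poly_def pos_poly_def)

section \<open>The Jack form in power sum coordinates\<close>

lemma pnorm_tau_pos:
  assumes "0 \<notin># M"
  shows "0 < pnorm tau M"
proof -
  have "0 < (\<Prod>r\<in>set_mset M. r ^ count M r * fact (count M r))"
    using assms by (intro prod_pos) (metis fact_gt_zero gr0I mult_pos_pos zero_less_power)
  then have "(0::ratfun) < of_nat (\<Prod>r\<in>set_mset M. r ^ count M r * fact (count M r))"
    by (simp only: of_nat_0_less_iff)
  then show ?thesis unfolding pnorm_def using tau_pos by (intro mult_pos_pos) auto
qed

text \<open>Resolves the description operator in \<open>power_sum_coords\<close>: the candidate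
  takes its coordinates through the bijection \<open>parts\<close>, and uniqueness is linear
  independence of the products of power sums.\<close>

lemma power_sum_coords_eq:
  fixes c :: "nat multiset \<Rightarrow> ratfun"
  assumes I: "finite I" "\<And>M. M \<in> I \<Longrightarrow> 0 \<notin># M"
  defines "F \<equiv> (\<lambda>a. \<Sum>M\<in>I. c M * psum M a)"
  shows "lookup (power_sum_coords F) l = (if l \<in> int_partitions \<and> parts l \<in> I then c (parts l) else 0)"
proof -
  define h where "h l = (if l \<in> int_partitions \<and> parts l \<in> I then c (parts l) else 0)" for l
  have inj: "inj_on parts int_partitions" by (auto simp: inj_on_def parts_inj)
  have fin: "finite {l \<in> int_partitions. parts l \<in> I}"
    using finite_vimage_IntI[OF I(1) inj] by (rule rev_finite_subset) auto
  then have "finite {l. h l \<noteq> 0}" by (rule rev_finite_subset) (auto simp: h_def)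
  then have hl: "lookup (Abs_poly_mapping h) = h" by simp
  define C where "C = Abs_poly_mapping h"
  have lC: "lookup C = h" using hl by (simp add: C_def)
  have kC: "keys C = {l. h l \<noteq> 0}" by (auto simp: in_keys_iff lC)
  have "F a = (\<Sum>l\<in>keys C. lookup C l * sf_power_sum l a)" for a
  proof -
    have "parts ` {l \<in> int_partitions. parts l \<in> I} = I"
      using I parts_surj by fastforce
    then have "F a = (\<Sum>M\<in>parts ` {l \<in> int_partitions. parts l \<in> I}. c M * psum M a)"
      unfolding F_def by simp
    also have "\<dots> = (\<Sum>l\<in>{l \<in> int_partitions. parts l \<in> I}. c (parts l) * psum (parts l) a)"
      by (subst sum.reindex) (auto intro: inj_on_subset[OF inj])
    also have "\<dots> = (\<Sum>l\<in>keys C. lookup C l * sf_power_sum l a)"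
      unfolding lC kC using fin by (intro sum.mono_neutral_cong_right) (auto simp: h_def sf_power_sum_psum)
    finally show ?thesis .
  qed
  then have ex: "keys C \<subseteq> int_partitions \<and> F = (\<lambda>a. \<Sum>l\<in>keys C. lookup C l * sf_power_sum l a)"
    by (auto simp: kC h_def split: if_splits)
  have uni: "C' = C" if C': "keys C' \<subseteq> int_partitions" "F = (\<lambda>a. \<Sum>l\<in>keys C'. lookup C' l * sf_power_sum l a)" for C'
  proof (rule poly_mapping_eqI)
    fix l
    let ?L = "keys C \<union> keys C'"
    have L: "?L \<subseteq> int_partitions" using ex C' by auto
    \<comment> \<open>The difference of two coordinate vectors, transported to multisets so that
      \<open>psum_independent\<close> applies.\<close>
    define e where "e = (\<lambda>M. let l = inv_into int_partitions parts M in lookup C l - lookup C' l)"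
    have e: "e (parts l) = lookup C l - lookup C' l" if "l \<in> int_partitions" for l
      using that by (simp add: e_def inv_into_f_f[OF inj])
    have s: "(\<Sum>l\<in>keys D. lookup D l * sf_power_sum l a) = (\<Sum>l\<in>?L. lookup D l * psum (parts l) a)"
      if "D = C \<or> D = C'" for D :: "expo \<Rightarrow>\<^sub>0 ratfun" and a
      using that L by (intro sum.mono_neutral_cong_left) (auto simp: sf_power_sum_psum in_keys_iff)
    have z: "(\<Sum>M\<in>parts ` ?L. e M * psum M a) = 0" for a
    proof -
      have "(\<Sum>M\<in>parts ` ?L. e M * psum M a) = (\<Sum>l\<in>?L. (lookup C l - lookup C' l) * psum (parts l) a)"
        using L by (subst sum.reindex[OF inj_on_subset[OF inj L]]) (auto intro!: sum.cong simp: e)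
      also have "\<dots> = F a - F a"
        using fun_cong[OF conjunct2[OF ex], of a] fun_cong[OF C'(2), of a] s[of C a] s[of C' a]
        by (simp add: left_diff_distrib sum_subtractf)
      finally show ?thesis by simp
    qed
    have "e M = 0" if "M \<in> parts ` ?L" for M
    proof (rule psum_independent[where I = "parts ` ?L" and c = e])
      show "0 \<notin># N" if "N \<in> parts ` ?L" for N using that by auto
    qed (use that in \<open>simp_all add: z\<close>)
    then have cl: "lookup C l = lookup C' l" if "l \<in> ?L" using that L e by force
    show "lookup C' l = lookup C l"
    proof (cases "l \<in> ?L")
      case True
      then show ?thesis by (rule cl[symmetric])
    next
      case False
      then show ?thesis by (auto simp: in_keys_iff)
    qed
  qed
  have "power_sum_coords F = C"
    unfolding power_sum_coords_def using ex uni by (intro the_equality) auto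
  then show ?thesis by (simp add: lC h_def)
qed

lemma jack_form_eq:
  fixes c c' :: "nat multiset \<Rightarrow> ratfun"
  assumes I: "finite I" "\<And>M. M \<in> I \<Longrightarrow> 0 \<notin># M"
  shows "jack_form (\<lambda>a. \<Sum>M\<in>I. c M * psum M a) (\<lambda>a. \<Sum>M\<in>I. c' M * psum M a) =
    (\<Sum>M\<in>I. c M * c' M * pnorm tau M)"
proof -
  let ?F = "\<lambda>a. \<Sum>M\<in>I. c M * psum M a" and ?G = "\<lambda>a. \<Sum>M\<in>I. c' M * psum M a"
  let ?L = "{l \<in> int_partitions. parts l \<in> I}"
  have inj: "inj_on parts int_partitions" by (auto simp: inj_on_def parts_inj)
  have fin: "finite ?L"
    using finite_vimage_IntI[OF I(1) inj] by (rule rev_finite_subset) auto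
  have "jack_form ?F ?G = (\<Sum>l\<in>?L. c (parts l) * c' (parts l) * pnorm tau (parts l))"
    unfolding jack_form_def
    using fin by (intro sum.mono_neutral_cong_left)
      (auto simp: power_sum_coords_eq[OF I] pnorm_zee in_keys_iff mult.assoc split: if_splits)
  also have "\<dots> = (\<Sum>M\<in>parts ` ?L. c M * c' M * pnorm tau M)"
    by (subst sum.reindex) (auto intro: inj_on_subset[OF inj])
  also have "parts ` ?L = I"
    using I parts_surj by fastforce
  finally show ?thesis .
qed

lemma mparts_0: "M \<in> mparts d \<Longrightarrow> 0 \<notin># M"
  by (simp add: mparts_def)

lemma jack_form_mparts:
  "jack_form (\<lambda>a. \<Sum>M\<in>mparts d. c M * psum M a) (\<lambda>a. \<Sum>M\<in>mparts d. c' M * psum M a) =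
    (\<Sum>M\<in>mparts d. c M * c' M * pnorm tau M)"
  by (rule jack_form_eq) (auto simp: finite_mparts mparts_0)

text \<open>Functions of different degrees involve disjoint sets of power sums.\<close>

lemma jack_form_degree:
  assumes "inspan d F" "inspan e G" "d \<noteq> e"
  shows "jack_form F G = 0"
proof -
  obtain c c' where F: "F = (\<lambda>a. \<Sum>M\<in>mparts d. c M * psum M a)" and G: "G = (\<lambda>a. \<Sum>M\<in>mparts e. c' M * psum M a)"
    using assms by (auto simp: inspan_def)
  have disj: "M \<notin> mparts e" if "M \<in> mparts d" for M using that assms(3) by (auto simp: mparts_def)
  let ?I = "mparts d \<union> mparts e"
  let ?c = "\<lambda>M. if M \<in> mparts d then c M else 0" and ?c' = "\<lambda>M. if M \<in> mparts e then c' M else 0"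
  have F': "F = (\<lambda>a. \<Sum>M\<in>?I. ?c M * psum M a)"
    unfolding F by (intro ext sum.mono_neutral_cong_left) (auto simp: finite_mparts)
  have G': "G = (\<lambda>a. \<Sum>M\<in>?I. ?c' M * psum M a)"
    unfolding G by (intro ext sum.mono_neutral_cong_left) (auto simp: finite_mparts)
  have "jack_form F G = (\<Sum>M\<in>?I. ?c M * ?c' M * pnorm tau M)"
    unfolding F' G' by (rule jack_form_eq) (auto simp: finite_mparts mparts_0)
  also have "\<dots> = 0" using disj by (intro sum.neutral) auto
  finally show ?thesis .
qed

lemma jack_form_commute:
  assumes "inspan d F" "inspan d G"
  shows "jack_form F G = jack_form G F"
proof -
  obtain c c' where F: "F = (\<lambda>a. \<Sum>M\<in>mparts d. c M * psum M a)" and G: "G = (\<lambda>a. \<Sum>M\<in>mparts d. c' M * psum M a)"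
    using assms by (auto simp: inspan_def)
  show ?thesis unfolding F G jack_form_mparts by (simp add: mult_ac)
qed

lemma jack_form_sum:
  assumes "\<And>i. i \<in> S \<Longrightarrow> inspan d (F i)" "inspan d G"
  shows "jack_form (\<lambda>a. \<Sum>i\<in>S. x i * F i a) G = (\<Sum>i\<in>S. x i * jack_form (F i) G)"
proof -
  have "\<forall>i. \<exists>c. i \<in> S \<longrightarrow> F i = (\<lambda>a. \<Sum>M\<in>mparts d. c M * psum M a)"
    using assms by (auto simp: inspan_def)
  then obtain c where c: "\<And>i. i \<in> S \<Longrightarrow> F i = (\<lambda>a. \<Sum>M\<in>mparts d. c i M * psum M a)" by metis
  obtain c' where G: "G = (\<lambda>a. \<Sum>M\<in>mparts d. c' M * psum M a)" using assms by (auto simp: inspan_def)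
  have "(\<lambda>a. \<Sum>i\<in>S. x i * F i a) = (\<lambda>a. \<Sum>M\<in>mparts d. (\<Sum>i\<in>S. x i * c i M) * psum M a)"
  proof (rule ext)
    fix a
    have "(\<Sum>i\<in>S. x i * F i a) = (\<Sum>i\<in>S. \<Sum>M\<in>mparts d. x i * c i M * psum M a)"
      by (intro sum.cong) (auto simp: c sum_distrib_left mult.assoc)
    also have "\<dots> = (\<Sum>M\<in>mparts d. (\<Sum>i\<in>S. x i * c i M) * psum M a)"
      by (subst sum.swap) (simp add: sum_distrib_right)
    finally show "(\<Sum>i\<in>S. x i * F i a) = \<dots>" .
  qed
  then have "jack_form (\<lambda>a. \<Sum>i\<in>S. x i * F i a) G = (\<Sum>M\<in>mparts d. (\<Sum>i\<in>S. x i * c i M) * c' M * pnorm tau M)"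
    unfolding G by (simp only: jack_form_mparts)
  also have "\<dots> = (\<Sum>i\<in>S. \<Sum>M\<in>mparts d. x i * (c i M * c' M * pnorm tau M))"
    by (subst sum.swap) (simp add: sum_distrib_right mult.assoc)
  also have "\<dots> = (\<Sum>i\<in>S. x i * jack_form (F i) G)"
    by (intro sum.cong) (auto simp: c G jack_form_mparts sum_distrib_left)
  finally show ?thesis .
qed

text \<open>The form is diagonal with positive norms in the ordered field Q(tau), so a vanishing sum
  of weighted squares kills every coordinate.\<close>

lemma jack_form_definite:
  assumes "inspan d F" "jack_form F F = 0"
  shows "F = (\<lambda>a. 0)"
proof -
  obtain c where F: "F = (\<lambda>a. \<Sum>M\<in>mparts d. c M * psum M a)" using assms by (auto simp: inspan_def)
  have nn: "0 \<le> c M * c M * pnorm tau M" if "M \<in> mparts d" for M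
    using mult_nonneg_nonneg[OF zero_le_square[of "c M"] less_imp_le[OF pnorm_tau_pos[OF mparts_0[OF that]]]] .
  have "(\<Sum>M\<in>mparts d. c M * c M * pnorm tau M) = 0"
    using assms(2) unfolding F jack_form_mparts .
  then have "\<forall>M\<in>mparts d. c M * c M * pnorm tau M = 0"
    by (subst (asm) sum_nonneg_eq_0_iff) (use nn in \<open>auto simp: finite_mparts\<close>)
  then have "\<forall>M\<in>mparts d. c M = 0"
    using pnorm_tau_pos[OF mparts_0] by fastforce
  then show ?thesis unfolding F by simp
qed

lemma jack_form_jop:
  assumes "inspan d F" "inspan d G"
  shows "jack_form (jop tau k F) G = jack_form F (jop tau k G)"
proof -
  have tau0: "tau \<noteq> 0" using tau_pos by simp
  obtain c c' where F: "F = (\<lambda>a. \<Sum>M\<in>mparts d. c M * psum M a)" and G: "G = (\<lambda>a. \<Sum>M\<in>mparts d. c' M * psum M a)"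
    using assms by (auto simp: inspan_def)
  have j: "jop tau k (\<lambda>a. \<Sum>M\<in>mparts d. c M * psum M a) =
      (\<lambda>a. \<Sum>M'\<in>mparts d. (\<Sum>M\<in>mparts d. c M * jmat tau d k M M') * psum M' a)" for c
  proof (rule ext)
    fix a
    have "jop tau k (\<lambda>a. \<Sum>M\<in>mparts d. c M * psum M a) a = (\<Sum>M\<in>mparts d. \<Sum>M'\<in>mparts d. c M * jmat tau d k M M' * psum M' a)"
      unfolding lin_sum[OF lin_jop finite_mparts]
      by (intro sum.cong) (auto simp: jop_psum sum_distrib_left mult.assoc)
    also have "\<dots> = (\<Sum>M'\<in>mparts d. (\<Sum>M\<in>mparts d. c M * jmat tau d k M M') * psum M' a)"
      by (subst sum.swap) (simp add: sum_distrib_right)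
    finally show "jop tau k (\<lambda>a. \<Sum>M\<in>mparts d. c M * psum M a) a = \<dots>" .
  qed
  have "jack_form (jop tau k F) G = (\<Sum>M'\<in>mparts d. \<Sum>M\<in>mparts d. c M * c' M' * (jmat tau d k M M' * pnorm tau M'))"
    unfolding F G j jack_form_mparts by (simp add: sum_distrib_left sum_distrib_right mult_ac)
  also have "\<dots> = (\<Sum>M\<in>mparts d. \<Sum>M'\<in>mparts d. c M * c' M' * (jmat tau d k M' M * pnorm tau M))"
    by (subst sum.swap) (simp add: jmat_adjoint[OF tau0])
  also have "\<dots> = jack_form F (jop tau k G)"
    unfolding F G j jack_form_mparts by (simp add: sum_distrib_left sum_distrib_right mult_ac)
  finally show ?thesis .
qed

text \<open>Coefficients of the eigenvectors of a triangular matrix; \<open>rk\<close> strictly decreases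
  along nonzero off-diagonal entries.\<close>

function triangular_eigen :: "'i set \<Rightarrow> ('i \<Rightarrow> nat) \<Rightarrow> ('i \<Rightarrow> 'i \<Rightarrow> 'a::field) \<Rightarrow> 'i \<Rightarrow> 'i \<Rightarrow> 'a" where
  "triangular_eigen J rk a l m = (if m = l then 1 else
     (\<Sum>n\<in>{n \<in> J. rk n < rk m}. triangular_eigen J rk a l n * a n m) / (a l l - a m m))"
  by auto
termination by (relation "Wellfounded.measure (\<lambda>(J, rk, a, l, m). rk m)") auto

declare triangular_eigen.simps [simp del]

lemma triangular_eigen_diag: "triangular_eigen J rk a l l = 1"
  by (simp add: triangular_eigen.simps)

context
  fixes J :: "'i set" and rk :: "'i \<Rightarrow> nat" and a :: "'i \<Rightarrow> 'i \<Rightarrow> 'a::field" and le :: "'i \<Rightarrow> 'i \<Rightarrow> bool"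
  assumes fin: "finite J"
    and trans: "\<And>x y z. le x y \<Longrightarrow> le y z \<Longrightarrow> le x z" and refl: "\<And>x. le x x"
    and supp: "\<And>l m. l \<in> J \<Longrightarrow> m \<in> J \<Longrightarrow> a l m \<noteq> 0 \<Longrightarrow> le l m"
    and rk: "\<And>l m. l \<in> J \<Longrightarrow> m \<in> J \<Longrightarrow> le l m \<Longrightarrow> l \<noteq> m \<Longrightarrow> rk l < rk m"
begin

lemma triangular_eigen_support:
  assumes "l \<in> J" "m \<in> J" "triangular_eigen J rk a l m \<noteq> 0"
  shows "le l m"
  using assms(2,3)
proof (induction "rk m" arbitrary: m rule: less_induct)
  case less
  show ?case
  proof (cases "m = l")
    case False
    then have "(\<Sum>n\<in>{n \<in> J. rk n < rk m}. triangular_eigen J rk a l n * a n m) \<noteq> 0"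
      using less.prems by (auto simp: triangular_eigen.simps[of J rk a l m])
    then obtain n where "n \<in> J" "rk n < rk m" "triangular_eigen J rk a l n * a n m \<noteq> 0"
      by (auto elim!: sum.not_neutral_contains_not_neutral)
    then show ?thesis using less supp[of n m] trans by auto
  qed (simp add: refl)
qed

text \<open>For m \<noteq> l the recursion is the eigenvalue equation solved for the unknown at m;
  the sum over smaller ranks is complete because all other off-diagonal entries vanish. At m = l
  only the diagonal term survives, by the support lemma.\<close>

lemma triangular_eigen_eq:
  assumes distinct: "\<And>l m. l \<in> J \<Longrightarrow> m \<in> J \<Longrightarrow> l \<noteq> m \<Longrightarrow> a l l \<noteq> a m m" and l: "l \<in> J" and m: "m \<in> J"
  shows "(\<Sum>n\<in>J. triangular_eigen J rk a l n * a n m) = a l l * triangular_eigen J rk a l m"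
proof -
  let ?K = "triangular_eigen J rk a l"
  have z: "a n m = 0" if "n \<in> J" "n \<noteq> m" "\<not> rk n < rk m" for n
    using supp[OF that(1) m] rk[OF that(1) m] that by blast
  have "(\<Sum>n\<in>J. ?K n * a n m) = (\<Sum>n\<in>insert m {n \<in> J. rk n < rk m}. ?K n * a n m)"
    using fin m z by (intro sum.mono_neutral_right) auto
  also have "\<dots> = ?K m * a m m + (\<Sum>n\<in>{n \<in> J. rk n < rk m}. ?K n * a n m)"
    using fin by simp
  finally have s: "(\<Sum>n\<in>J. ?K n * a n m) = \<dots>" .
  show ?thesis
  proof (cases "m = l")
    case True
    have "?K n * a n l = 0" if "n \<in> J" "rk n < rk l" for n
      using triangular_eigen_support[OF l that(1)] rk[OF l that(1)] that by auto
    then have "(\<Sum>n\<in>{n \<in> J. rk n < rk m}. ?K n * a n m) = 0"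
      unfolding True by (intro sum.neutral) auto
    then show ?thesis unfolding s using True by (simp add: triangular_eigen_diag)
  next
    case False
    then have "(\<Sum>n\<in>{n \<in> J. rk n < rk m}. ?K n * a n m) = ?K m * (a l l - a m m)"
      using distinct[OF l m] by (simp add: triangular_eigen.simps[of J rk a l m])
    then show ?thesis unfolding s by (simp add: algebra_simps)
  qed
qed

end

section \<open>Construction of a Jack family from eigenvectors\<close>

lemma monomial_at:
  assumes "l \<in> int_partitions" "m \<in> int_partitions"
  shows "sf_monomial l m = (if l = m then 1 else 0)"
  using parts_inj[OF assms] by (auto simp: sf_monomial_parts)

lemma parts_of_sizeD: "l \<in> parts_of_size d \<Longrightarrow> l \<in> int_partitions" "l \<in> parts_of_size d \<Longrightarrow> partition_size l = d"
  by (simp_all add: parts_of_size_def)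

lemma monomial_sum_at:
  assumes "m \<in> parts_of_size d"
  shows "(\<Sum>l\<in>parts_of_size d. c l * sf_monomial l m) = (c m :: 'a::comm_ring_1)"
proof -
  have "(\<Sum>l\<in>parts_of_size d. c l * sf_monomial l m) = (\<Sum>l\<in>parts_of_size d. if l = m then c l else 0)"
    using assms by (intro sum.cong) (auto simp: monomial_at parts_of_sizeD)
  then show ?thesis using assms by (simp add: finite_parts_of_size)
qed

lemma inspan_eqI:
  assumes "inspan d F" "inspan d G" "\<And>m. m \<in> parts_of_size d \<Longrightarrow> F m = G m"
  shows "F = G"
  by (subst inspan_expansion[OF assms(1)], subst inspan_expansion[OF assms(2)]) (simp add: assms(3))

lemma inspan_monomials: "inspan d (\<lambda>a. \<Sum>l\<in>parts_of_size d. c l * (sf_monomial l a :: 'a::linordered_field))"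
  by (intro inspan_sum inspan_monomial)

abbreviation jop_entry :: "nat \<Rightarrow> expo \<Rightarrow> expo \<Rightarrow> ratfun" where
  "jop_entry k l m \<equiv> jop tau k (sf_monomial l) m"

lemma jop_entry_majorizes:
  assumes "l \<in> int_partitions" "jop_entry k l m \<noteq> 0"
  shows "majorizes l m"
proof (rule dominated_imp_majorizes, rule jop_dominated[OF _ assms(2)])
  fix b assume "sf_monomial l b \<noteq> (0 :: ratfun)"
  then have "parts b = parts l" by (auto simp: sf_monomial_parts split: if_splits)
  with dominated_refl[OF assms(1)] show "dominated l b" by (rule dominated_parts)
qed

lemma jop_monomials:
  "jop tau k (\<lambda>a. \<Sum>l\<in>parts_of_size d. c l * sf_monomial l a) m = (\<Sum>l\<in>parts_of_size d. c l * jop_entry k l m)"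
  unfolding lin_sum[OF lin_jop finite_parts_of_size] ..

text \<open>The diagonal entries modulo tau are power sums with exponent \<open>Suc k\<close>; for
  this k the exponent exceeds \<open>d * d\<close>, the bound in
  \<open>power_sum_less\<close>.\<close>

definition sep_exponent :: "nat \<Rightarrow> nat" where
  "sep_exponent d = d * d + 1"

definition eigen_coeff :: "expo \<Rightarrow> expo \<Rightarrow> ratfun" where
  "eigen_coeff l = triangular_eigen (parts_of_size (partition_size l)) weight_sum
     (jop_entry (sep_exponent (partition_size l))) l"

definition eigen_fun :: "expo \<Rightarrow> ratfun series" where
  "eigen_fun l = (\<lambda>a. \<Sum>m\<in>parts_of_size (partition_size l). eigen_coeff l m * sf_monomial m a)"

lemma weight_sum_less:
  "l \<in> parts_of_size d \<Longrightarrow> m \<in> parts_of_size d \<Longrightarrow> majorizes l m \<Longrightarrow> l \<noteq> m \<Longrightarrow> weight_sum l < weight_sum m"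
  by (intro majorizes_strict) (auto simp: parts_of_sizeD)

lemma jop_entry_distinct:
  assumes "l \<in> parts_of_size d" "m \<in> parts_of_size d" "l \<noteq> m"
  shows "jop_entry (sep_exponent d) l l \<noteq> jop_entry (sep_exponent d) m m"
  by (rule jop_diag_distinct, rule power_sums_separate[OF assms]) (simp add: sep_exponent_def)

lemma eigen_coeff_support:
  assumes "l \<in> parts_of_size d" "m \<in> parts_of_size d" "eigen_coeff l m \<noteq> 0"
  shows "majorizes l m"
proof (rule triangular_eigen_support[where le = majorizes, OF finite_parts_of_size majorizes_trans majorizes_refl _ _ assms(1,2)])
  show "triangular_eigen (parts_of_size d) weight_sum (jop_entry (sep_exponent d)) l m \<noteq> 0"
    using assms by (simp add: eigen_coeff_def parts_of_sizeD)
qed (auto intro: jop_entry_majorizes weight_sum_less dest: parts_of_sizeD)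

lemma eigen_fun_eigen:
  assumes l: "l \<in> parts_of_size d"
  shows "jop tau (sep_exponent d) (eigen_fun l) = (\<lambda>a. jop_entry (sep_exponent d) l l * eigen_fun l a)"
proof (rule inspan_eqI)
  have s: "partition_size l = d" using l by (rule parts_of_sizeD)
  have i: "inspan d (eigen_fun l)" unfolding eigen_fun_def s by (rule inspan_monomials)
  show "inspan d (jop tau (sep_exponent d) (eigen_fun l))" using i by (rule inspan_jop)
  show "inspan d (\<lambda>a. jop_entry (sep_exponent d) l l * eigen_fun l a)" using i by (rule inspan_cmult)
  fix m assume m: "m \<in> parts_of_size d"
  have "(\<Sum>n\<in>parts_of_size d. eigen_coeff l n * jop_entry (sep_exponent d) n m) =
     jop_entry (sep_exponent d) l l * eigen_coeff l m"
    unfolding eigen_coeff_def s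
  proof (rule triangular_eigen_eq[where le = majorizes, OF finite_parts_of_size majorizes_trans majorizes_refl _ _ _ l m])
  qed (auto intro: jop_entry_majorizes weight_sum_less dest: parts_of_sizeD jop_entry_distinct)
  then show "jop tau (sep_exponent d) (eigen_fun l) m = jop_entry (sep_exponent d) l l * eigen_fun l m"
    unfolding eigen_fun_def s jop_monomials monomial_sum_at[OF m] .
qed

lemma inspan_eigen_fun: "inspan (partition_size l) (eigen_fun l)"
  unfolding eigen_fun_def by (rule inspan_monomials)

lemma jack_form_scale_left: "inspan d F \<Longrightarrow> inspan d G \<Longrightarrow> jack_form (\<lambda>a. c * F a) G = c * jack_form F G"
  using jack_form_sum[of "{()}" d "\<lambda>_. F" G "\<lambda>_. c"] by simp

lemma triangular_sum:
  fixes c :: "expo \<Rightarrow> ratfun"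
  assumes l: "l \<in> parts_of_size d" and c: "c l = 1" "\<And>m. m \<in> parts_of_size d \<Longrightarrow> c m \<noteq> 0 \<Longrightarrow> majorizes l m"
  shows "(\<Sum>m\<in>parts_of_size d. c m * f m) = f l + (\<Sum>m\<in>{m \<in> int_partitions. m \<noteq> l \<and> majorizes l m}. c m * f m)"
proof -
  have sub: "{m \<in> int_partitions. m \<noteq> l \<and> majorizes l m} \<subseteq> parts_of_size d"
    using l by (auto simp: parts_of_size_def majorizes_size)
  have "(\<Sum>m\<in>parts_of_size d. c m * f m) = (\<Sum>m\<in>insert l {m \<in> int_partitions. m \<noteq> l \<and> majorizes l m}. c m * f m)"
    using finite_parts_of_size l sub c(2) by (intro sum.mono_neutral_right) (auto simp: parts_of_sizeD)
  also have "\<dots> = f l + (\<Sum>m\<in>{m \<in> int_partitions. m \<noteq> l \<and> majorizes l m}. c m * f m)"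
    using finite_subset[OF sub finite_parts_of_size] c(1) by simp
  finally show ?thesis .
qed

text \<open>In equal degree, the two functions are eigenvectors of one self-adjoint operator for
  distinct eigenvalues; this covers incomparable partitions as well.\<close>

lemma eigen_fun_jack_family: "is_jack_family eigen_fun"
  unfolding is_jack_family_def
proof (intro conjI ballI impI)
  fix l assume "l \<in> int_partitions"
  then have l: "l \<in> parts_of_size (partition_size l)" by (simp add: parts_of_size_def)
  have d: "eigen_coeff l l = 1" by (simp add: eigen_coeff_def triangular_eigen_diag)
  show "\<exists>K. eigen_fun l = (\<lambda>a. sf_monomial l a +
        (\<Sum>m\<in>{m \<in> int_partitions. m \<noteq> l \<and> majorizes l m}. K m * sf_monomial m a))"
    by (rule exI[of _ "eigen_coeff l"]) (simp add: eigen_fun_def triangular_sum[where c = "eigen_coeff l", OF l d eigen_coeff_support[OF l]])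
next
  fix l m assume lm: "l \<in> int_partitions" "m \<in> int_partitions" "l \<noteq> m"
  show "jack_form (eigen_fun l) (eigen_fun m) = 0"
  proof (cases "partition_size l = partition_size m")
    case False
    then show ?thesis using jack_form_degree[OF inspan_eigen_fun inspan_eigen_fun] by blast
  next
    case True
    let ?d = "partition_size l" and ?k = "sep_exponent (partition_size l)"
    have l: "l \<in> parts_of_size ?d" and m: "m \<in> parts_of_size ?d" using lm True by (auto simp: parts_of_size_def)
    have i: "inspan ?d (eigen_fun l)" "inspan ?d (eigen_fun m)" using inspan_eigen_fun True by metis+
    have "jop_entry ?k l l * jack_form (eigen_fun l) (eigen_fun m) = jack_form (jop tau ?k (eigen_fun l)) (eigen_fun m)"
      by (simp add: eigen_fun_eigen[OF l] jack_form_scale_left[OF i])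
    also have "\<dots> = jack_form (eigen_fun l) (jop tau ?k (eigen_fun m))"
      by (rule jack_form_jop[OF i])
    also have "\<dots> = jack_form (jop tau ?k (eigen_fun m)) (eigen_fun l)"
      by (rule jack_form_commute[OF i(1) inspan_jop[OF i(2)]])
    also have "\<dots> = jop_entry ?k m m * jack_form (eigen_fun l) (eigen_fun m)"
      by (simp add: eigen_fun_eigen[OF m] jack_form_scale_left[OF i(2,1)] jack_form_commute[OF i])
    finally show ?thesis using jop_entry_distinct[OF l m lm(3)] by simp
  qed
qed

section \<open>Uniqueness, and the eigenvalue equation for every exponent\<close>

lemma jack_family_expansion:
  assumes P: "is_jack_family P" and l: "l \<in> parts_of_size d"
  obtains c where "P l = (\<lambda>a. \<Sum>m\<in>parts_of_size d. c m * sf_monomial m a)" "c l = 1"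
    "\<And>m. m \<in> parts_of_size d \<Longrightarrow> c m \<noteq> 0 \<Longrightarrow> majorizes l m"
proof -
  let ?S = "{m \<in> int_partitions. m \<noteq> l \<and> majorizes l m}"
  obtain K where K: "P l = (\<lambda>a. sf_monomial l a + (\<Sum>m\<in>?S. K m * sf_monomial m a))"
    using P l parts_of_sizeD(1)[OF l] unfolding is_jack_family_def by blast
  let ?c = "\<lambda>m. if m = l then 1 else if m \<in> ?S then K m else 0"
  have c: "?c l = 1" "\<And>m. ?c m \<noteq> 0 \<Longrightarrow> majorizes l m"
    using majorizes_refl by (auto split: if_splits)
  have "(\<Sum>m\<in>?S. K m * sf_monomial m a) = (\<Sum>m\<in>?S. ?c m * sf_monomial m a)" for a
    by (intro sum.cong) auto
  then have "P l = (\<lambda>a. \<Sum>m\<in>parts_of_size d. ?c m * sf_monomial m a)"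
    unfolding K using triangular_sum[of l d ?c, OF l c] by simp
  then show ?thesis using that[of ?c] c by blast
qed

lemma jack_family_inspan:
  assumes "is_jack_family P" "l \<in> parts_of_size d"
  shows "inspan d (P l)"
proof -
  obtain c where "P l = (\<lambda>a. \<Sum>m\<in>parts_of_size d. c m * sf_monomial m a)"
    by (rule jack_family_expansion[OF assms])
  then show ?thesis by (simp only: inspan_monomials)
qed

text \<open>\<open>sf_monomial m\<close> is \<open>P m\<close> minus a combination of monomial
  functions strictly below m, so orthogonality passes from the family to the monomial functions;
  \<open>square_sum\<close> drops on the way and serves as induction measure.\<close>

lemma jack_family_orthogonal:
  assumes P: "is_jack_family P" and l: "l \<in> parts_of_size d" and m: "m \<in> parts_of_size d" "majorizes l m" "l \<noteq> m"
  shows "jack_form (P l) (sf_monomial m) = 0"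
  using m
proof (induction "square_sum m" arbitrary: m rule: less_induct)
  case less
  obtain c where c: "P m = (\<lambda>a. \<Sum>n\<in>parts_of_size d. c n * sf_monomial n a)" "c m = 1"
    "\<And>n. n \<in> parts_of_size d \<Longrightarrow> c n \<noteq> 0 \<Longrightarrow> majorizes m n"
    using jack_family_expansion[OF P less.prems(1)] by blast
  have iP: "inspan d (P l)" "inspan d (P m)" using jack_family_inspan[OF P] l less.prems by auto
  have z: "c n * jack_form (sf_monomial n) (P l) = 0" if n: "n \<in> parts_of_size d" "n \<noteq> m" for n
  proof (cases "c n = 0")
    case False
    then have mn: "majorizes m n" using c n by simp
    then have "square_sum n < square_sum m" using n by (intro majorizes_strict) (auto simp: parts_of_sizeD)
    moreover have "majorizes l n" using less.prems(2) mn by (rule majorizes_trans)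
    moreover have "l \<noteq> n" using mn less.prems majorizes_antisym by blast
    ultimately have "jack_form (P l) (sf_monomial n) = 0" using less.hyps n by blast
    then show ?thesis using jack_form_commute[OF iP(1) inspan_monomial[OF n(1)]] by simp
  qed simp
  have "0 = jack_form (P l) (P m)"
    using P l less.prems parts_of_sizeD(1) unfolding is_jack_family_def by metis
  also have "\<dots> = jack_form (P m) (P l)" by (rule jack_form_commute[OF iP])
  also have "\<dots> = (\<Sum>n\<in>parts_of_size d. c n * jack_form (sf_monomial n) (P l))"
    unfolding c(1) by (rule jack_form_sum[OF inspan_monomial iP(1)])
  also have "\<dots> = (\<Sum>n\<in>{m}. c n * jack_form (sf_monomial n) (P l))"
    using less.prems z finite_parts_of_size by (intro sum.mono_neutral_right) auto
  also have "\<dots> = jack_form (P l) (sf_monomial m)"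
    using c(2) jack_form_commute[OF iP(1) inspan_monomial[OF less.prems(1)]] by simp
  finally show ?case by simp
qed

text \<open>Expanding one argument of the form on D, D in monomial functions leaves only vanishing
  terms, and the form is definite.\<close>

lemma jack_form_lower_zero:
  assumes D: "inspan d D" and low: "\<And>m. m \<in> parts_of_size d \<Longrightarrow> D m \<noteq> 0 \<Longrightarrow> jack_form D (sf_monomial m) = 0"
  shows "D = (\<lambda>a. 0)"
proof (rule jack_form_definite[OF D])
  have "jack_form D D = jack_form (\<lambda>a. \<Sum>m\<in>parts_of_size d. D m * sf_monomial m a) D"
    using inspan_expansion[OF D] by simp
  also have "\<dots> = (\<Sum>m\<in>parts_of_size d. D m * jack_form (sf_monomial m) D)"
    by (rule jack_form_sum[OF inspan_monomial D])
  also have "\<dots> = 0"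
  proof (rule sum.neutral, rule ballI)
    fix m assume m: "m \<in> parts_of_size d"
    show "D m * jack_form (sf_monomial m) D = 0"
      using low[OF m] jack_form_commute[OF D inspan_monomial[OF m]] by auto
  qed
  finally show "jack_form D D = 0" .
qed

lemma jack_form_minus_left:
  assumes "inspan d F" "inspan d F'" "inspan d G"
  shows "jack_form (\<lambda>a. F a - x * F' a) G = jack_form F G - x * jack_form F' G"
proof -
  have "jack_form (\<lambda>a. \<Sum>i\<in>{True, False}. (if i then 1 else - x) * (if i then F else F') a) G =
     (\<Sum>i\<in>{True, False}. (if i then 1 else - x) * jack_form (if i then F else F') G)"
    by (rule jack_form_sum) (use assms in auto)
  then show ?thesis by simp
qed

lemma inspan_minus: "inspan d F \<Longrightarrow> inspan d F' \<Longrightarrow> inspan d (\<lambda>a. F a - x * F' a)"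
  using inspan_add[OF _ inspan_cmult[of d F' "- x"], of F] by simp

text \<open>The difference of two candidates has coefficient 0 at l, is supported strictly below l,
  and is orthogonal to all monomial functions there.\<close>

lemma jack_family_unique:
  assumes P: "is_jack_family P" and Q: "is_jack_family Q" and "l \<in> int_partitions"
  shows "P l = Q l"
proof -
  define d where "d = partition_size l"
  have l: "l \<in> parts_of_size d" using assms by (simp add: parts_of_size_def d_def)
  let ?D = "\<lambda>a. P l a - 1 * Q l a"
  have i: "inspan d (P l)" "inspan d (Q l)" using jack_family_inspan[OF P l] jack_family_inspan[OF Q l] .
  have "?D = (\<lambda>a. 0)"
  proof (rule jack_form_lower_zero[OF inspan_minus[OF i]])
    fix m assume m: "m \<in> parts_of_size d" "?D m \<noteq> 0"
    obtain c where c: "P l = (\<lambda>a. \<Sum>m\<in>parts_of_size d. c m * sf_monomial m a)" "c l = 1"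
      "\<And>m. m \<in> parts_of_size d \<Longrightarrow> c m \<noteq> 0 \<Longrightarrow> majorizes l m" using jack_family_expansion[OF P l] by blast
    obtain c' where c': "Q l = (\<lambda>a. \<Sum>m\<in>parts_of_size d. c' m * sf_monomial m a)" "c' l = 1"
      "\<And>m. m \<in> parts_of_size d \<Longrightarrow> c' m \<noteq> 0 \<Longrightarrow> majorizes l m" using jack_family_expansion[OF Q l] by blast
    have "c m - c' m \<noteq> 0" using m by (simp add: c(1) c'(1) monomial_sum_at)
    then have "l \<noteq> m" "c m \<noteq> 0 \<or> c' m \<noteq> 0" using c(2) c'(2) by auto
    then have "majorizes l m" using c(3) c'(3) m by blast
    then show "jack_form ?D (sf_monomial m) = 0"
      using jack_form_minus_left[OF i inspan_monomial[OF m(1)], of 1] \<open>l \<noteq> m\<close>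
        jack_family_orthogonal[OF P l m(1)] jack_family_orthogonal[OF Q l m(1)] by simp
  qed
  then show ?thesis by (simp add: fun_eq_iff)
qed

lemma jack_eq: "is_jack_family P \<Longrightarrow> l \<in> int_partitions \<Longrightarrow> jack l = P l"
  unfolding jack_def by (rule the_equality) (auto intro: jack_family_unique)

lemma jack_family: "is_jack_family jack"
proof -
  have "jack l = eigen_fun l" if "l \<in> int_partitions" for l
    using jack_eq[OF eigen_fun_jack_family that] .
  then show ?thesis using eigen_fun_jack_family unfolding is_jack_family_def by simp
qed

lemma jack_inspan: "l \<in> parts_of_size d \<Longrightarrow> inspan d (jack l)"
  by (rule jack_family_inspan[OF jack_family])

lemma jack_expansion: "l \<in> parts_of_size d \<Longrightarrow> jack l = (\<lambda>a. \<Sum>m\<in>parts_of_size d. jack l m * sf_monomial m a)"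
  by (rule inspan_expansion[OF jack_inspan])

lemma jack_diag:
  assumes "l \<in> int_partitions"
  shows "jack l l = 1"
proof -
  have l: "l \<in> parts_of_size (partition_size l)" using assms by (simp add: parts_of_size_def)
  obtain c where "jack l = (\<lambda>a. \<Sum>m\<in>parts_of_size (partition_size l). c m * sf_monomial m a)" "c l = 1"
    by (rule jack_family_expansion[OF jack_family l])
  then show ?thesis by (simp only: monomial_sum_at[OF l])
qed

lemma jack_support:
  assumes "l \<in> int_partitions" "m \<in> int_partitions" "jack l m \<noteq> 0"
  shows "majorizes l m"
proof -
  have l: "l \<in> parts_of_size (partition_size l)" using assms by (simp add: parts_of_size_def)
  have "partition_size m = partition_size l" using inspan_size[OF jack_inspan[OF l] assms(3)] .
  then have m: "m \<in> parts_of_size (partition_size l)" using assms by (simp add: parts_of_size_def)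
  obtain c where "jack l = (\<lambda>a. \<Sum>m\<in>parts_of_size (partition_size l). c m * sf_monomial m a)" "c l = 1"
    "\<And>m. m \<in> parts_of_size (partition_size l) \<Longrightarrow> c m \<noteq> 0 \<Longrightarrow> majorizes l m"
    using jack_family_expansion[OF jack_family l] by blast
  then show ?thesis using assms(3) m by (simp only: monomial_sum_at[OF m])
qed

text \<open>The construction diagonalizes the operator with exponent \<open>sep_exponent d\<close>,
  but the coefficient recursion needs exponent 1, whose eigenvalues may coincide. So the equation is
  derived from orthogonality: the defect \<open>?D\<close> is supported strictly below l, and moving
  the operator to a monomial function below l produces only monomial functions below l, to which
  \<open>jack l\<close> is orthogonal.\<close>

lemma jack_eigen:
  assumes l: "l \<in> parts_of_size d" and m: "m \<in> parts_of_size d"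
  shows "(\<Sum>n\<in>parts_of_size d. jack l n * jop_entry k n m) = jop_entry k l l * jack l m"
proof -
  let ?x = "jop_entry k l l"
  let ?D = "\<lambda>a. jop tau k (jack l) a - ?x * jack l a"
  have i: "inspan d (jack l)" using jack_inspan[OF l] .
  have ij: "inspan d (jop tau k (jack l))" using inspan_jop[OF i] .
  have e: "jop tau k (jack l) m = (\<Sum>n\<in>parts_of_size d. jack l n * jop_entry k n m)" for m
    by (subst jack_expansion[OF l]) (rule jop_monomials)
  have lint: "l \<in> int_partitions" using parts_of_sizeD(1)[OF l] .
  have orth: "jack_form (jack l) (sf_monomial m) = 0" if "m \<in> parts_of_size d" "majorizes l m" "l \<noteq> m" for m
    using jack_family_orthogonal[OF jack_family l] that by blast
  have "?D = (\<lambda>a. 0)"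
  proof (rule jack_form_lower_zero[OF inspan_minus[OF ij i]])
    fix m assume m: "m \<in> parts_of_size d" "?D m \<noteq> 0"
    have le: "majorizes l n" "n = m \<or> majorizes n m" if "n \<in> parts_of_size d" "jack l n * jop_entry k n m \<noteq> 0" for n
      using that jack_support[OF lint, of n] jop_entry_majorizes[of n k m] by (auto dest: parts_of_sizeD)
    have maj: "majorizes l m"
    proof (rule ccontr)
      assume *: "\<not> majorizes l m"
      then have "jack l m = 0" using jack_support[OF lint, of m] parts_of_sizeD(1)[OF m(1)] by blast
      moreover have "(\<Sum>n\<in>parts_of_size d. jack l n * jop_entry k n m) = 0"
      proof (rule sum.neutral, rule ballI, rule ccontr)
        fix n assume "n \<in> parts_of_size d" "jack l n * jop_entry k n m \<noteq> 0"
        from le[OF this] show False using * majorizes_trans by blast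
      qed
      ultimately show False using m e by simp
    qed
    \<comment> \<open>At l itself only n = l contributes to the sum, and \<open>jack l l = 1\<close>
      cancels the defect.\<close>
    have ne: "l \<noteq> m"
    proof
      assume "l = m"
      have "(\<Sum>n\<in>parts_of_size d. jack l n * jop_entry k n l) = (\<Sum>n\<in>{l}. jack l n * jop_entry k n l)"
      proof (rule sum.mono_neutral_right[OF finite_parts_of_size])
        show "\<forall>n\<in>parts_of_size d - {l}. jack l n * jop_entry k n l = 0"
        proof (rule ballI, rule ccontr)
          fix n assume n: "n \<in> parts_of_size d - {l}" "jack l n * jop_entry k n l \<noteq> 0"
          then have "majorizes l n" "majorizes n l" using le[of n] \<open>l = m\<close> by auto
          then show False using n majorizes_antisym by blast
        qed
      qed (use l in auto)
      then show False using m e \<open>l = m\<close> jack_diag[OF lint] by simp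
    qed
    have mm: "inspan d (sf_monomial m :: ratfun series)" using m by (simp add: inspan_monomial)
    have "jack_form (jop tau k (jack l)) (sf_monomial m) = jack_form (jack l) (jop tau k (sf_monomial m))"
      by (rule jack_form_jop[OF i mm])
    also have "\<dots> = jack_form (jop tau k (sf_monomial m)) (jack l)"
      by (rule jack_form_commute[OF i inspan_jop[OF mm]])
    also have "jop tau k (sf_monomial m) = (\<lambda>a. \<Sum>n\<in>parts_of_size d. jop_entry k m n * sf_monomial n a)"
      by (rule inspan_expansion[OF inspan_jop[OF mm]])
    also have "jack_form \<dots> (jack l) = (\<Sum>n\<in>parts_of_size d. jop_entry k m n * jack_form (sf_monomial n) (jack l))"
      by (rule jack_form_sum[OF inspan_monomial i])
    also have "\<dots> = 0"
    proof (rule sum.neutral, rule ballI)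
      fix n assume n: "n \<in> parts_of_size d"
      show "jop_entry k m n * jack_form (sf_monomial n) (jack l) = 0"
      proof (cases "jop_entry k m n = 0")
        case False
        then have mn: "majorizes m n" using jop_entry_majorizes[of m k n] parts_of_sizeD(1)[OF m(1)] by blast
        have "majorizes l n" using maj mn by (rule majorizes_trans)
        moreover have "l \<noteq> n" using mn maj ne majorizes_antisym by blast
        ultimately have "jack_form (jack l) (sf_monomial n) = 0" using orth n by blast
        then show ?thesis using jack_form_commute[OF i inspan_monomial[OF n]] by simp
      qed simp
    qed
    finally have "jack_form (jop tau k (jack l)) (sf_monomial m) = 0" .
    then show "jack_form ?D (sf_monomial m) = 0"
      using jack_form_minus_left[OF ij i mm] orth[OF m(1) maj ne] by simp
  qed
  then have "?D m = 0" by metis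
  then show ?thesis using e by simp
qed

section \<open>Positivity and specialization of the coefficients\<close>

abbreviation real_poly :: "rat poly \<Rightarrow> real poly" where
  "real_poly \<equiv> map_poly of_rat"

lemma real_poly_add: "real_poly (p + q) = real_poly p + real_poly q"
  by (rule poly_eqI) (simp add: coeff_map_poly of_rat_add)

lemma real_poly_mult: "real_poly (p * q) = real_poly p * real_poly q"
  by (rule poly_eqI) (simp add: coeff_map_poly coeff_mult of_rat_sum of_rat_mult)

lemma real_poly_eq_0 [simp]: "real_poly p = 0 \<longleftrightarrow> p = 0"
  by (simp add: map_poly_eq_0_iff)

lemma real_poly_1 [simp]: "real_poly 1 = 1"
  by simp

text \<open>A Bezout identity over the rationals stays valid over the reals, so the larger field
  creates no common root.\<close>

lemma coprime_real_poly:
  assumes "coprime p q"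
  shows "poly (real_poly p) x \<noteq> 0 \<or> poly (real_poly q) x \<noteq> 0"
proof -
  obtain a b where "a * p + b * q = 1"
    using bezout_coefficients_fst_snd[of p q] assms by (metis coprime_imp_gcd_eq_1)
  then have "real_poly (a * p + b * q) = 1" by simp
  then have "poly (real_poly a) x * poly (real_poly p) x + poly (real_poly b) x * poly (real_poly q) x = 1"
    by (metis poly_1 poly_add poly_mult real_poly_add real_poly_mult)
  then show ?thesis by auto
qed

lemma ratfun_cases:
  obtains p q where "quot_of_fract f = (p, q)" "q \<noteq> 0" "f = Fract p q" "coprime p q"
proof -
  obtain p q where pq: "quot_of_fract f = (p, q)" by (cases "quot_of_fract f")
  show ?thesis
  proof (rule that[OF pq])
    show "q \<noteq> 0" using snd_quot_of_fract_nonzero[of f] pq by simp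
    show "f = Fract p q" using quot_to_fract_quot_of_fract[of f] pq by (simp add: quot_to_fract_def)
    show "coprime p q" using coprime_quot_of_fract[of f] pq by simp
  qed
qed

section \<open>Values of rational functions as limits\<close>

lemma ratfun_Fract: "\<exists>p q. f = Fract p q \<and> q \<noteq> 0" for f :: ratfun
  by (cases f) auto

lemma ratfun_value_Fract:
  assumes "poly (real_poly q) x \<noteq> 0"
  shows "ratfun_value (Fract p q) x = poly (real_poly p) x / poly (real_poly q) x"
proof -
  obtain p0 q0 where pq: "quot_of_fract (Fract p q) = (p0, q0)" "q0 \<noteq> 0" "Fract p q = Fract p0 q0" "coprime p0 q0"
    by (rule ratfun_cases)
  have "q \<noteq> 0" using assms by auto
  then have "p * q0 = p0 * q" using pq by (simp add: eq_fract)
  then have e: "poly (real_poly p) x * poly (real_poly q0) x = poly (real_poly p0) x * poly (real_poly q) x"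
    by (metis poly_mult real_poly_mult)
  then have "poly (real_poly q0) x \<noteq> 0"
    using coprime_real_poly[OF pq(4), of x] assms by auto
  then show ?thesis using e assms pq(1) by (simp add: ratfun_value_def field_simps)
qed

lemma ratfun_to_real_Fract:
  assumes "q \<noteq> 0"
  shows "ratfun_to_real (Fract p q) = Fract (real_poly p) (real_poly q)"
proof -
  obtain p0 q0 where pq: "quot_of_fract (Fract p q) = (p0, q0)" "q0 \<noteq> 0" "Fract p q = Fract p0 q0" "coprime p0 q0"
    by (rule ratfun_cases)
  then have "p * q0 = p0 * q" using assms by (simp add: eq_fract)
  then have "real_poly p0 * real_poly q = real_poly p * real_poly q0" by (metis real_poly_mult)
  then show ?thesis using assms pq(2) unfolding ratfun_to_real_def pq(1) by (simp add: eq_fract)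
qed

text \<open>Limits avoid the finitely many zeros of denominators, so identities between fractions
  need to hold only eventually, and the point at infinity is treated like the others.\<close>

definition spec_filter :: "ennreal \<Rightarrow> real filter" where
  "spec_filter t = (if t = \<infinity> then at_top else at_right (enn2real t))"

lemma spec_filter_bot [simp]: "spec_filter t \<noteq> bot"
  by (simp add: spec_filter_def)

lemma eventually_spec_filter_notin:
  assumes "finite S"
  shows "\<forall>\<^sub>F x in spec_filter t. x \<notin> S"
proof -
  have "\<forall>\<^sub>F x in spec_filter t. x \<noteq> r" for r
    by (auto simp: spec_filter_def eventually_neq_at_within intro: eventually_mono[OF eventually_gt_at_top[of r]])
  then have "\<forall>\<^sub>F x in spec_filter t. \<forall>r\<in>S. x \<noteq> r"
    using assms by (simp add: eventually_ball_finite)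
  then show ?thesis by (rule eventually_mono) auto
qed

lemma eventually_spec_filter_poly:
  assumes "q \<noteq> 0"
  shows "\<forall>\<^sub>F x in spec_filter t. poly (real_poly q) x \<noteq> 0"
  using eventually_spec_filter_notin[OF poly_roots_finite[of "real_poly q"], of t] assms by simp

definition specs :: "ennreal \<Rightarrow> ratfun \<Rightarrow> real \<Rightarrow> bool" where
  "specs t f v \<longleftrightarrow> (ratfun_value f \<longlongrightarrow> v) (spec_filter t)"

lemma eventually_value:
  "\<forall>\<^sub>F x in spec_filter t. ratfun_value (f + g) x = ratfun_value f x + ratfun_value g x \<and>
     ratfun_value (f * g) x = ratfun_value f x * ratfun_value g x"
proof -
  obtain p q where f: "f = Fract p q" "q \<noteq> 0" using ratfun_Fract by blast
  obtain p' q' where g: "g = Fract p' q'" "q' \<noteq> 0" using ratfun_Fract by blast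
  have fg: "f + g = Fract (p * q' + p' * q) (q * q')" "f * g = Fract (p * p') (q * q')"
    using f g by simp_all
  show ?thesis
    using eventually_spec_filter_poly[OF f(2), of t] eventually_spec_filter_poly[OF g(2), of t]
  proof eventually_elim
    case (elim x)
    then have "poly (real_poly (q * q')) x \<noteq> 0" by (simp add: real_poly_mult)
    then show ?case
      using elim unfolding fg by (simp add: f(1) g(1) ratfun_value_Fract real_poly_mult real_poly_add add_frac_eq)
  qed
qed

lemma specs_add: "specs t f v \<Longrightarrow> specs t g w \<Longrightarrow> specs t (f + g) (v + w)"
  unfolding specs_def
  by (rule Lim_transform_eventually[OF tendsto_add]) (auto intro: eventually_mono[OF eventually_value[of f g t]])

lemma specs_mult: "specs t f v \<Longrightarrow> specs t g w \<Longrightarrow> specs t (f * g) (v * w)"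
  unfolding specs_def
  by (rule Lim_transform_eventually[OF tendsto_mult]) (auto intro: eventually_mono[OF eventually_value[of f g t]])

lemma specs_rat:
  assumes "f = Fract p q" "q \<noteq> 0" "((\<lambda>x. poly (real_poly p) x / poly (real_poly q) x) \<longlongrightarrow> v) (spec_filter t)"
  shows "specs t f v"
  unfolding specs_def
  by (rule tendsto_cong[THEN iffD2, OF eventually_mono[OF eventually_spec_filter_poly[OF assms(2)]] assms(3)])
    (simp add: assms(1) ratfun_value_Fract)

lemma specs_of_nat: "specs t (of_nat n) (of_nat n)"
proof (rule specs_rat)
  have "of_nat n = to_fract (of_nat n :: rat poly)" by (induction n) simp_all
  then show "of_nat n = Fract (of_nat n :: rat poly) 1" by (simp add: to_fract_def)
  have "real_poly (of_nat n) = of_nat n" by (induction n) (simp_all add: real_poly_add)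
  then show "((\<lambda>x. poly (real_poly (of_nat n)) x / poly (real_poly 1) x) \<longlongrightarrow> real n) (spec_filter t)" by simp
qed simp

lemma specs_1: "specs t 1 1"
  using specs_of_nat[of t 1] by simp

lemma specs_0: "specs t 0 0"
  using specs_of_nat[of t 0] by simp

lemma specs_uminus:
  assumes "specs t f v"
  shows "specs t (- f) (- v)"
proof -
  have "specs t (-1) (-1)"
  proof (rule specs_rat[of _ "-1" 1])
    have "real_poly (-1) = -1" by (rule poly_eqI) (simp add: coeff_map_poly coeff_1)
    then show "((\<lambda>x. poly (real_poly (-1)) x / poly (real_poly 1) x) \<longlongrightarrow> - 1) (spec_filter t)" by simp
  qed (simp_all add: One_fract_def)
  then show ?thesis using specs_mult[OF _ assms] by fastforce
qed

lemma specs_diff: "specs t f v \<Longrightarrow> specs t g w \<Longrightarrow> specs t (f - g) (v - w)"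
  using specs_add[OF _ specs_uminus, of t f v g w] by simp

lemma specs_sum: "(\<And>i. i \<in> I \<Longrightarrow> specs t (f i) (v i)) \<Longrightarrow> specs t (\<Sum>i\<in>I. f i) (\<Sum>i\<in>I. v i)"
  by (induction I rule: infinite_finite_induct) (auto intro: specs_add specs_0)

lemma specs_unique: "specs t f v \<Longrightarrow> specs t f w \<Longrightarrow> v = w"
  unfolding specs_def by (rule tendsto_unique[OF spec_filter_bot])

lemma specs_inverse:
  assumes "specs t f v" "v \<noteq> 0"
  shows "specs t (inverse f) (inverse v)"
proof -
  obtain p q where f: "f = Fract p q" "q \<noteq> 0" using ratfun_Fract by blast
  have "f \<noteq> 0" using assms specs_unique[OF _ specs_0] by blast
  then have p: "p \<noteq> 0" using f by (auto simp: fract_collapse)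
  have "((\<lambda>x. inverse (ratfun_value f x)) \<longlongrightarrow> inverse v) (spec_filter t)"
    using assms unfolding specs_def by (rule tendsto_inverse)
  then show ?thesis
    unfolding specs_def
  proof (rule tendsto_cong[THEN iffD2, rotated])
    show "\<forall>\<^sub>F x in spec_filter t. ratfun_value (inverse f) x = inverse (ratfun_value f x)"
      using eventually_spec_filter_poly[OF p, of t] eventually_spec_filter_poly[OF f(2), of t]
      by eventually_elim (simp add: f ratfun_value_Fract)
  qed
qed

lemma specs_divide: "specs t f v \<Longrightarrow> specs t g w \<Longrightarrow> w \<noteq> 0 \<Longrightarrow> specs t (f / g) (v / w)"
  unfolding divide_inverse by (intro specs_mult specs_inverse)

text \<open>A finite limit v excludes a pole at a: letting x tend to a in f q = p gives p(a) = v
  q(a), so q(a) = 0 would make a a common root of coprime polynomials.\<close>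

lemma ratfun_spec_eq:
  assumes "specs t f v"
  shows "ratfun_spec t f = v"
proof (cases "t = \<infinity>")
  case True
  then show ?thesis
    using assms tendsto_Lim[of at_top "ratfun_value f" v] by (simp add: ratfun_spec_def specs_def spec_filter_def)
next
  case False
  let ?a = "enn2real t"
  obtain p q where f: "quot_of_fract f = (p, q)" "q \<noteq> 0" "f = Fract p q" "coprime p q" by (rule ratfun_cases)
  have v: "(ratfun_value f \<longlongrightarrow> v) (at_right ?a)"
    using assms False by (simp add: specs_def spec_filter_def)
  have cont: "((\<lambda>x. poly r x) \<longlongrightarrow> poly r ?a) (at_right ?a)" for r :: "real poly"
    by (intro tendsto_within_subset[OF isContD[OF poly_isCont]]) auto
  have "((\<lambda>x. ratfun_value f x * poly (real_poly q) x) \<longlongrightarrow> v * poly (real_poly q) ?a) (at_right ?a)"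
    by (intro tendsto_mult v cont)
  moreover have "\<forall>\<^sub>F x in at_right ?a. ratfun_value f x * poly (real_poly q) x = poly (real_poly p) x"
    using eventually_spec_filter_poly[OF f(2), of t] False
    by (auto simp: spec_filter_def f(3) ratfun_value_Fract elim!: eventually_mono)
  ultimately have "((\<lambda>x. poly (real_poly p) x) \<longlongrightarrow> v * poly (real_poly q) ?a) (at_right ?a)"
    by (rule Lim_transform_eventually)
  then have e: "poly (real_poly p) ?a = v * poly (real_poly q) ?a"
    using tendsto_unique[OF _ cont] by (metis trivial_limit_at_right_real)
  then have "poly (real_poly q) ?a \<noteq> 0" using coprime_real_poly[OF f(4), of ?a] by auto
  then show ?thesis using e False by (simp add: ratfun_spec_def f(3) ratfun_value_Fract)
qed

text \<open>Rational functions built from \<open>(a + b \<tau>) / (c + e \<tau>)\<close> with \<open>c, e > 0\<close> have no pole in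
  \<open>[0, \<infinity>]\<close>, including the point at infinity.\<close>

inductive_set tame :: "ratfun set" where
  of_nat: "of_nat n \<in> tame"
| add: "f \<in> tame \<Longrightarrow> g \<in> tame \<Longrightarrow> f + g \<in> tame"
| mult: "f \<in> tame \<Longrightarrow> g \<in> tame \<Longrightarrow> f * g \<in> tame"
| frac: "0 < c \<Longrightarrow> 0 < e \<Longrightarrow> (of_nat a + of_nat b * tau) / (of_nat c + of_nat e * tau) \<in> tame"

lemma tame_0: "0 \<in> tame" and tame_1: "1 \<in> tame"
  using tame.of_nat[of 0] tame.of_nat[of 1] by simp_all

lemma tame_sum: "(\<And>i. i \<in> I \<Longrightarrow> f i \<in> tame) \<Longrightarrow> (\<Sum>i\<in>I. f i) \<in> tame"
  by (induction I rule: infinite_finite_induct) (auto intro: tame.add tame_0)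

lemma linear_to_fract: "of_nat a + of_nat b * tau = to_fract [:of_nat a, of_nat b:]"
proof -
  have n: "of_nat n = to_fract (of_nat n :: rat poly)" for n by (induction n) simp_all
  have "of_nat a + of_nat b * tau = to_fract (of_nat a + of_nat b * [:0, 1:])"
    by (simp only: to_fract_add to_fract_mult n tau_to_fract)
  also have "of_nat a + of_nat b * [:0, 1:] = [:of_nat a, of_nat b :: rat:]"
    by (simp add: of_nat_poly)
  finally show ?thesis .
qed

lemma linear_frac: "(of_nat a + of_nat b * tau) / (of_nat c + of_nat e * tau) = Fract [:of_nat a, of_nat b:] [:of_nat c, of_nat e:]"
  unfolding linear_to_fract Fract_conv_to_fract ..

text \<open>Sums and products inherit limits. A single fraction is continuous on [0, infinity),
  where c + e x stays positive, and tends to b / e at infinity.\<close>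

lemma tame_specs: "f \<in> tame \<Longrightarrow> \<exists>v\<ge>0. specs t f v"
proof (induction rule: tame.induct)
  case (of_nat n)
  then show ?case using specs_of_nat of_nat_0_le_iff by blast
next
  case (add f g)
  then show ?case using specs_add add_nonneg_nonneg by blast
next
  case (mult f g)
  then show ?case using specs_mult mult_nonneg_nonneg by blast
next
  case (frac c e a b)
  have p: "poly (real_poly [:of_nat i, of_nat j:]) x = real i + real j * x" for i j x
    by (simp add: map_poly_pCons)
  have *: "specs t ((of_nat a + of_nat b * tau) / (of_nat c + of_nat e * tau)) v"
    if "((\<lambda>x. (real a + real b * x) / (real c + real e * x)) \<longlongrightarrow> v) (spec_filter t)" for v
    using frac that by (intro specs_rat[OF linear_frac]) (simp_all only: p, simp)
  show ?case
  proof (cases "t = \<infinity>")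
    case True
    have "filterlim (\<lambda>x. real c + real e * x) at_top at_top"
      using frac by (intro filterlim_tendsto_add_at_top[OF tendsto_const]
          filterlim_tendsto_pos_mult_at_top[OF tendsto_const _ filterlim_ident]) auto
    \<comment> \<open>Prepares the decomposition (a + b x) / (c + e x) = b / e + (a - b c / e) / (c
      + e x).\<close>
    then have "((\<lambda>x. (real a - real b * real c / real e) / (real c + real e * x)) \<longlongrightarrow> 0) at_top"
      by (intro tendsto_divide_0[OF tendsto_const] filterlim_at_top_imp_at_infinity)
    then have "((\<lambda>x. real b / real e + (real a - real b * real c / real e) / (real c + real e * x)) \<longlongrightarrow> real b / real e + 0) at_top"
      by (intro tendsto_add tendsto_const)
    moreover have "\<forall>\<^sub>F x in at_top. real b / real e + (real a - real b * real c / real e) / (real c + real e * x) =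
        (real a + real b * x) / (real c + real e * x)"
      using eventually_ge_at_top[of "0::real"]
    proof eventually_elim
      case (elim x)
      define D where "D = real c + real e * x"
      have "D > 0" unfolding D_def using frac elim by (intro add_pos_nonneg) auto
      moreover have "real a + real b * x = real b / real e * D + (real a - real b * real c / real e)"
        using frac by (simp add: D_def field_simps)
      moreover have "(u * D + w) / D = u + w / D" for u w
        using \<open>D > 0\<close> by (simp add: add_divide_distrib)
      ultimately show ?case unfolding D_def[symmetric] by (simp only:)
    qed
    ultimately have "((\<lambda>x. (real a + real b * x) / (real c + real e * x)) \<longlongrightarrow> real b / real e + 0) at_top"
      by (rule Lim_transform_eventually)
    then show ?thesis using * True by (intro exI[of _ "real b / real e"]) (simp add: spec_filter_def)
  next
    case False
    have "real c + real e * enn2real t > 0" using frac by (intro add_pos_nonneg) auto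
    then have "((\<lambda>x. (real a + real b * x) / (real c + real e * x)) \<longlongrightarrow>
        (real a + real b * enn2real t) / (real c + real e * enn2real t)) (at_right (enn2real t))"
      by (intro tendsto_intros) auto
    then show ?thesis using * False
      by (intro exI[of _ "(real a + real b * enn2real t) / (real c + real e * enn2real t)"]) (simp add: spec_filter_def)
  qed
qed

lemma tame_spec:
  assumes "f \<in> tame"
  shows "specs t f (ratfun_spec t f)" "0 \<le> ratfun_spec t f"
  using tame_specs[OF assms, of t] ratfun_spec_eq by auto

text \<open>The eigenvalue equation for k = 1 at m expresses (A + B tau) times the coefficient at m
  as a sum of coefficients at n, each times N tau with a natural number N, over n strictly above m.
  By \<open>majorizes_strict\<close> A and B are positive integers, so every factor N tau / (A + B
  tau) is tame.\<close>

lemma jack_tame: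
  assumes l: "l \<in> parts_of_size d" and m: "m \<in> parts_of_size d"
  shows "jack l m \<in> tame"
  using m
proof (induction "weight_sum m" arbitrary: m rule: less_induct)
  case less
  note m = less.prems
  have li: "l \<in> int_partitions" and mi: "m \<in> int_partitions" using l m parts_of_sizeD by auto
  show ?case
  proof (cases "jack l m = 0 \<or> l = m")
    case True
    then show ?thesis using jack_diag[OF li] tame_0 tame_1 by auto
  next
    case False
    then have maj: "majorizes l m" and ne: "l \<noteq> m" using jack_support[OF li mi] by auto
    define A where "A = square_sum l - square_sum m"
    define B where "B = 2 * (weight_sum m - weight_sum l)"
    have s: "weight_sum l < weight_sum m" "square_sum m < square_sum l"
      using majorizes_strict[OF mi maj ne] .
    then have AB: "0 < A" "0 < B" by (auto simp: A_def B_def)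
    have "jop_entry 1 l l - jop_entry 1 m m = of_nat A + of_nat B * tau"
      using s jop1_diag[OF li, of tau] jop1_diag[OF mi, of tau]
      by (simp add: A_def B_def of_nat_diff algebra_simps)
    moreover have "of_nat A + of_nat B * tau > 0"
      using AB tau_pos by (intro add_pos_pos mult_pos_pos) auto
    ultimately have pos: "jop_entry 1 l l - jop_entry 1 m m = of_nat A + of_nat B * tau"
      "of_nat A + of_nat B * tau \<noteq> 0" by auto
    have "(\<Sum>n\<in>parts_of_size d. jack l n * jop_entry 1 n m) =
       jack l m * jop_entry 1 m m + (\<Sum>n\<in>parts_of_size d - {m}. jack l n * jop_entry 1 n m)"
      using m finite_parts_of_size by (simp add: sum.remove)
    then have "jack l m * (of_nat A + of_nat B * tau) = (\<Sum>n\<in>parts_of_size d - {m}. jack l n * jop_entry 1 n m)"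
      using jack_eigen[OF l m, of 1] pos(1) by (simp add: algebra_simps)
    then have "jack l m = (\<Sum>n\<in>parts_of_size d - {m}. jack l n * jop_entry 1 n m) / (of_nat A + of_nat B * tau)"
      using pos(2) by (simp add: field_simps)
    then have e: "jack l m = (\<Sum>n\<in>parts_of_size d - {m}. jack l n * (jop_entry 1 n m / (of_nat A + of_nat B * tau)))"
      by (simp add: sum_divide_distrib)
    show ?thesis
      unfolding e
    proof (rule tame_sum)
      fix n assume n: "n \<in> parts_of_size d - {m}"
      then have ni: "n \<in> int_partitions" using parts_of_sizeD(1)[of n d] by blast
      show "jack l n * (jop_entry 1 n m / (of_nat A + of_nat B * tau)) \<in> tame"
      proof (cases "jop_entry 1 n m = 0")
        case True
        then show ?thesis using tame_0 by simp
      next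
        case False
        then have "majorizes n m" by (rule jop_entry_majorizes[OF ni])
        then have "weight_sum n < weight_sum m" using n mi by (intro majorizes_strict(1)) auto
        then have "jack l n \<in> tame" using less.hyps n by blast
        moreover have "parts m \<noteq> parts n" using parts_inj[OF ni mi] n by auto
        then obtain N where N: "jop_entry 1 n m = tau * of_nat N"
          using jop1_offdiag[of m n tau] by blast
        moreover have "(of_nat 0 + of_nat N * tau) / (of_nat A + of_nat B * tau) \<in> tame"
          using AB by (rule tame.frac)
        moreover have "jop_entry 1 n m = of_nat 0 + of_nat N * tau"
          using N by (simp add: mult.commute)
        ultimately show ?thesis by (simp only: tame.mult)
      qed
    qed
  qed
qed

section \<open>Cones of rational functions\<close>

definition fract_cone :: "'a::idom set \<Rightarrow> 'a poly fract set" where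
  "fract_cone C = {Fract f g | f g. (\<forall>i. coeff f i \<in> C) \<and> (\<forall>i. coeff g i \<in> C) \<and> g \<noteq> 0}"

definition semiring_closed :: "'a::comm_semiring_1 set \<Rightarrow> bool" where
  "semiring_closed C \<longleftrightarrow> 0 \<in> C \<and> 1 \<in> C \<and> (\<forall>x\<in>C. \<forall>y\<in>C. x + y \<in> C \<and> x * y \<in> C)"

definition semifield_closed :: "'a::field set \<Rightarrow> bool" where
  "semifield_closed C \<longleftrightarrow> semiring_closed C \<and> (\<forall>x\<in>C. inverse x \<in> C)"

lemma semiring_closed_sum: "semiring_closed C \<Longrightarrow> (\<And>i. i \<in> I \<Longrightarrow> f i \<in> C) \<Longrightarrow> (\<Sum>i\<in>I. f i) \<in> C"
  by (induction I rule: infinite_finite_induct) (auto simp: semiring_closed_def)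

lemma semiring_closed_of_nat: "semiring_closed C \<Longrightarrow> of_nat n \<in> C"
  by (induction n) (auto simp: semiring_closed_def)

lemma semifield_closedD:
  assumes "semifield_closed C"
  shows "semiring_closed C" "0 \<in> C" "1 \<in> C" "x \<in> C \<Longrightarrow> y \<in> C \<Longrightarrow> x + y \<in> C"
    "x \<in> C \<Longrightarrow> y \<in> C \<Longrightarrow> x * y \<in> C" "x \<in> C \<Longrightarrow> y \<in> C \<Longrightarrow> x / y \<in> C"
  using assms by (auto simp: semifield_closed_def semiring_closed_def divide_inverse)

lemma semifield_closed_nonneg: "semifield_closed {c :: 'a::linordered_field. 0 \<le> c}"
  by (auto simp: semifield_closed_def semiring_closed_def)

text \<open>Common denominators settle sums and products. The inverse of a fraction with numerator 0
  is 0 and is treated apart, since exchanging numerator and denominator would fail there.\<close>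

lemma semifield_closed_fract_cone:
  assumes C: "semiring_closed C"
  shows "semifield_closed (fract_cone C)"
proof -
  have m: "\<forall>i. coeff (f * g) i \<in> C" if "\<forall>i. coeff f i \<in> C" "\<forall>i. coeff g i \<in> C" for f g
    using that C by (auto simp: coeff_mult semiring_closed_def intro!: semiring_closed_sum[OF C])
  have a: "\<forall>i. coeff (f + g) i \<in> C" if "\<forall>i. coeff f i \<in> C" "\<forall>i. coeff g i \<in> C" for f g
    using that C by (auto simp: semiring_closed_def)
  have z: "\<forall>i. coeff 0 i \<in> C" "\<forall>i. coeff 1 i \<in> C" using C by (auto simp: semiring_closed_def coeff_1)
  have "Fract f g + Fract f' g' \<in> fract_cone C \<and> Fract f g * Fract f' g' \<in> fract_cone C"
    if "\<forall>i. coeff f i \<in> C" "\<forall>i. coeff g i \<in> C" "g \<noteq> 0" "\<forall>i. coeff f' i \<in> C" "\<forall>i. coeff g' i \<in> C" "g' \<noteq> 0" for f g f' g'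
    using that m a unfolding fract_cone_def by (auto intro!: exI)
  moreover have zero: "0 \<in> fract_cone C" "1 \<in> fract_cone C"
  proof -
    have I: "Fract p q \<in> fract_cone C" if "\<forall>i. coeff p i \<in> C" "\<forall>i. coeff q i \<in> C" "q \<noteq> 0" for p q
      using that by (auto simp: fract_cone_def)
    show "0 \<in> fract_cone C" "1 \<in> fract_cone C"
      unfolding Zero_fract_def One_fract_def using I[OF z one_neq_zero] I[OF z(2,2) one_neq_zero] .
  qed
  moreover have "inverse (Fract f g) \<in> fract_cone C"
    if "\<forall>i. coeff f i \<in> C" "\<forall>i. coeff g i \<in> C" "g \<noteq> 0" for f g
  proof (cases "f = 0")
    case True
    then have "inverse (Fract f g) = 0" by (simp add: fract_collapse)
    then show ?thesis using zero by simp
  next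
    case False
    then show ?thesis using that unfolding fract_cone_def by auto
  qed
  ultimately show ?thesis
    unfolding semifield_closed_def semiring_closed_def by (fastforce simp: fract_cone_def)
qed

lemma F_nonneg_fract_cone: "F_nonneg = fract_cone \<nat>"
  by (simp add: F_nonneg_def fract_cone_def)

lemma F_nonneg_real_fract_cone: "F_nonneg_real = fract_cone {c. 0 \<le> c}"
  by (simp add: F_nonneg_real_def fract_cone_def)

lemma semifield_closed_F_nonneg: "semifield_closed F_nonneg"
  unfolding F_nonneg_fract_cone by (rule semifield_closed_fract_cone) (auto simp: semiring_closed_def)

lemma semifield_closed_F_nonneg_real: "semifield_closed F_nonneg_real"
  unfolding F_nonneg_real_fract_cone by (rule semifield_closed_fract_cone) (auto simp: semiring_closed_def)

lemma tame_F_nonneg: "f \<in> tame \<Longrightarrow> f \<in> F_nonneg"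
proof (induction rule: tame.induct)
  case (of_nat n)
  then show ?case using semiring_closed_of_nat[OF semifield_closedD(1)[OF semifield_closed_F_nonneg]] .
next
  case (frac c e a b)
  have "\<forall>i. coeff [:of_nat x, of_nat y:] i \<in> (\<nat> :: rat set)" for x y
    by (auto simp: coeff_pCons split: nat.split)
  moreover have "[:of_nat c, of_nat e:] \<noteq> (0 :: rat poly)" using frac by simp
  ultimately show ?case unfolding linear_frac F_nonneg_def by blast
qed (use semifield_closedD[OF semifield_closed_F_nonneg] in auto)

text \<open>Coefficients in C include the leading one, which decides the sign; this opens the cones
  to arguments in ordered fields.\<close>

lemma fract_cone_nonneg:
  fixes C :: "'a::linordered_field set"
  assumes "C \<subseteq> {c. 0 \<le> c}"
  shows "fract_cone C \<subseteq> {c. 0 \<le> c}"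
proof
  fix x assume "x \<in> fract_cone C"
  then obtain f g where x: "x = Fract f g" "\<forall>i. coeff f i \<in> C" "\<forall>i. coeff g i \<in> C" "g \<noteq> 0"
    by (auto simp: fract_cone_def)
  have nn: "0 \<le> p" if "\<forall>i. coeff p i \<in> C" for p :: "'a poly"
  proof -
    have "0 \<le> coeff p (degree p)" using that assms by blast
    then show ?thesis
      by (cases "p = 0") (auto simp: less_eq_poly_def pos_poly_def order_less_le)
  qed
  have "0 \<le> f" "0 < g" using nn x by (auto simp: order_less_le)
  then show "x \<in> {c. 0 \<le> c}" using x by (simp add: zero_le_Fract_iff)
qed

lemma F_nonneg_nonneg: "F_nonneg \<subseteq> {c. 0 \<le> c}"
  unfolding F_nonneg_fract_cone by (rule fract_cone_nonneg) (auto elim!: Nats_cases)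

lemma F_nonneg_real_nonneg: "F_nonneg_real \<subseteq> {c. 0 \<le> c}"
  unfolding F_nonneg_real_fract_cone by (rule fract_cone_nonneg) simp

lemma ratfun_to_real_F_nonneg:
  assumes "f \<in> F_nonneg"
  shows "ratfun_to_real f \<in> F_nonneg_real"
proof -
  obtain p q where f: "f = Fract p q" "\<forall>i. coeff p i \<in> \<nat>" "\<forall>i. coeff q i \<in> \<nat>" "q \<noteq> 0"
    using assms by (auto simp: F_nonneg_def)
  have "0 \<le> (of_rat x :: real)" if "x \<in> \<nat>" for x using that by (auto elim!: Nats_cases)
  then have "\<forall>i. 0 \<le> coeff (real_poly p) i" "\<forall>i. 0 \<le> coeff (real_poly q) i"
    using f by (auto simp: coeff_map_poly)
  moreover have "real_poly q \<noteq> 0" using f(4) by simp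
  ultimately show ?thesis
    unfolding f(1) ratfun_to_real_Fract[OF f(4)] F_nonneg_real_def by blast
qed

lemma ratfun_to_real_1: "ratfun_to_real 1 = 1"
  using ratfun_to_real_Fract[of 1 1] by (simp add: One_fract_def)

section \<open>Muirhead means and one-column partitions\<close>

definition mono_val :: "(nat \<Rightarrow> 'a::comm_semiring_1) \<Rightarrow> expo \<Rightarrow> 'a" where
  "mono_val x a = (\<Prod>i\<in>keys a. x i ^ lookup a i)"

lemma mono_val_superset:
  assumes "finite A" "keys a \<subseteq> A"
  shows "mono_val x a = (\<Prod>i\<in>A. x i ^ lookup a i)"
  unfolding mono_val_def using assms by (intro prod.mono_neutral_left) (auto simp: in_keys_iff)

lemma mono_val_0 [simp]: "mono_val x 0 = 1"
  by (simp add: mono_val_def)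

lemma mono_val_add: "mono_val x (a + b) = mono_val x a * mono_val x b"
proof -
  let ?A = "keys a \<union> keys b"
  have "keys (a + b) \<subseteq> ?A" by (rule keys_add)
  then show ?thesis
    by (simp add: mono_val_superset[of ?A] lookup_add power_add prod.distrib)
qed

lemma mono_val_sum: "mono_val x (\<Sum>i\<in>I. f i) = (\<Prod>i\<in>I. mono_val x (f i))"
  by (induction I rule: infinite_finite_induct) (simp_all add: mono_val_add)

lemma mono_val_one [simp]: "mono_val (\<lambda>_. 1) a = 1"
  by (simp add: mono_val_def)

lemma mv_eval_superset:
  assumes "finite A" "keys f \<subseteq> A"
  shows "mv_eval x f = (\<Sum>a\<in>A. lookup f a * mono_val x a)"
  unfolding mv_eval_def mono_val_def[symmetric]
  using assms by (intro sum.mono_neutral_left) (auto simp: in_keys_iff)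

lemma mv_eval_0 [simp]: "mv_eval x 0 = 0"
  by (simp add: mv_eval_def)

lemma mv_eval_add: "mv_eval x (f + g) = mv_eval x f + mv_eval x g"
proof -
  let ?A = "keys f \<union> keys g"
  have "keys (f + g) \<subseteq> ?A" by (rule keys_add)
  then show ?thesis
    by (simp add: mv_eval_superset[of ?A] lookup_add algebra_simps sum.distrib)
qed

lemma mv_eval_single: "mv_eval x (Poly_Mapping.single a c) = c * mono_val x a"
  by (simp add: mv_eval_superset[of "{a}"])

lemma mv_eval_const [simp]: "mv_eval x (mv_const c) = c"
  by (simp add: mv_const_def mv_eval_single)

lemma mv_eval_sum: "mv_eval x (\<Sum>i\<in>I. f i) = (\<Sum>i\<in>I. mv_eval x (f i))"
  by (induction I rule: infinite_finite_induct) (auto simp: mv_eval_add)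

lemma sum_singles: "f = (\<Sum>a\<in>keys f. Poly_Mapping.single a (lookup f a))"
proof (rule poly_mapping_eqI)
  fix k
  have "(\<Sum>a\<in>keys f. lookup f a when a = k) = (\<Sum>a\<in>keys f. if a = k then lookup f a else 0)"
    by (intro sum.cong) (auto simp: when_def)
  then show "lookup f k = lookup (\<Sum>a\<in>keys f. Poly_Mapping.single a (lookup f a)) k"
    by (simp add: lookup_sum lookup_single in_keys_iff)
qed

lemma mv_eval_mult: "mv_eval x (f * g) = mv_eval x f * mv_eval x g"
proof -
  have "mv_eval x (f * g) = mv_eval x ((\<Sum>a\<in>keys f. Poly_Mapping.single a (lookup f a)) * (\<Sum>b\<in>keys g. Poly_Mapping.single b (lookup g b)))"
    using sum_singles[of f] sum_singles[of g] by simp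
  also have "\<dots> = (\<Sum>a\<in>keys f. \<Sum>b\<in>keys g. (lookup f a * lookup g b) * (mono_val x a * mono_val x b))"
    by (simp add: sum_product mult_single mv_eval_sum mv_eval_single mono_val_add)
  also have "\<dots> = mv_eval x f * mv_eval x g"
    by (simp add: mv_eval_def mono_val_def[symmetric] sum_product mult_ac)
  finally show ?thesis .
qed

lemma mv_eval_minus: "mv_eval x (f - g) = mv_eval x f - mv_eval x (g :: 'a::comm_ring_1 mvpoly)"
  using mv_eval_add[of x "f - g" g] by (simp add: algebra_simps)

lemma mv_eval_normalize: "mv_eval x (normalize_at_one f) = mv_eval x f / mv_eval (\<lambda>_. 1) f"
  by (simp add: normalize_at_one_def mv_eval_mult)

lemma lookup_const_mult: "lookup (mv_const c * f) a = c * lookup f a"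
proof -
  have "mv_const c * f = Poly_Mapping.map ((*) c) f"
    unfolding mv_const_def by (rule mult_map_scale_conv_mult[symmetric])
  then show ?thesis by (simp add: Poly_Mapping.map.rep_eq when_def)
qed

lemma mv_const_mult: "mv_const (c * d) = mv_const c * mv_const d"
  by (simp add: mv_const_def mult_single)

lemma mv_const_add: "mv_const (c + d) = mv_const c + mv_const d"
  by (simp add: mv_const_def single_add)

lemma mv_const_0 [simp]: "mv_const 0 = 0" and mv_const_1 [simp]: "mv_const 1 = 1"
  by (simp_all add: mv_const_def)

lemma mv_const_sum: "mv_const (\<Sum>i\<in>I. f i) = (\<Sum>i\<in>I. mv_const (f i))"
  by (induction I rule: infinite_finite_induct) (auto simp: mv_const_add)

section \<open>Symmetric polynomials in n variables and Muirhead means\<close>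

lemma finite_bounded_expos: "finite {a. keys a \<subseteq> {..<n} \<and> partition_size a = d}"
proof -
  let ?X = "{a. keys a \<subseteq> {..<n} \<and> partition_size a = d}"
  have "lookup ` ?X \<subseteq> {f. \<forall>i. (i \<in> {..<n} \<longrightarrow> f i \<in> {..d}) \<and> (i \<notin> {..<n} \<longrightarrow> f i = 0)}"
    using lookup_le_size by (auto simp: in_keys_iff)
  then have "finite (lookup ` ?X)"
    by (rule finite_subset) (intro finite_set_of_finite_funs, auto)
  then show ?thesis by (rule finite_imageD) (auto simp: inj_on_def poly_mapping_eqI)
qed

lemma lookup_restrict_vars:
  assumes "\<And>a. F a \<noteq> 0 \<Longrightarrow> partition_size a = d"
  shows "lookup (restrict_vars n F) a = (if keys a \<subseteq> {..<n} then F a else 0)"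
proof -
  have "finite {a. (if keys a \<subseteq> {..<n} then F a else 0) \<noteq> 0}"
    by (rule finite_subset[OF _ finite_bounded_expos[of n d]]) (use assms in \<open>auto split: if_splits\<close>)
  then show ?thesis by (simp add: restrict_vars_def)
qed

abbreviation mono_poly :: "nat \<Rightarrow> expo \<Rightarrow> 'a::comm_semiring_1 mvpoly" where
  "mono_poly n m \<equiv> restrict_vars n (sf_monomial m)"

definition orbit :: "nat \<Rightarrow> expo \<Rightarrow> expo set" where
  "orbit n m = {a. keys a \<subseteq> {..<n} \<and> parts a = parts m}"

lemma finite_orbit: "finite (orbit n m)"
proof (rule finite_subset[OF _ finite_bounded_expos[of n "partition_size m"]])
  show "orbit n m \<subseteq> {a. keys a \<subseteq> {..<n} \<and> partition_size a = partition_size m}"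
    unfolding orbit_def using sum_parts by (auto, metis)
qed

lemma sf_monomial_size: "(sf_monomial l a :: 'a::comm_semiring_1) \<noteq> 0 \<Longrightarrow> partition_size a = partition_size l"
  by (auto simp: sf_monomial_parts split: if_splits) (metis sum_parts)

lemma lookup_mono_poly: "lookup (mono_poly n m) a = (if a \<in> orbit n m then 1 else 0)"
  by (subst lookup_restrict_vars[OF sf_monomial_size]) (auto simp: orbit_def sf_monomial_parts)

lemma keys_mono_poly: "keys (mono_poly n m :: 'a::comm_semiring_1 mvpoly) \<subseteq> orbit n m"
  by (auto simp: in_keys_iff lookup_mono_poly split: if_splits)

lemma mv_eval_mono_poly: "mv_eval x (mono_poly n m) = (\<Sum>a\<in>orbit n m. mono_val x a)"
  by (subst mv_eval_superset[OF finite_orbit keys_mono_poly]) (simp add: lookup_mono_poly)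

lemma mv_eval_mono_poly_1: "mv_eval (\<lambda>_. 1) (mono_poly n m) = of_nat (card (orbit n m))"
  by (simp add: mv_eval_mono_poly)

lemma card_orbit_pos:
  assumes "m \<in> partitions_upto n"
  shows "0 < card (orbit n m)"
proof -
  have "m \<in> orbit n m" using assms by (simp add: orbit_def partitions_upto_def)
  then show ?thesis using finite_orbit card_gt_0_iff by blast
qed

text \<open>A vector with the parts of m has as many nonzero entries as m, so it fits into n
  variables only if m does.\<close>

lemma orbit_empty:
  assumes "m \<in> int_partitions" "m \<notin> partitions_upto n"
  shows "orbit n m = {}"
proof (rule ccontr)
  assume "orbit n m \<noteq> {}"
  then obtain a where a: "keys a \<subseteq> {..<n}" "parts a = parts m" by (auto simp: orbit_def)
  have "partition_length m = partition_length a" using a(2) size_parts by metis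
  also have "\<dots> \<le> n" using card_mono[OF _ a(1)] by (simp add: partition_length_def)
  finally have "keys m \<subseteq> {..<n}" using partition_keys[OF assms(1)] by auto
  then show False using assms by (simp add: partitions_upto_def)
qed

lemma mono_poly_mean:
  assumes "m \<in> int_partitions"
  shows "(mono_poly n m :: 'a::field_char_0 mvpoly) =
    (if m \<in> partitions_upto n then mv_const (of_nat (card (orbit n m))) * muirhead_mean n m else 0)"
proof (cases "m \<in> partitions_upto n")
  case True
  let ?c = "of_nat (card (orbit n m)) :: 'a"
  have "?c \<noteq> 0" using card_orbit_pos[OF True] by simp
  then have "mv_const ?c * (mv_const (1 / ?c) * mono_poly n m) = mono_poly n m"
    by (simp add: mult.assoc[symmetric] mv_const_mult[symmetric])
  then show ?thesis using True by (simp add: muirhead_mean_def normalize_at_one_def mv_eval_mono_poly_1)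
next
  case False
  have "mono_poly n m = (0 :: 'a mvpoly)"
    by (rule poly_mapping_eqI) (simp add: lookup_mono_poly orbit_empty[OF assms False])
  then show ?thesis using False by simp
qed

text \<open>Common shape of the generic, the real and the specialized Jack polynomials, so that the
  following is proved once for an arbitrary coefficient function \<open>k\<close>. Partitions with
  more than n parts contribute 0.\<close>

definition sym_poly :: "nat \<Rightarrow> nat \<Rightarrow> (expo \<Rightarrow> 'a::comm_semiring_1) \<Rightarrow> 'a mvpoly" where
  "sym_poly n d k = (\<Sum>m\<in>parts_of_size d. mv_const (k m) * mono_poly n m)"

definition sort_parts :: "expo \<Rightarrow> expo" where
  "sort_parts a = (THE m. m \<in> int_partitions \<and> parts m = parts a)"

lemma sort_parts: "sort_parts a \<in> int_partitions" "parts (sort_parts a) = parts a"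
proof -
  have "\<exists>!m. m \<in> int_partitions \<and> parts m = parts a"
    using parts_surj[of "parts a"] parts_inj by auto
  from theI'[OF this] show "sort_parts a \<in> int_partitions" "parts (sort_parts a) = parts a"
    by (simp_all add: sort_parts_def)
qed

lemma sort_parts_eq: "m \<in> int_partitions \<Longrightarrow> parts m = parts a \<longleftrightarrow> m = sort_parts a"
  using parts_inj[of m "sort_parts a"] sort_parts[of a] by auto

lemma sort_parts_size: "partition_size (sort_parts a) = partition_size a"
  using sort_parts(2)[of a] sum_parts by metis

lemma lookup_sym_poly:
  "lookup (sym_poly n d k) a = (if keys a \<subseteq> {..<n} \<and> partition_size a = d then k (sort_parts a) else 0)"
proof -
  have "lookup (sym_poly n d k) a = (\<Sum>m\<in>parts_of_size d. k m * (if a \<in> orbit n m then 1 else 0))"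
    by (simp add: sym_poly_def lookup_sum lookup_const_mult lookup_mono_poly)
  also have "\<dots> = (\<Sum>m\<in>parts_of_size d. if m = sort_parts a then (if keys a \<subseteq> {..<n} then k m else 0) else 0)"
    by (intro sum.cong) (auto simp: orbit_def parts_of_sizeD sort_parts_eq[symmetric] dest: parts_of_sizeD(1))
  also have "\<dots> = (if sort_parts a \<in> parts_of_size d then (if keys a \<subseteq> {..<n} then k (sort_parts a) else 0) else 0)"
    using finite_parts_of_size by simp
  also have "\<dots> = (if keys a \<subseteq> {..<n} \<and> partition_size a = d then k (sort_parts a) else 0)"
    using sort_parts(1)[of a] by (auto simp: parts_of_size_def sort_parts_size)
  finally show ?thesis .
qed

lemma jack_poly_sym_poly:
  assumes "l \<in> parts_of_size d"
  shows "jack_poly n l = sym_poly n d (jack l)"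
proof (rule poly_mapping_eqI)
  fix a
  have i: "inspan d (jack l)" using jack_inspan[OF assms] .
  have "jack l a = jack l (sort_parts a)"
    using symmetric_parts[OF inspan_symmetric[OF i]] sort_parts(2) by metis
  then show "lookup (jack_poly n l) a = lookup (sym_poly n d (jack l)) a"
    using inspan_size[OF i, of a]
    by (auto simp: jack_poly_def lookup_restrict_vars[OF inspan_size[OF i]] lookup_sym_poly)
qed

lemma map_sym_poly:
  assumes "f 0 = 0"
  shows "Poly_Mapping.map f (sym_poly n d k) = sym_poly n d (\<lambda>m. f (k m))"
  by (rule poly_mapping_eqI) (auto simp: Poly_Mapping.map.rep_eq lookup_sym_poly when_def assms)

text \<open>Coefficient of the Muirhead mean of m after normalization at (1,...,1); the orbit size
  converts the monomial polynomial into its mean.\<close>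

definition sym_weight :: "nat \<Rightarrow> nat \<Rightarrow> (expo \<Rightarrow> 'a::field) \<Rightarrow> expo \<Rightarrow> 'a" where
  "sym_weight n d k m = k m * of_nat (card (orbit n m)) / mv_eval (\<lambda>_. 1) (sym_poly n d k)"

lemma mv_eval_sym_poly: "mv_eval x (sym_poly n d k) = (\<Sum>m\<in>parts_of_size d. k m * mv_eval x (mono_poly n m))"
  by (simp add: sym_poly_def mv_eval_sum mv_eval_mult)

abbreviation bounded_parts :: "nat \<Rightarrow> nat \<Rightarrow> expo set" where
  "bounded_parts n d \<equiv> parts_of_size d \<inter> partitions_upto n"

lemma sum_sym_weight:
  assumes "mv_eval (\<lambda>_. 1) (sym_poly n d k) \<noteq> (0 :: 'a::field_char_0)"
  shows "(\<Sum>m\<in>bounded_parts n d. sym_weight n d k m) = 1"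
proof -
  have "(\<Sum>m\<in>bounded_parts n d. sym_weight n d k m) = (\<Sum>m\<in>parts_of_size d. sym_weight n d k m)"
  proof (intro sum.mono_neutral_left ballI)
    fix m assume "m \<in> parts_of_size d - bounded_parts n d"
    then have "orbit n m = {}" using orbit_empty[of m n] parts_of_sizeD(1)[of m d] by blast
    then show "sym_weight n d k m = 0" by (simp add: sym_weight_def)
  qed (auto simp: finite_parts_of_size)
  also have "\<dots> = 1"
    using assms by (simp add: sym_weight_def sum_divide_distrib[symmetric] mv_eval_sym_poly mv_eval_mono_poly_1)
  finally show ?thesis .
qed

lemma normalize_sym_poly:
  fixes k :: "expo \<Rightarrow> 'a::field_char_0"
  shows "normalize_at_one (sym_poly n d k) = (\<Sum>m\<in>bounded_parts n d. mv_const (sym_weight n d k m) * muirhead_mean n m)"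
proof -
  let ?s = "mv_eval (\<lambda>_. 1) (sym_poly n d k)"
  have "normalize_at_one (sym_poly n d k) = (\<Sum>m\<in>parts_of_size d. mv_const (1 / ?s) * (mv_const (k m) * mono_poly n m))"
    unfolding normalize_at_one_def by (simp add: sym_poly_def sum_distrib_left)
  also have "\<dots> = (\<Sum>m\<in>parts_of_size d. if m \<in> partitions_upto n then mv_const (sym_weight n d k m) * muirhead_mean n m else 0)"
  proof (rule sum.cong[OF refl])
    fix m assume "m \<in> parts_of_size d"
    then have m: "m \<in> int_partitions" by (rule parts_of_sizeD)
    have w: "sym_weight n d k m = 1 / ?s * (k m * of_nat (card (orbit n m)))"
      by (simp add: sym_weight_def)
    show "mv_const (1 / ?s) * (mv_const (k m) * mono_poly n m) =
      (if m \<in> partitions_upto n then mv_const (sym_weight n d k m) * muirhead_mean n m else 0)"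
      unfolding w mono_poly_mean[OF m] by (cases "m \<in> partitions_upto n") (simp_all only: if_True if_False mv_const_mult mult.assoc mult_zero_right)
  qed
  also have "\<dots> = (\<Sum>m\<in>bounded_parts n d. mv_const (sym_weight n d k m) * muirhead_mean n m)"
    by (simp add: sum.inter_restrict finite_parts_of_size)
  finally show ?thesis .
qed

text \<open>Weights of total 1 allow g to be distributed over the summands. For g the mean of the
  one-column partition, each bracket becomes a generator of the semiring.\<close>

lemma normalize_sym_poly_minus:
  fixes k :: "expo \<Rightarrow> 'a::field_char_0"
  assumes "mv_eval (\<lambda>_. 1) (sym_poly n d k) \<noteq> 0"
  shows "normalize_at_one (sym_poly n d k) - g = (\<Sum>m\<in>bounded_parts n d. mv_const (sym_weight n d k m) * (muirhead_mean n m - g))"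
proof -
  have "g = (\<Sum>m\<in>bounded_parts n d. mv_const (sym_weight n d k m) * g)"
    by (simp add: sum_distrib_right[symmetric] mv_const_sum[symmetric] sum_sym_weight[OF assms])
  then show ?thesis
    unfolding normalize_sym_poly right_diff_distrib sum_subtractf by simp
qed

section \<open>Closure properties of the Muirhead semiring\<close>

lemma semiring_0: "0 \<in> muirhead_semiring n C"
  unfolding muirhead_semiring_def by (rule CollectI, rule exI[of _ 0]) auto

lemma semiringE:
  assumes "f \<in> muirhead_semiring n C"
  obtains k :: nat and c gs where "f = (\<Sum>j<k. mv_const (c j) * prod_list (gs j))"
    "\<forall>j<k. c j \<in> C \<and> set (gs j) \<subseteq> muirhead_generators n"
  using assms unfolding muirhead_semiring_def by (elim CollectE exE conjE)

lemma semiring_add: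
  assumes "f \<in> muirhead_semiring n C" "g \<in> muirhead_semiring n C"
  shows "f + g \<in> muirhead_semiring n C"
proof -
  obtain k :: nat and c gs where f: "f = (\<Sum>j<k. mv_const (c j) * prod_list (gs j))" "\<forall>j<k. c j \<in> C \<and> set (gs j) \<subseteq> muirhead_generators n"
    by (rule semiringE[OF assms(1)])
  obtain k' :: nat and c' gs' where g: "g = (\<Sum>j<k'. mv_const (c' j) * prod_list (gs' j))" "\<forall>j<k'. c' j \<in> C \<and> set (gs' j) \<subseteq> muirhead_generators n"
    by (rule semiringE[OF assms(2)])
  let ?c = "\<lambda>j. if j < k then c j else c' (j - k)" and ?g = "\<lambda>j. if j < k then gs j else gs' (j - k)"
  let ?h = "\<lambda>j. mv_const (?c j) * prod_list (?g j)"
  have "(\<Sum>j<k + k'. mv_const (?c j) * prod_list (?g j)) =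
      (\<Sum>j<k. mv_const (?c j) * prod_list (?g j)) + (\<Sum>j\<in>{k..<k + k'}. mv_const (?c j) * prod_list (?g j))"
    using sum.atLeastLessThan_concat[of 0 k "k + k'" ?h] by (simp only: atLeast0LessThan le0 le_add1)
  also have "(\<Sum>j<k. mv_const (?c j) * prod_list (?g j)) = f" unfolding f(1) by (intro sum.cong) simp_all
  also have "(\<Sum>j\<in>{k..<k + k'}. mv_const (?c j) * prod_list (?g j)) = g"
    unfolding g(1) by (rule sum.reindex_bij_witness[of _ "\<lambda>j. j + k" "\<lambda>j. j - k"]) (simp_all add: less_diff_conv2)
  finally have "f + g = (\<Sum>j<k + k'. mv_const (?c j) * prod_list (?g j))" by simp
  moreover have "\<forall>j<k + k'. ?c j \<in> C \<and> set (?g j) \<subseteq> muirhead_generators n"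
  proof (intro allI impI)
    fix j assume j: "j < k + k'"
    show "?c j \<in> C \<and> set (?g j) \<subseteq> muirhead_generators n"
    proof (cases "j < k")
      case True
      then show ?thesis using f(2) by simp
    next
      case False
      then have "j - k < k'" using j by simp
      then show ?thesis using g(2) False by simp
    qed
  qed
  ultimately show ?thesis unfolding muirhead_semiring_def
    by (intro CollectI exI[of _ "k + k'"] exI[of _ ?c] exI[of _ ?g] conjI)
qed

lemma semiring_sum: "(\<And>i. i \<in> I \<Longrightarrow> f i \<in> muirhead_semiring n C) \<Longrightarrow> (\<Sum>i\<in>I. f i) \<in> muirhead_semiring n C"
  by (induction I rule: infinite_finite_induct) (auto intro: semiring_add semiring_0)

lemma semiring_product:
  assumes "c \<in> C" "set gs \<subseteq> muirhead_generators n"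
  shows "mv_const c * prod_list gs \<in> muirhead_semiring n C"
  unfolding muirhead_semiring_def
  by (rule CollectI, rule exI[of _ 1], rule exI[of _ "\<lambda>_. c"], rule exI[of _ "\<lambda>_. gs"]) (use assms in auto)

section \<open>One-column partitions\<close>

lemma partition_size_one_column: "partition_size (one_column d) = d"
  and lookup_one_column: "lookup (one_column d) i = (if i < d then 1 else 0)"
proof -
  show l: "lookup (one_column d) i = (if i < d then 1 else 0)" for i
  proof -
    have "(\<Sum>j<d. 1 when j = i) = (\<Sum>j<d. if j = i then 1 else 0 :: nat)"
      by (intro sum.cong) (auto simp: when_def)
    then show ?thesis by (simp add: one_column_def lookup_sum lookup_single)
  qed
  have "keys (one_column d) = {..<d}" by (auto simp: in_keys_iff l split: if_splits)
  then show "partition_size (one_column d) = d" by (simp add: partition_size_def l)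
qed

lemma one_column_partition: "one_column d \<in> parts_of_size d"
  by (auto simp: parts_of_size_def partition_size_one_column int_partitions_def antimono_def lookup_one_column)

lemma keys_one_column: "keys (one_column d) = {..<d}"
  by (auto simp: in_keys_iff lookup_one_column split: if_splits)

text \<open>The first k parts of m are either all at least 1 or already add up to d.\<close>

lemma majorizes_one_column:
  assumes "m \<in> parts_of_size d"
  shows "majorizes m (one_column d)"
proof -
  have mi: "m \<in> int_partitions" "partition_size m = d" using assms parts_of_sizeD by auto
  have "(\<Sum>i<k. lookup (one_column d) i) \<le> (\<Sum>i<k. lookup m i)" for k
  proof (cases "k \<le> partition_length m")
    case True
    have "(\<Sum>i<k. lookup (one_column d) i) \<le> (\<Sum>i<k. 1)" by (intro sum_mono) (simp add: lookup_one_column)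
    also have "\<dots> \<le> (\<Sum>i<k. lookup m i)"
    proof (rule sum_mono)
      fix i assume "i \<in> {..<k}"
      then have "i \<in> keys m" using True partition_keys[OF mi(1)] by auto
      then show "1 \<le> lookup m i" by (simp add: in_keys_iff)
    qed
    finally show ?thesis .
  next
    case False
    then have "keys m \<subseteq> {..<k}" using partition_keys[OF mi(1)] by auto
    then have "(\<Sum>i<k. lookup m i) = d" using partition_size_superset[of "{..<k}" m] mi by simp
    moreover have "(\<Sum>i<k. lookup (one_column d) i) \<le> (\<Sum>i<max k d. lookup (one_column d) i)"
      by (intro sum_mono2) auto
    moreover have "(\<Sum>i<max k d. lookup (one_column d) i) = d"
      using partition_size_superset[of "{..<max k d}" "one_column d"] by (simp add: partition_size_one_column keys_one_column)
    ultimately show ?thesis by simp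
  qed
  then show ?thesis using mi by (simp add: majorizes_def weakly_majorizes_def partition_size_one_column)
qed

text \<open>The partition (1^d) is the smallest of its size, so its Jack function has no room for
  further monomial functions.\<close>

lemma jack_one_column:
  assumes "m \<in> parts_of_size d"
  shows "jack (one_column d) m = (if m = one_column d then 1 else 0)"
  using jack_diag[of "one_column d"] jack_support[of "one_column d" m] majorizes_one_column[OF assms]
    majorizes_antisym assms one_column_partition[of d] by (auto dest: parts_of_sizeD(1))

section \<open>Means as averages over permutations\<close>

lemma perm_perm: "bij \<pi> \<Longrightarrow> bij \<rho> \<Longrightarrow> perm \<pi> (perm \<rho> a) = perm (\<rho> \<circ> \<pi>) a"
  by (rule poly_mapping_eqI) (simp add: lookup_perm bij_comp)

lemma keys_perm_bounded:
  assumes "\<pi> permutes {..<n}" "keys a \<subseteq> {..<n}"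
  shows "keys (perm \<pi> a) \<subseteq> {..<n}"
  using assms permutes_not_in[OF assms(1)] by (auto simp: keys_perm[OF permutes_bij[OF assms(1)]]) (metis lessThan_iff subsetD)

lemma orbit_perm:
  assumes "\<pi> permutes {..<n}"
  shows "bij_betw (perm \<pi>) (orbit n m) (orbit n m)"
proof (rule bij_betw_byWitness[where f' = "perm (inv \<pi>)"])
  have b: "bij \<pi>" "bij (inv \<pi>)" using permutes_bij[OF assms] permutes_bij[OF permutes_inv[OF assms]] .
  have p: "inv \<pi> permutes {..<n}" using assms by (rule permutes_inv)
  have id: "perm id a = a" for a by (rule poly_mapping_eqI) (simp add: lookup_perm)
  show "\<forall>a\<in>orbit n m. perm (inv \<pi>) (perm \<pi> a) = a" "\<forall>a\<in>orbit n m. perm \<pi> (perm (inv \<pi>) a) = a"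
    using b by (simp_all add: perm_perm permutes_inv_o[OF assms] id)
  show "perm \<pi> ` orbit n m \<subseteq> orbit n m" "perm (inv \<pi>) ` orbit n m \<subseteq> orbit n m"
    using keys_perm_bounded[OF assms] keys_perm_bounded[OF p] b by (auto simp: orbit_def parts_perm)
qed

text \<open>Double counting: every exponent vector in the orbit has the same sum over permutations
  as m, and each permutation maps the orbit bijectively to itself.\<close>

lemma orbit_mean:
  fixes x :: "nat \<Rightarrow> real"
  assumes m: "m \<in> partitions_upto n"
  shows "mv_eval x (muirhead_mean n m) = (\<Sum>\<pi>\<in>{\<pi>. \<pi> permutes {..<n}}. mono_val x (perm \<pi> m)) / fact n"
proof -
  let ?P = "{\<pi>. \<pi> permutes {..<n}}"
  let ?A = "\<lambda>a. \<Sum>\<pi>\<in>?P. mono_val x (perm \<pi> a)"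
  have "?A a = ?A m" if a: "a \<in> orbit n m" for a
  proof -
    obtain \<rho> where \<rho>: "\<rho> permutes (keys a \<union> keys m)" "a = perm \<rho> m"
      using parts_eq_imp_permutes[of a m] a by (auto simp: orbit_def)
    have "\<rho> permutes {..<n}"
      using \<rho>(1) by (rule permutes_subset) (use a m in \<open>auto simp: orbit_def partitions_upto_def\<close>)
    then have "?A m = (\<Sum>\<pi>\<in>?P. mono_val x (perm (\<rho> \<circ> \<pi>) m))"
      by (rule setum_permutations_compose_left)
    also have "\<dots> = ?A a"
      unfolding \<rho>(2) using \<rho>(1) by (intro sum.cong) (auto simp: perm_perm permutes_bij)
    finally show ?thesis by simp
  qed
  then have "real (card (orbit n m)) * ?A m = (\<Sum>a\<in>orbit n m. ?A a)" by simp
  also have "\<dots> = (\<Sum>\<pi>\<in>?P. \<Sum>a\<in>orbit n m. mono_val x (perm \<pi> a))" by (rule sum.swap)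
  also have "\<dots> = (\<Sum>\<pi>\<in>?P. \<Sum>a\<in>orbit n m. mono_val x a)"
    by (intro sum.cong refl sum.reindex_bij_betw orbit_perm) simp
  also have "\<dots> = fact n * (\<Sum>a\<in>orbit n m. mono_val x a)" by (simp add: card_permutations)
  finally have "real (card (orbit n m)) * ?A m = fact n * (\<Sum>a\<in>orbit n m. mono_val x a)" .
  then show ?thesis
    using card_orbit_pos[OF m] by (simp add: muirhead_mean_def mv_eval_normalize mv_eval_mono_poly field_simps)
qed

lemma mono_val_nonneg:
  fixes x :: "nat \<Rightarrow> 'a::linordered_field"
  assumes "\<forall>i<n. 0 \<le> x i" "keys a \<subseteq> {..<n}"
  shows "0 \<le> mono_val x a"
  using assms by (auto simp: mono_val_def intro!: prod_nonneg)

text \<open>The arithmetic-geometric mean inequality is applied to the cyclic shifts of the first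
  \<open>d\<close> variables, whose exponent vectors add up to \<open>d\<close> times \<open>(1\<^sup>d)\<close>.\<close>

lemma mean_ge_one_column:
  fixes x :: "nat \<Rightarrow> real"
  assumes x: "\<forall>i<n. 0 \<le> x i" and d: "d \<le> n" and m: "m \<in> parts_of_size d"
  shows "mv_eval x (muirhead_mean n (one_column d)) \<le> mv_eval x (muirhead_mean n m)"
proof (cases "d = 0")
  case True
  then have "m = 0" "one_column d = 0"
    using m lookup_le_size[of m] by (auto simp: parts_of_size_def one_column_def intro!: poly_mapping_eqI)
  then show ?thesis by simp
next
  case False
  let ?P = "{\<pi>. \<pi> permutes {..<n}}"
  let ?e = "one_column d"
  \<comment> \<open>The identity from d on, so that all n variables are permuted. For fixed i < d,
    the indices \<open>(i + s) mod d\<close> with s < d meet every index below d once.\<close>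
  define \<rho> where "\<rho> s i = (if i < d then (i + s) mod d else i)" for s i
  have mi: "m \<in> int_partitions" "partition_size m = d" using m parts_of_sizeD by auto
  have km: "keys m \<subseteq> {..<d}" using partition_keys[OF mi(1)] partition_length_le[of m] mi(2) by auto
  have eq: "s = s'" if "s < d" "s' < d" "(i + s) mod d = (i + s') mod d" "s \<le> s'" for i s s' :: nat
  proof -
    have "d dvd (i + s') - (i + s)"
      using that mod_eq_dvd_iff_nat[of "i + s" "i + s'" d] by simp
    then have "d dvd s' - s" by simp
    moreover have "s' - s < d" using that by simp
    ultimately have "s' - s = 0" using dvd_imp_le[of d "s' - s"] by (cases "s' - s = 0") auto
    then show ?thesis using that(4) by simp
  qed
  have inj: "inj_on (\<lambda>s. (i + s) mod d) {..<d}" for i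
  proof (rule inj_onI)
    fix s s' assume "s \<in> {..<d}" "s' \<in> {..<d}" "(i + s) mod d = (i + s') mod d"
    then show "s = s'" using eq[of s s' i] eq[of s' s i] by (cases "s \<le> s'") auto
  qed
  have bij: "bij_betw (\<lambda>s. (i + s) mod d) {..<d} {..<d}" for i
    using inj[of i] False by (intro bij_betw_imageI endo_inj_surj) auto
  have \<rho>: "\<rho> s permutes {..<n}" for s
  proof (rule permutes_subset)
    have "bij_betw (\<rho> s) {..<d} {..<d}"
      using bij[of s] by (subst bij_betw_cong[of _ _ "\<lambda>i. (s + i) mod d"]) (auto simp: \<rho>_def add.commute)
    then show "\<rho> s permutes {..<d}" by (rule bij_imp_permutes) (simp add: \<rho>_def)
  qed (use d in auto)
  have shifts: "(\<Sum>s<d. lookup (perm (\<rho> s) m) i) = d * lookup ?e i" for i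
  proof (cases "i < d")
    case True
    have "(\<Sum>s<d. lookup (perm (\<rho> s) m) i) = (\<Sum>s<d. lookup m ((i + s) mod d))"
      using True by (simp add: lookup_perm permutes_bij[OF \<rho>]) (simp add: \<rho>_def)
    also have "\<dots> = (\<Sum>j<d. lookup m j)" by (rule sum.reindex_bij_betw[OF bij])
    also have "\<dots> = d" using partition_size_superset[OF _ km] mi(2) by simp
    finally show ?thesis using True by (simp add: lookup_one_column)
  next
    case False
    then have "i \<notin> keys m" using km by auto
    then show ?thesis using False by (simp add: lookup_perm permutes_bij[OF \<rho>] lookup_one_column) (simp add: \<rho>_def in_keys_iff)
  qed
  have km': "keys m \<subseteq> {..<n}" "keys ?e \<subseteq> {..<n}" using km d by (auto simp: keys_one_column)
  have agm: "real d * mono_val x (perm \<pi> ?e) \<le> (\<Sum>s<d. mono_val x (perm \<pi> (perm (\<rho> s) m)))"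
    if \<pi>: "\<pi> permutes {..<n}" for \<pi>
  proof -
    let ?y = "\<lambda>s. mono_val x (perm \<pi> (perm (\<rho> s) m))"
    have nn: "0 \<le> ?y s" for s
      using x by (rule mono_val_nonneg) (intro keys_perm_bounded \<pi> \<rho> km')
    have nne: "0 \<le> mono_val x (perm \<pi> ?e)"
      using x by (rule mono_val_nonneg) (intro keys_perm_bounded \<pi> km')
    have "(\<Prod>s<d. ?y s) = mono_val x (\<Sum>s<d. perm \<pi> (perm (\<rho> s) m))"
      by (rule mono_val_sum[symmetric])
    also have "(\<Sum>s<d. perm \<pi> (perm (\<rho> s) m)) = (\<Sum>s<d. perm \<pi> ?e)"
    proof (rule poly_mapping_eqI)
      fix k
      have "lookup (\<Sum>s<d. perm \<pi> (perm (\<rho> s) m)) k = (\<Sum>s<d. lookup (perm (\<rho> s) m) (\<pi> k))"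
        by (simp only: lookup_sum lookup_perm[OF permutes_bij[OF \<pi>]])
      then show "lookup (\<Sum>s<d. perm \<pi> (perm (\<rho> s) m)) k = lookup (\<Sum>s<d. perm \<pi> ?e) k"
        unfolding shifts lookup_sum lookup_perm[OF permutes_bij[OF \<pi>]] by simp
    qed
    also have "mono_val x \<dots> = mono_val x (perm \<pi> ?e) ^ d"
      by (subst mono_val_sum) (simp only: prod_constant card_lessThan)
    finally have pr: "(\<Prod>s<d. ?y s) = mono_val x (perm \<pi> ?e) ^ d" .
    have "mono_val x (perm \<pi> ?e) = (\<Prod>s<d. ?y s) powr (1 / real d)"
      unfolding pr using False nne by (cases "mono_val x (perm \<pi> ?e) = 0") (auto simp: powr_powr simp flip: powr_realpow)
    also have "\<dots> \<le> (\<Sum>s<d. ?y s / real d)"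
    proof -
      have "0 \<in> {..<d}" using False by simp
      then have "{..<d} \<noteq> {}" by blast
      then show ?thesis using arith_geom_mean[of "{..<d}" ?y] nn by simp
    qed
    also have "\<dots> = (\<Sum>s<d. ?y s) / real d" by (simp add: sum_divide_distrib)
    finally show ?thesis using False by (simp add: field_simps)
  qed
  have mu: "m \<in> partitions_upto n" "?e \<in> partitions_upto n"
    using km' mi(1) one_column_partition[of d] by (auto simp: partitions_upto_def parts_of_size_def)
  have "real d * (\<Sum>\<pi>\<in>?P. mono_val x (perm \<pi> ?e)) \<le> (\<Sum>\<pi>\<in>?P. \<Sum>s<d. mono_val x (perm \<pi> (perm (\<rho> s) m)))"
    unfolding sum_distrib_left using agm by (intro sum_mono) auto
  also have "\<dots> = (\<Sum>s<d. \<Sum>\<pi>\<in>?P. mono_val x (perm \<pi> (perm (\<rho> s) m)))" by (rule sum.swap)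
  \<comment> \<open>Composition with a fixed shift only reorders the permutations, so each s
    contributes the full sum for m.\<close>
  also have "\<dots> = (\<Sum>s<d. \<Sum>\<pi>\<in>?P. mono_val x (perm \<pi> m))"
  proof (rule sum.cong[OF refl])
    fix s
    have "(\<Sum>\<pi>\<in>?P. mono_val x (perm \<pi> m)) = (\<Sum>\<pi>\<in>?P. mono_val x (perm (\<rho> s \<circ> \<pi>) m))"
      by (rule setum_permutations_compose_left[OF \<rho>])
    also have "\<dots> = (\<Sum>\<pi>\<in>?P. mono_val x (perm \<pi> (perm (\<rho> s) m)))"
      by (intro sum.cong) (auto simp: perm_perm permutes_bij[OF \<rho>] permutes_bij)
    finally show "(\<Sum>\<pi>\<in>?P. mono_val x (perm \<pi> (perm (\<rho> s) m))) = (\<Sum>\<pi>\<in>?P. mono_val x (perm \<pi> m))" by simp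
  qed
  finally have "(\<Sum>\<pi>\<in>?P. mono_val x (perm \<pi> ?e)) \<le> (\<Sum>\<pi>\<in>?P. mono_val x (perm \<pi> m))"
    using False by simp
  then show ?thesis unfolding orbit_mean[OF mu(1)] orbit_mean[OF mu(2)] by (simp add: divide_right_mono)
qed

lemma sym_poly_value_pos:
  fixes k :: "expo \<Rightarrow> 'a::linordered_field"
  assumes l: "l \<in> bounded_parts n d" "k l = 1" and k: "\<And>m. m \<in> parts_of_size d \<Longrightarrow> 0 \<le> k m"
  shows "0 < mv_eval (\<lambda>_. 1) (sym_poly n d k)"
  unfolding mv_eval_sym_poly mv_eval_mono_poly_1
  by (rule sum_pos2[of _ l]) (use l k card_orbit_pos[of l n] in \<open>auto simp: finite_parts_of_size\<close>)

lemma sym_weight_closed: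
  assumes C: "semifield_closed C" and k: "\<And>m. m \<in> parts_of_size d \<Longrightarrow> k m \<in> C" and m: "m \<in> parts_of_size d"
  shows "sym_weight n d k m \<in> C"
proof -
  have "mv_eval (\<lambda>_. 1) (sym_poly n d k) \<in> C"
    unfolding mv_eval_sym_poly mv_eval_mono_poly_1
    by (intro semiring_closed_sum semifield_closedD[OF C] k semiring_closed_of_nat)
  then show ?thesis
    unfolding sym_weight_def by (intro semifield_closedD[OF C] k m semiring_closed_of_nat)
qed

lemma sym_poly_one_column:
  assumes "\<And>m. m \<in> parts_of_size d \<Longrightarrow> k m = (if m = one_column d then 1 else 0)"
  shows "sym_poly n d k = mono_poly n (one_column d)"
proof -
  have "sym_poly n d k = (\<Sum>m\<in>parts_of_size d. if m = one_column d then mono_poly n m else 0)"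
    unfolding sym_poly_def by (intro sum.cong) (auto simp: assms)
  then show ?thesis using one_column_partition by (simp add: finite_parts_of_size)
qed

lemma normalized_minus_one_column:
  fixes k k' :: "expo \<Rightarrow> 'a::linordered_field"
  assumes l: "l \<in> bounded_parts n d" "k l = 1" and k: "\<And>m. m \<in> parts_of_size d \<Longrightarrow> 0 \<le> k m"
    and k': "\<And>m. m \<in> parts_of_size d \<Longrightarrow> k' m = (if m = one_column d then 1 else 0)"
  shows "normalize_at_one (sym_poly n d k) - normalize_at_one (sym_poly n d k') =
    (\<Sum>m\<in>bounded_parts n d. mv_const (sym_weight n d k m) * (muirhead_mean n m - muirhead_mean n (one_column d)))"
proof -
  have nz: "mv_eval (\<lambda>_. 1) (sym_poly n d k) \<noteq> 0"
    using sym_poly_value_pos[of l d n k, OF l k] by simp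
  have "sym_poly n d k' = mono_poly n (one_column d)"
    by (rule sym_poly_one_column) (rule k')
  then have eq: "normalize_at_one (sym_poly n d k') = muirhead_mean n (one_column d)"
    unfolding muirhead_mean_def by simp
  show ?thesis unfolding eq by (rule normalize_sym_poly_minus[OF nz])
qed

lemma one_column_bounded: "d \<le> n \<Longrightarrow> one_column d \<in> partitions_upto n"
  using one_column_partition[of d] by (auto simp: partitions_upto_def parts_of_size_def keys_one_column)

text \<open>Every partition of d majorizes (1^d), so each summand is a weight in C times a single
  generator.\<close>

lemma normalized_minus_one_column_semiring:
  fixes k k' :: "expo \<Rightarrow> 'a::linordered_field"
  assumes C: "semifield_closed C" "C \<subseteq> {c. 0 \<le> c}" and l: "l \<in> bounded_parts n d" "k l = 1"
    and k: "\<And>m. m \<in> parts_of_size d \<Longrightarrow> k m \<in> C"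
    and k': "\<And>m. m \<in> parts_of_size d \<Longrightarrow> k' m = (if m = one_column d then 1 else 0)" and d: "d \<le> n"
  shows "normalize_at_one (sym_poly n d k) - normalize_at_one (sym_poly n d k') \<in> muirhead_semiring n C"
proof -
  have nn: "0 \<le> k m" if "m \<in> parts_of_size d" for m using k[OF that] C(2) by blast
  have "mv_const (sym_weight n d k m) * prod_list [muirhead_mean n m - muirhead_mean n (one_column d)] \<in> muirhead_semiring n C"
    if m: "m \<in> bounded_parts n d" for m
  proof (rule semiring_product)
    show "sym_weight n d k m \<in> C" using m by (intro sym_weight_closed[OF C(1)] k) auto
    show "set [muirhead_mean n m - muirhead_mean n (one_column d)] \<subseteq> muirhead_generators n"
      using m majorizes_one_column[of m d] one_column_bounded[OF d] by (auto simp: muirhead_generators_def)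
  qed
  moreover have "normalize_at_one (sym_poly n d k) - normalize_at_one (sym_poly n d k') =
    (\<Sum>m\<in>bounded_parts n d. mv_const (sym_weight n d k m) * (muirhead_mean n m - muirhead_mean n (one_column d)))"
    by (rule normalized_minus_one_column[where l = l], rule l(1), rule l(2), rule nn, assumption, rule k')
  ultimately show ?thesis by (simp only:) (intro semiring_sum, simp)
qed

section \<open>Real and specialized Jack polynomials compared with one column\<close>

lemma ratfun_to_real_0: "ratfun_to_real 0 = 0"
  using ratfun_to_real_Fract[of 1 0] by (simp add: fract_collapse)

lemma ratfun_spec_0: "ratfun_spec t 0 = 0" and ratfun_spec_1: "ratfun_spec t 1 = 1"
  using ratfun_spec_eq[OF specs_0] ratfun_spec_eq[OF specs_1] by simp_all

lemma jack_poly_real_sym_poly: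
  "l \<in> parts_of_size d \<Longrightarrow> jack_poly_real n l = sym_poly n d (\<lambda>m. ratfun_to_real (jack l m))"
  unfolding jack_poly_real_def by (simp add: jack_poly_sym_poly map_sym_poly ratfun_to_real_0)

lemma jack_poly_at_sym_poly:
  "l \<in> parts_of_size d \<Longrightarrow> jack_poly_at n t l = sym_poly n d (\<lambda>m. ratfun_spec t (jack l m))"
  unfolding jack_poly_at_def by (simp add: jack_poly_sym_poly map_sym_poly ratfun_spec_0)

lemma real_const_add: "real_const (a + b) = real_const a + real_const b"
  by (simp add: real_const_def)

lemma real_const_mult: "real_const (a * b) = real_const a * real_const b"
  by (simp add: real_const_def mult.commute)

lemma real_const_0: "real_const 0 = 0" and real_const_1: "real_const 1 = 1"
  by (simp_all add: real_const_def fract_collapse One_fract_def one_pCons)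

lemma real_const_sum: "real_const (\<Sum>i\<in>I. f i) = (\<Sum>i\<in>I. real_const (f i))"
  by (induction I rule: infinite_finite_induct) (auto simp: real_const_0 real_const_add)

lemma real_const_power: "real_const (a ^ k) = real_const a ^ k"
  by (induction k) (auto simp: real_const_1 real_const_mult)

lemma real_const_prod: "real_const (\<Prod>i\<in>I. f i) = (\<Prod>i\<in>I. real_const (f i))"
  by (induction I rule: infinite_finite_induct) (auto simp: real_const_1 real_const_mult)

lemma real_const_of_nat: "real_const (of_nat n) = of_nat n"
  by (induction n) (auto simp: real_const_0 real_const_1 real_const_add)

lemma real_const_inverse: "real_const (inverse a) = inverse (real_const a)"
proof (cases "a = 0")
  case False
  then have "real_const a * real_const (inverse a) = 1"
    by (simp add: real_const_mult[symmetric] real_const_1)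
  then show ?thesis by (metis inverse_unique)
qed (simp add: real_const_0)

lemma real_const_minus: "real_const (a - b) = real_const a - real_const b"
  using real_const_add[of "a - b" b] by (simp add: algebra_simps)

lemma real_const_nonneg: "0 \<le> a \<Longrightarrow> real_const a \<in> F_nonneg_real"
  unfolding F_nonneg_real_def real_const_def
  by (intro CollectI exI[of _ "[:a:]"] exI[of _ 1]) (auto simp: coeff_pCons coeff_1 split: nat.split)

text \<open>Muirhead means have rational coefficients, so evaluation commutes with the embedding of
  the reals as constants.\<close>

lemma mv_eval_mean_real_const:
  "mv_eval (\<lambda>i. real_const (x i)) (muirhead_mean n m) = real_const (mv_eval x (muirhead_mean n m))"
proof -
  have "mono_val (\<lambda>i. real_const (x i)) a = real_const (mono_val x a)" for a
    by (simp add: mono_val_def real_const_prod real_const_power)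
  then show ?thesis
    by (simp add: muirhead_mean_def mv_eval_normalize mv_eval_mono_poly mv_eval_mono_poly_1 divide_inverse
        real_const_mult real_const_inverse real_const_sum real_const_of_nat)
qed

lemma diff_generic_eval:
  "diff_generic n l m x = mv_eval (\<lambda>i. real_const (x i)) (normalize_at_one (jack_poly_real n l) - normalize_at_one (jack_poly_real n m))"
  by (simp add: diff_generic_def mv_eval_minus mv_eval_normalize)

lemma diff_at_eval:
  "diff_at n t l m x = mv_eval x (normalize_at_one (jack_poly_at n t l) - normalize_at_one (jack_poly_at n t m))"
  by (simp add: diff_at_def mv_eval_minus mv_eval_normalize)

context
  fixes n d :: nat and l :: expo
  assumes l: "l \<in> bounded_parts n d" and d: "d \<le> n"
begin

lemma l_parts: "l \<in> parts_of_size d" and l_int: "l \<in> int_partitions"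
  using l parts_of_sizeD(1)[of l d] by auto

lemma one_column_C1: "C1 n l (one_column d)"
  unfolding C1_def jack_poly_sym_poly[OF l_parts] jack_poly_sym_poly[OF one_column_partition]
  by (rule normalized_minus_one_column_semiring[OF semifield_closed_F_nonneg F_nonneg_nonneg l _ _ _ d])
    (auto simp: jack_diag[OF l_int] jack_one_column intro!: tame_F_nonneg jack_tame[OF l_parts])

lemma one_column_C2: "C2 n l (one_column d)"
  unfolding C2_def jack_poly_at_sym_poly[OF l_parts] jack_poly_at_sym_poly[OF one_column_partition]
  by (intro allI normalized_minus_one_column_semiring[OF semifield_closed_nonneg _ l _ _ _ d])
    (auto simp: jack_diag[OF l_int] jack_one_column ratfun_spec_0 ratfun_spec_1 intro!: tame_spec jack_tame[OF l_parts])

lemma one_column_diff_at: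
  assumes x: "\<forall>i<n. 0 \<le> x i"
  shows "0 \<le> diff_at n t l (one_column d) x"
proof -
  let ?k = "\<lambda>m. ratfun_spec t (jack l m)" and ?k' = "\<lambda>m. ratfun_spec t (jack (one_column d) m)"
  have k: "?k l = 1" "\<And>m. m \<in> parts_of_size d \<Longrightarrow> 0 \<le> ?k m"
    by (auto simp: jack_diag[OF l_int] ratfun_spec_1 intro!: tame_spec jack_tame[OF l_parts])
  have k': "\<And>m. m \<in> parts_of_size d \<Longrightarrow> ?k' m = (if m = one_column d then 1 else 0)"
    by (auto simp: jack_one_column ratfun_spec_0 ratfun_spec_1)
  have "0 \<le> sym_weight n d ?k m" if "m \<in> parts_of_size d" for m
    using sym_weight_closed[OF semifield_closed_nonneg, of d ?k m n] k that by auto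
  moreover have "normalize_at_one (sym_poly n d ?k) - normalize_at_one (sym_poly n d ?k') =
    (\<Sum>m\<in>bounded_parts n d. mv_const (sym_weight n d ?k m) * (muirhead_mean n m - muirhead_mean n (one_column d)))"
    by (rule normalized_minus_one_column[where l = l], rule l, rule k(1), rule k(2), assumption, rule k')
  ultimately show ?thesis
    unfolding diff_at_eval jack_poly_at_sym_poly[OF l_parts] jack_poly_at_sym_poly[OF one_column_partition]
    by (auto simp: mv_eval_sum mv_eval_mult mv_eval_minus intro!: sum_nonneg mult_nonneg_nonneg mean_ge_one_column[OF x d])
qed

text \<open>Only the weights depend on tau, and they lie in the cone because the coefficients are
  tame; the differences of means are nonnegative real constants by
  \<open>mean_ge_one_column\<close>.\<close>

lemma one_column_diff_generic:
  assumes x: "\<forall>i<n. 0 \<le> x i"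
  shows "diff_generic n l (one_column d) x \<in> F_nonneg_real"
proof -
  note F = semifield_closedD[OF semifield_closed_F_nonneg_real]
  let ?k = "\<lambda>m. ratfun_to_real (jack l m)" and ?k' = "\<lambda>m. ratfun_to_real (jack (one_column d) m)"
  have k: "?k l = 1" "\<And>m. m \<in> parts_of_size d \<Longrightarrow> ?k m \<in> F_nonneg_real"
    by (auto simp: jack_diag[OF l_int] ratfun_to_real_1 intro!: ratfun_to_real_F_nonneg tame_F_nonneg jack_tame[OF l_parts])
  have k0: "\<And>m. m \<in> parts_of_size d \<Longrightarrow> 0 \<le> ?k m" using k(2) F_nonneg_real_nonneg by blast
  have k': "\<And>m. m \<in> parts_of_size d \<Longrightarrow> ?k' m = (if m = one_column d then 1 else 0)"
    by (auto simp: jack_one_column ratfun_to_real_0 ratfun_to_real_1)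
  have "mv_eval (\<lambda>i. real_const (x i)) (muirhead_mean n m - muirhead_mean n (one_column d)) \<in> F_nonneg_real"
    if "m \<in> parts_of_size d" for m
    using mean_ge_one_column[OF x d that]
    by (simp add: mv_eval_minus mv_eval_mean_real_const real_const_minus[symmetric] real_const_nonneg)
  moreover have "sym_weight n d ?k m \<in> F_nonneg_real" if "m \<in> parts_of_size d" for m
    using that by (intro sym_weight_closed[OF semifield_closed_F_nonneg_real] k)
  moreover have "normalize_at_one (sym_poly n d ?k) - normalize_at_one (sym_poly n d ?k') =
    (\<Sum>m\<in>bounded_parts n d. mv_const (sym_weight n d ?k m) * (muirhead_mean n m - muirhead_mean n (one_column d)))"
    by (rule normalized_minus_one_column[where l = l], rule l, rule k(1), rule k0, assumption, rule k')
  ultimately show ?thesis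
    unfolding diff_generic_eval jack_poly_real_sym_poly[OF l_parts] jack_poly_real_sym_poly[OF one_column_partition]
    by (auto simp: mv_eval_sum mv_eval_mult intro!: semiring_closed_sum F)
qed

end

section \<open>Two variables\<close>

definition expo2 :: "nat \<Rightarrow> nat \<Rightarrow> expo" where
  "expo2 p q = Poly_Mapping.single 0 p + Poly_Mapping.single 1 q"

lemma lookup_expo2: "lookup (expo2 p q) i = (if i = 0 then p else if i = 1 then q else 0)"
  by (auto simp: expo2_def lookup_add lookup_single)

lemma keys_expo2: "keys (expo2 p q) \<subseteq> {..<2}"
  by (auto simp: in_keys_iff lookup_expo2 split: if_splits)

lemma lessThan_2: "{..<2} = {0, 1::nat}"
  by auto

lemma expo2_eqI:
  assumes "keys a \<subseteq> {..<2}"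
  shows "a = expo2 (lookup a 0) (lookup a 1)"
proof (rule poly_mapping_eqI)
  fix i
  have "lookup a i = 0" if "i \<noteq> 0" "i \<noteq> 1"
    using assms that by (auto simp: in_keys_iff lessThan_2)
  then show "lookup a i = lookup (expo2 (lookup a 0) (lookup a 1)) i" by (auto simp: lookup_expo2)
qed

lemma size_expo2: "partition_size (expo2 p q) = p + q"
  using partition_size_superset[OF _ keys_expo2, of p q] by (simp add: lessThan_2 lookup_expo2)

lemma size_two: "keys a \<subseteq> {..<2} \<Longrightarrow> partition_size a = lookup a 0 + lookup a 1"
  using size_expo2[of "lookup a 0" "lookup a 1"] expo2_eqI[of a] by simp

lemma expo2_partition: "q \<le> p \<Longrightarrow> expo2 p q \<in> bounded_parts 2 (p + q)"
  using keys_expo2 by (auto simp: partitions_upto_def parts_of_size_def int_partitions_def antimono_def lookup_expo2 size_expo2)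

lemma two_parts:
  assumes "m \<in> partitions_upto 2"
  shows "m = expo2 (lookup m 0) (lookup m 1)" "lookup m 1 \<le> lookup m 0" "partition_size m = lookup m 0 + lookup m 1"
    "keys m \<subseteq> {..<2}"
  using assms expo2_eqI[of m] size_two[of m] antimonoD[of "lookup m" 0 1]
  by (auto simp: partitions_upto_def int_partitions_def)

lemma parts_expo2_commute: "parts (expo2 p q) = parts (expo2 q p)"
proof -
  have "expo2 p q = swap0 1 (expo2 q p)"
    by (rule poly_mapping_eqI) (auto simp: lookup_expo2 Transposition.transpose_def)
  then show ?thesis by (simp add: parts_perm)
qed

text \<open>A vector in two variables is a \<open>pairup\<close> of m, so
  \<open>pairup_parts\<close> leaves just the two arrangements.\<close>

lemma orbit_two:
  assumes "m \<in> partitions_upto 2"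
  shows "orbit 2 m = {expo2 (lookup m 0) (lookup m 1), expo2 (lookup m 1) (lookup m 0)}"
proof (intro equalityI subsetI)
  fix a assume "a \<in> orbit 2 m"
  then have a: "keys a \<subseteq> {..<2}" "parts a = parts m" by (auto simp: orbit_def)
  have s: "lookup a 0 + lookup a 1 = lookup m 0 + lookup m 1"
    using a sum_parts[of a] sum_parts[of m] size_two[OF a(1)] two_parts(3)[OF assms] by simp
  have "pairup 1 (lookup a 0) (lookup a 1) m = expo2 (lookup a 0) (lookup a 1)"
    by (rule poly_mapping_eqI) (use two_parts(4)[OF assms] in \<open>auto simp: lookup_pairup lookup_expo2 in_keys_iff lessThan_2\<close>)
  then have "parts (pairup 1 (lookup a 0) (lookup a 1) m) = parts m" using expo2_eqI[OF a(1)] a(2) by simp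
  then have "lookup a 0 = lookup m 0 \<or> lookup a 0 = lookup m 1"
    using pairup_parts[of 1 "lookup a 0" "lookup a 1" m] s by simp
  then show "a \<in> {expo2 (lookup m 0) (lookup m 1), expo2 (lookup m 1) (lookup m 0)}"
    using expo2_eqI[OF a(1)] s by auto
next
  fix a assume "a \<in> {expo2 (lookup m 0) (lookup m 1), expo2 (lookup m 1) (lookup m 0)}"
  then have "keys a \<subseteq> {..<2}" "parts a = parts (expo2 (lookup m 0) (lookup m 1))"
    using keys_expo2 parts_expo2_commute by blast+
  then show "a \<in> orbit 2 m" using two_parts(1)[OF assms] by (simp add: orbit_def)
qed

lemma mono_val_expo2: "mono_val x (expo2 p q) = x 0 ^ p * x 1 ^ q"
  using mono_val_superset[OF _ keys_expo2, of x p q] by (simp add: lessThan_2 lookup_expo2)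

lemma mean_two:
  fixes x :: "nat \<Rightarrow> 'a::field_char_0"
  assumes "m \<in> partitions_upto 2"
  shows "mv_eval x (muirhead_mean 2 m) =
    (x 0 ^ lookup m 0 * x 1 ^ lookup m 1 + x 0 ^ lookup m 1 * x 1 ^ lookup m 0) / 2"
proof (cases "lookup m 0 = lookup m 1")
  case True
  then show ?thesis
    by (simp add: muirhead_mean_def mv_eval_normalize mv_eval_mono_poly mv_eval_mono_poly_1 orbit_two[OF assms] mono_val_expo2)
next
  case False
  then have "expo2 (lookup m 0) (lookup m 1) \<noteq> expo2 (lookup m 1) (lookup m 0)"
    by (metis lookup_expo2)
  then show ?thesis
    by (simp add: muirhead_mean_def mv_eval_normalize mv_eval_mono_poly mv_eval_mono_poly_1 orbit_two[OF assms] mono_val_expo2)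
qed

section \<open>Majorization in two variables and its necessity\<close>

lemma majorizes_two:
  assumes "l \<in> partitions_upto 2" "m \<in> partitions_upto 2"
  shows "majorizes l m \<longleftrightarrow> partition_size l = partition_size m \<and> lookup m 0 \<le> lookup l 0"
proof
  assume maj: "majorizes l m"
  have "(\<Sum>i<1. lookup m i) \<le> (\<Sum>i<1. lookup l i)"
    using maj unfolding majorizes_def weakly_majorizes_def by blast
  then show "partition_size l = partition_size m \<and> lookup m 0 \<le> lookup l 0"
    using maj by (simp add: majorizes_def)
next
  assume *: "partition_size l = partition_size m \<and> lookup m 0 \<le> lookup l 0"
  have "(\<Sum>i<k. lookup m i) \<le> (\<Sum>i<k. lookup l i)" for k
  proof -
    consider "k = 0" | "k = 1" | "2 \<le> k" by linarith
    then show ?thesis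
    proof cases
      case 3
      then have "keys l \<subseteq> {..<k}" "keys m \<subseteq> {..<k}" using two_parts(4)[OF assms(1)] two_parts(4)[OF assms(2)] by auto
      then show ?thesis using * partition_size_superset[of "{..<k}"] by simp
    qed (use * in auto)
  qed
  then show "majorizes l m" using * by (simp add: majorizes_def weakly_majorizes_def)
qed

text \<open>The difference of the means is (x y)^c (x^u - y^u)(x^v - y^v) / 2, where both
  differences of powers have the sign of x - y or vanish.\<close>

lemma muirhead_two:
  fixes x :: "nat \<Rightarrow> 'a::linordered_field"
  assumes l: "l \<in> partitions_upto 2" and m: "m \<in> partitions_upto 2" and maj: "majorizes l m" and x: "\<And>i. 0 \<le> x i"
  shows "mv_eval x (muirhead_mean 2 m) \<le> mv_eval x (muirhead_mean 2 l)"
proof -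
  define c where "c = lookup l 1"
  define u where "u = lookup m 1 - c"
  define v where "v = lookup m 0 - c"
  have s: "lookup l 0 + lookup l 1 = lookup m 0 + lookup m 1" "lookup m 0 \<le> lookup l 0"
    using maj two_parts(3)[OF l] two_parts(3)[OF m] by (auto simp: majorizes_two[OF l m])
  have e: "lookup m 1 = c + u" "lookup m 0 = c + v" "lookup l 0 = c + (u + v)" "lookup l 1 = c"
    using s two_parts(2)[OF l] two_parts(2)[OF m] by (auto simp: c_def u_def v_def)
  have "0 \<le> (x 0 ^ u - x 1 ^ u) * (x 0 ^ v - x 1 ^ v)"
  proof (cases "x 0 \<le> x 1")
    case True
    then have "x 0 ^ u \<le> x 1 ^ u" "x 0 ^ v \<le> x 1 ^ v" using x by (auto intro: power_mono)
    then show ?thesis by (intro mult_nonpos_nonpos) auto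
  next
    case False
    then have "x 1 \<le> x 0" by simp
    then have "x 1 ^ u \<le> x 0 ^ u" "x 1 ^ v \<le> x 0 ^ v" using x by (auto intro: power_mono)
    then show ?thesis by (intro mult_nonneg_nonneg) auto
  qed
  moreover have "0 \<le> (x 0 * x 1) ^ c" using x by simp
  ultimately have "0 \<le> (x 0 * x 1) ^ c * ((x 0 ^ u - x 1 ^ u) * (x 0 ^ v - x 1 ^ v))"
    by (rule mult_nonneg_nonneg[rotated])
  also have "\<dots> = (x 0 ^ lookup l 0 * x 1 ^ lookup l 1 + x 0 ^ lookup l 1 * x 1 ^ lookup l 0) -
      (x 0 ^ lookup m 0 * x 1 ^ lookup m 1 + x 0 ^ lookup m 1 * x 1 ^ lookup m 0)"
    unfolding e by (simp add: power_add power_mult_distrib algebra_simps)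
  finally show ?thesis unfolding mean_two[OF l] mean_two[OF m] by (simp add: divide_right_mono)
qed

text \<open>Stated over an arbitrary ordered field in order to serve the scalars Q(tau) as well as
  the reals.\<close>

lemma semiring_eval_nonneg:
  fixes x :: "nat \<Rightarrow> 'a::linordered_field"
  assumes f: "f \<in> muirhead_semiring 2 C" and C: "C \<subseteq> {c. 0 \<le> c}" and x: "\<And>i. 0 \<le> x i"
  shows "0 \<le> mv_eval x f"
proof -
  obtain k :: nat and c gs where f: "f = (\<Sum>j<k. mv_const (c j) * prod_list (gs j))"
    "\<forall>j<k. c j \<in> C \<and> set (gs j) \<subseteq> muirhead_generators 2" by (rule semiringE[OF f])
  have gen: "0 \<le> mv_eval x g" if g: "g \<in> muirhead_generators 2" for g
  proof -
    consider l m where "g = muirhead_mean 2 l - muirhead_mean 2 m" "l \<in> partitions_upto 2" "m \<in> partitions_upto 2" "majorizes l m"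
      | l where "g = muirhead_mean 2 l" "l \<in> partitions_upto 2"
      using g by (auto simp: muirhead_generators_def)
    then show ?thesis
    proof cases
      case 1
      then show ?thesis using muirhead_two[OF 1(2-4) x] by (simp add: mv_eval_minus)
    next
      case 2
      then show ?thesis using x by (simp add: mean_two)
    qed
  qed
  have "0 \<le> mv_eval x (prod_list hs)" if "set hs \<subseteq> muirhead_generators 2" for hs
    using that gen by (induction hs) (auto simp: mv_eval_mult simp flip: mv_const_1)
  then show ?thesis
    unfolding f(1) mv_eval_sum mv_eval_mult mv_eval_const using f(2) C by (intro sum_nonneg mult_nonneg_nonneg) auto
qed

text \<open>The ordered field may be non-archimedean, as Q(tau) is, so explicit points take the
  place of limits. On the diagonal a normalized polynomial of degree d has the value s^d; off it,
  majorization bounds the exponents for l, while a single term bounds the value for m from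
  below.\<close>

lemma semiring_imp_majorizes:
  fixes k k' :: "expo \<Rightarrow> 'a::linordered_field"
  assumes f: "normalize_at_one (sym_poly 2 d k) - normalize_at_one (sym_poly 2 e k') \<in> muirhead_semiring 2 C"
    and C: "C \<subseteq> {c. 0 \<le> c}"
    and l: "l \<in> bounded_parts 2 d" "k l = 1" "\<And>p. p \<in> parts_of_size d \<Longrightarrow> 0 \<le> k p"
      "\<And>p. p \<in> parts_of_size d \<Longrightarrow> k p \<noteq> 0 \<Longrightarrow> majorizes l p"
    and m: "m \<in> bounded_parts 2 e" "k' m = 1" "\<And>p. p \<in> parts_of_size e \<Longrightarrow> 0 \<le> k' p"
  shows "majorizes l m"
proof -
  have ge: "mv_eval x (normalize_at_one (sym_poly 2 e k')) \<le> mv_eval x (normalize_at_one (sym_poly 2 d k))"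
    if "\<And>i. 0 \<le> x i" for x :: "nat \<Rightarrow> 'a"
    using semiring_eval_nonneg[OF f C that] by (simp add: mv_eval_minus)
  have nz: "mv_eval (\<lambda>_. 1) (sym_poly 2 d k) \<noteq> 0" "0 < mv_eval (\<lambda>_. 1) (sym_poly 2 e k')"
    using sym_poly_value_pos[of l d 2 k, OF l(1-3)] sym_poly_value_pos[of m e 2 k', OF m] by simp_all
  have ev: "mv_eval x (normalize_at_one (sym_poly 2 d k)) =
     (\<Sum>p\<in>bounded_parts 2 d. sym_weight 2 d k p * ((x 0 ^ lookup p 0 * x 1 ^ lookup p 1 + x 0 ^ lookup p 1 * x 1 ^ lookup p 0) / 2))"
    for x d and k :: "expo \<Rightarrow> 'a"
    unfolding normalize_sym_poly mv_eval_sum mv_eval_mult mv_eval_const by (intro sum.cong) (auto simp: mean_two)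
  have diag: "mv_eval (\<lambda>_. s) (normalize_at_one (sym_poly 2 d k)) = s ^ d"
    if "mv_eval (\<lambda>_. 1) (sym_poly 2 d k) \<noteq> 0" for s d and k :: "expo \<Rightarrow> 'a"
  proof -
    have "mv_eval (\<lambda>_. s) (normalize_at_one (sym_poly 2 d k)) = (\<Sum>p\<in>bounded_parts 2 d. sym_weight 2 d k p * s ^ d)"
      unfolding ev
    proof (rule sum.cong[OF refl])
      fix p assume p: "p \<in> bounded_parts 2 d"
      then have "lookup p 0 + lookup p 1 = d" using two_parts(3)[of p] parts_of_sizeD(2)[of p d] by auto
      then have "s ^ lookup p 0 * s ^ lookup p 1 = s ^ d" "s ^ lookup p 1 * s ^ lookup p 0 = s ^ d"
        by (metis power_add, metis add.commute power_add)
      then show "sym_weight 2 d k p * ((s ^ lookup p 0 * s ^ lookup p 1 + s ^ lookup p 1 * s ^ lookup p 0) / 2) = sym_weight 2 d k p * s ^ d"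
        by simp
    qed
    then show ?thesis using sum_sym_weight[OF that] by (simp add: sum_distrib_right[symmetric])
  qed
  have p2: "s ^ e \<le> s ^ d" if "0 \<le> s" for s :: 'a
    using ge[of "\<lambda>_. s"] that diag nz by auto
  have "e \<le> d" using p2[of 2] by simp
  moreover have "d \<le> e"
  proof -
    have "(1 / 2 :: 'a) ^ e \<le> (1 / 2) ^ d" by (rule p2) simp
    then have "(2 :: 'a) ^ d \<le> 2 ^ e" by (simp add: power_divide divide_simps)
    then show ?thesis by simp
  qed
  ultimately have de: "d = e" by simp
  have m0: "lookup m 0 \<le> lookup l 0"
  proof (rule ccontr)
    assume "\<not> ?thesis"
    then have lt: "lookup l 0 + 1 \<le> lookup m 0" by simp
    define w where "w = sym_weight 2 e k' m"
    have w: "0 < w"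
      using nz(2) m card_orbit_pos[of m 2] by (simp add: w_def sym_weight_def)
    \<comment> \<open>Makes w s = 2 + w exceed 2. The value for l is at most s to its first part,
      the value for m at least w/2 times s to its first part; a larger first part of m would force w
      s \<le> 2.\<close>
    define s where "s = 2 / w + 1"
    have s: "1 \<le> s" using w by (simp add: s_def)
    let ?x = "\<lambda>i::nat. if i = 0 then s else 1"
    have x: "0 \<le> ?x i" for i using s by auto
    have wn: "0 \<le> sym_weight 2 d k p" if "p \<in> parts_of_size d" for p
      using sym_weight_closed[OF semifield_closed_nonneg, of d k p 2] l(3) that by auto
    have wn': "0 \<le> sym_weight 2 e k' p" if "p \<in> parts_of_size e" for p
      using sym_weight_closed[OF semifield_closed_nonneg, of e k' p 2] m(3) that by auto
    have "mv_eval ?x (normalize_at_one (sym_poly 2 d k)) \<le> (\<Sum>p\<in>bounded_parts 2 d. sym_weight 2 d k p * s ^ lookup l 0)"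
      unfolding ev
    proof (rule sum_mono)
      fix p assume p: "p \<in> bounded_parts 2 d"
      show "sym_weight 2 d k p * ((?x 0 ^ lookup p 0 * ?x 1 ^ lookup p 1 + ?x 0 ^ lookup p 1 * ?x 1 ^ lookup p 0) / 2) \<le> sym_weight 2 d k p * s ^ lookup l 0"
      proof (cases "k p = 0")
        case True
        then show ?thesis by (simp add: sym_weight_def)
      next
        case False
        then have "majorizes l p" using l(4) p by blast
        then have "lookup p 0 \<le> lookup l 0" using majorizes_two[of l p] l(1) p by blast
        moreover have "lookup p 1 \<le> lookup p 0" using two_parts(2)[of p] p by blast
        ultimately have "s ^ lookup p 0 \<le> s ^ lookup l 0" "s ^ lookup p 1 \<le> s ^ lookup l 0"
          using s by (auto intro!: power_increasing)
        then show ?thesis using wn[of p] p by (intro mult_left_mono) auto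
      qed
    qed
    also have "\<dots> = s ^ lookup l 0" using sum_sym_weight[OF nz(1)] by (simp add: sum_distrib_right[symmetric])
    finally have up: "mv_eval ?x (normalize_at_one (sym_poly 2 d k)) \<le> s ^ lookup l 0" .
    have "w * (s ^ lookup m 0 / 2) \<le> w * ((s ^ lookup m 0 + s ^ lookup m 1) / 2)"
      using w s by (intro mult_left_mono divide_right_mono) auto
    also have "\<dots> = sym_weight 2 e k' m * ((?x 0 ^ lookup m 0 * ?x 1 ^ lookup m 1 + ?x 0 ^ lookup m 1 * ?x 1 ^ lookup m 0) / 2)"
      by (simp add: w_def)
    also have "\<dots> \<le> mv_eval ?x (normalize_at_one (sym_poly 2 e k'))"
      unfolding ev
      by (rule member_le_sum[where f = "\<lambda>p. sym_weight 2 e k' p * ((?x 0 ^ lookup p 0 * ?x 1 ^ lookup p 1 + ?x 0 ^ lookup p 1 * ?x 1 ^ lookup p 0) / 2)"])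
        (use m wn' s finite_parts_of_size in \<open>auto intro!: mult_nonneg_nonneg\<close>)
    also have "\<dots> \<le> s ^ lookup l 0" using ge[OF x] up by (rule order_trans)
    finally have 1: "w * s ^ lookup m 0 \<le> 2 * s ^ lookup l 0" by simp
    have "w * s * s ^ lookup l 0 = w * s ^ (lookup l 0 + 1)" by simp
    also have "\<dots> \<le> w * s ^ lookup m 0" using w s lt by (intro mult_left_mono power_increasing) auto
    also note 1
    finally have "w * s \<le> 2" using s by (simp add: mult_le_cancel_right)
    then show False using w by (simp add: s_def algebra_simps)
  qed
  have "partition_size l = partition_size m" using l(1) m(1) de by (auto simp: parts_of_sizeD)
  then show ?thesis using majorizes_two[of l m] l(1) m(1) m0 by blast
qed

lemma C1_imp_C4:
  assumes l: "l \<in> partitions_upto 2" and m: "m \<in> partitions_upto 2" and C: "C1 2 l m"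
  shows "majorizes l m"
proof (rule semiring_imp_majorizes[OF _ F_nonneg_nonneg])
  let ?d = "partition_size l" and ?e = "partition_size m"
  have li: "l \<in> int_partitions" "m \<in> int_partitions" using l m by (auto simp: partitions_upto_def)
  show lp: "l \<in> bounded_parts 2 ?d" and mp: "m \<in> bounded_parts 2 ?e" using l m li by (auto simp: parts_of_size_def)
  then have "jack_poly 2 l = sym_poly 2 ?d (jack l)" "jack_poly 2 m = sym_poly 2 ?e (jack m)"
    by (auto intro: jack_poly_sym_poly)
  then show "normalize_at_one (sym_poly 2 ?d (jack l)) - normalize_at_one (sym_poly 2 ?e (jack m)) \<in> muirhead_semiring 2 F_nonneg"
    using C by (simp add: C1_def)
  show "jack l l = 1" "jack m m = 1" using li by (auto simp: jack_diag)
  show "0 \<le> jack l p" if "p \<in> parts_of_size ?d" for p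
    using tame_F_nonneg[OF jack_tame[OF _ that]] lp F_nonneg_nonneg by blast
  show "0 \<le> jack m p" if "p \<in> parts_of_size ?e" for p
    using tame_F_nonneg[OF jack_tame[OF _ that]] mp F_nonneg_nonneg by blast
  show "majorizes l p" if "p \<in> parts_of_size ?d" "jack l p \<noteq> 0" for p
    using jack_support[OF li(1) _ that(2)] that(1) parts_of_sizeD(1) by blast
qed

lemma C3_imp_C4:
  assumes l: "l \<in> partitions_upto 2" and m: "m \<in> partitions_upto 2" and C: "C3 2 l m"
  shows "majorizes l m"
proof -
  obtain t where t: "normalize_at_one (jack_poly_at 2 t l) - normalize_at_one (jack_poly_at 2 t m)
       \<in> muirhead_semiring 2 {c. 0 \<le> c}" using C by (auto simp: C3_def)
  show ?thesis
  proof (rule semiring_imp_majorizes[OF _ subset_refl])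
    let ?d = "partition_size l" and ?e = "partition_size m"
    have li: "l \<in> int_partitions" "m \<in> int_partitions" using l m by (auto simp: partitions_upto_def)
    show lp: "l \<in> bounded_parts 2 ?d" and mp: "m \<in> bounded_parts 2 ?e" using l m li by (auto simp: parts_of_size_def)
    then have "jack_poly_at 2 t l = sym_poly 2 ?d (\<lambda>p. ratfun_spec t (jack l p))"
      "jack_poly_at 2 t m = sym_poly 2 ?e (\<lambda>p. ratfun_spec t (jack m p))"
      by (auto intro: jack_poly_at_sym_poly)
    then show "normalize_at_one (sym_poly 2 ?d (\<lambda>p. ratfun_spec t (jack l p))) - normalize_at_one (sym_poly 2 ?e (\<lambda>p. ratfun_spec t (jack m p)))
       \<in> muirhead_semiring 2 {c. 0 \<le> c}"
      using t by simp
    show "ratfun_spec t (jack l l) = 1" "ratfun_spec t (jack m m) = 1" using li by (auto simp: jack_diag ratfun_spec_1)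
    show "0 \<le> ratfun_spec t (jack l p)" if "p \<in> parts_of_size ?d" for p
      using tame_spec(2)[OF jack_tame[OF _ that]] lp by blast
    show "0 \<le> ratfun_spec t (jack m p)" if "p \<in> parts_of_size ?e" for p
      using tame_spec(2)[OF jack_tame[OF _ that]] mp by blast
    show "majorizes l p" if "p \<in> parts_of_size ?d" "ratfun_spec t (jack l p) \<noteq> 0" for p
    proof -
      have "jack l p \<noteq> 0" using that(2) ratfun_spec_0 by metis
      then show ?thesis using jack_support[OF li(1)] that(1) parts_of_sizeD(1) by blast
    qed
  qed
qed

section \<open>Coefficientwise specialization of polynomials\<close>

lemma lookup_mult_pairs: "lookup (f * g) b = (\<Sum>(p, q)\<in>{(p, q). p + q = b}. lookup f p * lookup g q)" for b :: expo
proof -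
  have "(\<Sum>p\<in>keys f. \<Sum>q\<in>keys g. Poly_Mapping.single (p + q) (lookup f p * lookup g q)) =
     (\<Sum>p\<in>keys f. Poly_Mapping.single p (lookup f p)) * (\<Sum>q\<in>keys g. Poly_Mapping.single q (lookup g q))"
    by (simp add: sum_product mult_single)
  then have "f * g = (\<Sum>p\<in>keys f. \<Sum>q\<in>keys g. Poly_Mapping.single (p + q) (lookup f p * lookup g q))"
    by (simp only: sum_singles[symmetric])
  then have "lookup (f * g) b = (\<Sum>p\<in>keys f. \<Sum>q\<in>keys g. if p + q = b then lookup f p * lookup g q else 0)"
    by (simp add: lookup_sum lookup_single when_def)
  also have "\<dots> = (\<Sum>(p, q)\<in>keys f \<times> keys g. if p + q = b then lookup f p * lookup g q else 0)"
    by (simp add: sum.cartesian_product)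
  also have "\<dots> = (\<Sum>(p, q)\<in>(keys f \<times> keys g) \<inter> {(p, q). p + q = b}. lookup f p * lookup g q)"
    by (rule sum.mono_neutral_cong_right) (auto split: if_splits)
  also have "\<dots> = (\<Sum>(p, q)\<in>{(p, q). p + q = b}. lookup f p * lookup g q)"
    using finite_expo_pairs by (intro sum.mono_neutral_left) (auto simp: in_keys_iff)
  finally show ?thesis .
qed

text \<open>A relation instead of a map, since limits need not exist for arbitrary coefficients; it
  respects the ring operations and determines \<open>g\<close>.\<close>

definition spec_poly :: "ennreal \<Rightarrow> ratfun mvpoly \<Rightarrow> real mvpoly \<Rightarrow> bool" where
  "spec_poly t f g \<longleftrightarrow> (\<forall>b. specs t (lookup f b) (lookup g b))"

lemma spec_poly_unique: "spec_poly t f g \<Longrightarrow> spec_poly t f h \<Longrightarrow> g = h"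
  unfolding spec_poly_def by (rule poly_mapping_eqI) (rule specs_unique, auto)

lemma spec_poly_0: "spec_poly t 0 0"
  by (simp add: spec_poly_def specs_0)

lemma spec_poly_add: "spec_poly t f g \<Longrightarrow> spec_poly t f' g' \<Longrightarrow> spec_poly t (f + f') (g + g')"
  by (simp add: spec_poly_def lookup_add specs_add)

lemma spec_poly_diff: "spec_poly t f g \<Longrightarrow> spec_poly t f' g' \<Longrightarrow> spec_poly t (f - f') (g - g')"
  by (simp add: spec_poly_def lookup_minus specs_diff)

lemma spec_poly_mult: "spec_poly t f g \<Longrightarrow> spec_poly t f' g' \<Longrightarrow> spec_poly t (f * f') (g * g')"
  unfolding spec_poly_def lookup_mult_pairs case_prod_beta by (intro allI specs_sum specs_mult) auto

lemma spec_poly_const: "specs t c v \<Longrightarrow> spec_poly t (mv_const c) (mv_const v)"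
  by (auto simp: spec_poly_def mv_const_def lookup_single when_def specs_0)

lemma spec_poly_sum: "(\<And>i. i \<in> I \<Longrightarrow> spec_poly t (f i) (g i)) \<Longrightarrow> spec_poly t (\<Sum>i\<in>I. f i) (\<Sum>i\<in>I. g i)"
  by (induction I rule: infinite_finite_induct) (auto intro: spec_poly_add spec_poly_0)

lemma spec_poly_mean:
  assumes "m \<in> partitions_upto n"
  shows "spec_poly t (muirhead_mean n m) (muirhead_mean n m)"
proof -
  have "specs t (1 / of_nat (card (orbit n m))) (1 / of_nat (card (orbit n m)))"
    using card_orbit_pos[OF assms] by (intro specs_divide specs_1 specs_of_nat) simp
  then show ?thesis
    by (simp add: spec_poly_def muirhead_mean_def normalize_at_one_def lookup_const_mult mv_eval_mono_poly_1 lookup_mono_poly specs_0)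
qed

lemma spec_poly_generator:
  assumes "f \<in> muirhead_generators n"
  shows "\<exists>g\<in>muirhead_generators n. spec_poly t f g"
proof -
  consider l m where "f = muirhead_mean n l - muirhead_mean n m" "l \<in> partitions_upto n" "m \<in> partitions_upto n" "majorizes l m"
    | l where "f = muirhead_mean n l" "l \<in> partitions_upto n"
    using assms by (auto simp: muirhead_generators_def)
  then show ?thesis
  proof cases
    case 1
    then show ?thesis using spec_poly_diff[OF spec_poly_mean[OF 1(2)] spec_poly_mean[OF 1(3)]]
      by (intro bexI[of _ "muirhead_mean n l - muirhead_mean n m"]) (auto simp: muirhead_generators_def)
  next
    case 2
    then show ?thesis using spec_poly_mean
      by (intro bexI[of _ "muirhead_mean n l"]) (auto simp: muirhead_generators_def)
  qed
qed

text \<open>Turns one certificate over Q(tau) with tame scalars into a certificate at each point of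
  [0, infinity]; the generators have rational coefficients and specialize to their real
  counterparts.\<close>

lemma spec_poly_semiring:
  assumes "f \<in> muirhead_semiring n tame"
  shows "\<exists>g\<in>muirhead_semiring n {c. 0 \<le> c}. spec_poly t f g"
proof -
  obtain k :: nat and c gs where f: "f = (\<Sum>j<k. mv_const (c j) * prod_list (gs j))"
    "\<forall>j<k. c j \<in> tame \<and> set (gs j) \<subseteq> muirhead_generators n" by (rule semiringE[OF assms])
  have pl: "\<exists>hs'. set hs' \<subseteq> muirhead_generators n \<and> spec_poly t (prod_list hs) (prod_list hs')"
    if "set hs \<subseteq> muirhead_generators n" for hs
    using that
  proof (induction hs)
    case Nil
    then show ?case using spec_poly_const[OF specs_1, of t] by (intro exI[of _ "[]"]) simp
  next
    case (Cons h hs)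
    then obtain hs' where hs': "set hs' \<subseteq> muirhead_generators n" "spec_poly t (prod_list hs) (prod_list hs')" by auto
    obtain h' where h': "h' \<in> muirhead_generators n" "spec_poly t h h'"
      using spec_poly_generator[of h n t] Cons.prems by auto
    then show ?case using hs' spec_poly_mult by (intro exI[of _ "h' # hs'"]) auto
  qed
  have "\<forall>j. \<exists>h. j < k \<longrightarrow> set h \<subseteq> muirhead_generators n \<and> spec_poly t (prod_list (gs j)) (prod_list h)"
    using pl f(2) by blast
  then obtain h where h: "\<And>j. j < k \<Longrightarrow> set (h j) \<subseteq> muirhead_generators n \<and> spec_poly t (prod_list (gs j)) (prod_list (h j))"
    by metis
  let ?g = "\<Sum>j<k. mv_const (ratfun_spec t (c j)) * prod_list (h j)"
  have "?g \<in> muirhead_semiring n {c. 0 \<le> c}"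
    using h f(2) tame_spec(2) by (intro semiring_sum semiring_product) auto
  moreover have "spec_poly t f ?g"
    unfolding f(1) using h f(2) tame_spec(1) by (intro spec_poly_sum spec_poly_mult spec_poly_const) auto
  ultimately show ?thesis by blast
qed

text \<open>Normalization survives the limit because the limiting value at (1,...,1) is positive:
  the coefficient at l stays 1 and the others stay nonnegative.\<close>

lemma spec_poly_normalized_jack:
  assumes l: "l \<in> bounded_parts n d"
  shows "spec_poly t (normalize_at_one (jack_poly n l)) (normalize_at_one (jack_poly_at n t l))"
proof -
  let ?k = "\<lambda>m. ratfun_spec t (jack l m)"
  have lp: "l \<in> parts_of_size d" and li: "l \<in> int_partitions" using l parts_of_sizeD(1) by blast+
  have k: "specs t (jack l m) (?k m)" "0 \<le> ?k m" if "m \<in> parts_of_size d" for m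
    using tame_spec[OF jack_tame[OF lp that]] .
  have s: "specs t (mv_eval (\<lambda>_. 1) (sym_poly n d (jack l))) (mv_eval (\<lambda>_. 1) (sym_poly n d ?k))"
    unfolding mv_eval_sym_poly mv_eval_mono_poly_1 by (intro specs_sum specs_mult k specs_of_nat)
  have "mv_eval (\<lambda>_. 1) (sym_poly n d ?k) \<noteq> 0"
    using sym_poly_value_pos[of l d n ?k, OF l _ k(2)] by (simp add: jack_diag[OF li] ratfun_spec_1)
  then have c: "spec_poly t (mv_const (1 / mv_eval (\<lambda>_. 1) (sym_poly n d (jack l)))) (mv_const (1 / mv_eval (\<lambda>_. 1) (sym_poly n d ?k)))"
    by (intro spec_poly_const specs_divide specs_1 s)
  have "spec_poly t (sym_poly n d (jack l)) (sym_poly n d ?k)"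
    unfolding spec_poly_def lookup_sym_poly
    using k(1) sort_parts(1) sort_parts_size by (auto simp: specs_0 parts_of_size_def)
  then show ?thesis
    unfolding jack_poly_sym_poly[OF lp] jack_poly_at_sym_poly[OF lp] normalize_at_one_def by (rule spec_poly_mult[OF c])
qed

section \<open>Rising factorials divided by factorials\<close>

definition upoch :: "'a::field_char_0 \<Rightarrow> nat \<Rightarrow> 'a" where
  "upoch c j = pochhammer c j / fact j"

lemma upoch_0 [simp]: "upoch c 0 = 1"
  by (simp add: upoch_def)

lemma upoch_Suc: "of_nat (Suc j) * upoch c (Suc j) = (c + of_nat j) * upoch c j"
  by (simp add: upoch_def pochhammer_Suc field_simps del: of_nat_Suc)

lemma upoch_pos: "0 < c \<Longrightarrow> 0 < upoch c j" for c :: "'a::linordered_field"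
  by (simp add: upoch_def pochhammer_pos)

lemma upoch_shift: "c * upoch (c + 1) j = (c + of_nat j) * upoch c j"
  using pochhammer_rec[of c j] pochhammer_Suc[of c j] by (simp add: upoch_def mult.commute)

text \<open>Chu-Vandermonde: \<open>upoch c j\<close> is the coefficient of z^j in (1 - z)^(-c), and
  squaring that series doubles c.\<close>

lemma upoch_sum: "(\<Sum>j\<le>r. upoch c j * upoch c (r - j)) = upoch (2 * c) r"
proof -
  have "upoch (2 * c) r = (\<Sum>j\<le>r. of_nat (r choose j) * pochhammer c j * pochhammer c (r - j)) / fact r"
    unfolding upoch_def mult_2[of c] pochhammer_binomial_sum ..
  also have "\<dots> = (\<Sum>j\<le>r. upoch c j * upoch c (r - j))"
    unfolding sum_divide_distrib by (rule sum.cong) (auto simp: upoch_def binomial_fact field_simps)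
  finally show ?thesis by simp
qed

text \<open>Closed form for the right-hand side of the coefficient recursion in
  \<open>jack_two\<close>, verified through its increments.\<close>

lemma upoch_telescope:
  assumes "j \<le> r"
  shows "(\<Sum>i<j. c * (of_nat r - 2 * of_nat i) * (upoch c i * upoch c (r - i))) =
    upoch c j * upoch c (r - j) * of_nat j * (of_nat (r - j) + c)"
  using assms
proof (induction j)
  case (Suc j)
  then obtain k where r: "r = Suc (j + k)" by (metis add_Suc less_iff_Suc_add Suc_le_eq)
  have e: "r - j = Suc k" "r - Suc j = k" using r by auto
  have 1: "of_nat (Suc k) * upoch c (Suc k) = (c + of_nat k) * upoch c k" by (rule upoch_Suc)
  have 2: "of_nat (Suc j) * upoch c (Suc j) = (c + of_nat j) * upoch c j" by (rule upoch_Suc)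
  have "(\<Sum>i<Suc j. c * (of_nat r - 2 * of_nat i) * (upoch c i * upoch c (r - i))) =
     upoch c j * upoch c (Suc k) * (of_nat j * (of_nat (Suc k) + c) + c * (of_nat r - 2 * of_nat j))"
  proof -
    have g: "x * y * n * (m + c) + c * R * (x * y) = x * y * (n * (m + c) + c * R)" for x y n m R
      by (simp add: algebra_simps)
    have IH: "(\<Sum>i<j. c * (of_nat r - 2 * of_nat i) * (upoch c i * upoch c (r - i))) =
      upoch c j * upoch c (Suc k) * of_nat j * (of_nat (Suc k) + c)"
      using Suc.IH[OF Suc_leD[OF Suc.prems]] unfolding e(1) .
    show ?thesis unfolding sum.lessThan_Suc IH e(1) by (rule g)
  qed
  also have "of_nat j * (of_nat (Suc k) + c) + c * (of_nat r - 2 * of_nat j) = of_nat (Suc k) * (c + of_nat j)"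
    unfolding r by (simp add: algebra_simps)
  also have "upoch c j * upoch c (Suc k) * (of_nat (Suc k) * (c + of_nat j)) =
     ((c + of_nat j) * upoch c j) * (of_nat (Suc k) * upoch c (Suc k))" by (simp only: mult_ac)
  also have "\<dots> = (of_nat (Suc j) * upoch c (Suc j)) * ((c + of_nat k) * upoch c k)" by (simp only: 1 2)
  also have "\<dots> = upoch c (Suc j) * upoch c (r - Suc j) * of_nat (Suc j) * (of_nat (r - Suc j) + c)"
    unfolding e by (simp only: mult_ac add.commute)
  finally show ?case .
qed simp

section \<open>Jack coefficients of partitions with two parts\<close>

lemma sf_monomial_expo2:
  assumes "q \<le> p" "x + y = p + q"
  shows "sf_monomial (expo2 p q) (expo2 x y) = (if x = p \<or> x = q then 1 else 0)"
proof -
  have m: "expo2 p q \<in> partitions_upto 2" using expo2_partition[OF assms(1)] by blast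
  have "parts (expo2 x y) = parts (expo2 p q) \<longleftrightarrow> expo2 x y \<in> orbit 2 (expo2 p q)"
    using keys_expo2 by (simp add: orbit_def)
  also have "\<dots> \<longleftrightarrow> expo2 x y = expo2 p q \<or> expo2 x y = expo2 q p"
    unfolding orbit_two[OF m] by (simp add: lookup_expo2)
  also have "\<dots> \<longleftrightarrow> x = p \<or> x = q"
    using assms(2) by (metis add.commute add_left_cancel lookup_expo2 one_neq_zero)
  finally show ?thesis by (simp add: sf_monomial_parts)
qed

text \<open>In the sum of \<open>ddiff_theta_symmetric\<close> only u = p meets the orbit, since u =
  q lies below the range; its weight is 2 p - (p + q).\<close>

lemma dunkl_expo2:
  fixes t :: "'a::comm_ring_1"
  assumes pq: "x + y = p + q" "q < x" "q < y" "x < p" "y < p"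
  shows "dunkl t (theta (sf_monomial (expo2 p q))) (expo2 x y) = t * of_nat (p - q)"
proof -
  let ?f = "sf_monomial (expo2 p q) :: 'a series" and ?b = "expo2 x y"
  have k: "keys ?b - {0} = {1}" using pq by (auto simp: in_keys_iff lookup_expo2 split: if_splits)
  have th: "theta ?f ?b = 0"
    using pq sf_monomial_expo2[of q p x y, where 'a = 'a] by (simp add: theta_def)
  have pu: "pairup 1 u v ?b = expo2 u v" for u v
    by (rule poly_mapping_eqI) (auto simp: lookup_pairup lookup_expo2)
  have "ddiff 1 (theta ?f) ?b = (\<Sum>u\<in>{max x (y + 1)..x + y}. of_nat (2 * u - (x + y)) * ?f (pairup 1 u (x + y - u) ?b))"
    using ddiff_theta_symmetric[OF symmetric_sf_monomial, where 'a = 'a, of 1 "expo2 p q" ?b] by (simp add: lookup_expo2)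
  also have "\<dots> = (\<Sum>u\<in>{max x (y + 1)..x + y}. of_nat (2 * u - (x + y)) * ?f (expo2 u (x + y - u)))"
    by (simp only: pu)
  also have "\<dots> = (\<Sum>u\<in>{p}. of_nat (2 * u - (x + y)) * ?f (expo2 u (x + y - u)))"
    using pq by (intro sum.mono_neutral_right) (auto simp: sf_monomial_expo2)
  also have "\<dots> = of_nat (p - q)"
    using pq sf_monomial_expo2[of q p p q, where 'a = 'a] by simp
  finally show ?thesis using th by (simp add: dunkl_def k)
qed

text \<open>Both choices of the marked variable contribute the same amount, whence the factor
  2.\<close>

lemma jop_entry_expo2:
  assumes "p + q = p' + q'" "q' \<le> p'" "p' < p"
  shows "jop_entry 1 (expo2 p q) (expo2 p' q') = 2 * tau * of_nat (p - q)"
proof -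
  let ?h = "dunkl tau (theta (sf_monomial (expo2 p q)))"
  have k: "keys (expo2 p' q') = {0, 1}" using assms by (auto simp: in_keys_iff lookup_expo2 split: if_splits)
  have s: "swap0 0 (expo2 p' q') = expo2 p' q'" "swap0 1 (expo2 p' q') = expo2 q' p'"
    by (auto intro!: poly_mapping_eqI simp: lookup_perm lookup_expo2 Transposition.transpose_def)
  have "jop_entry 1 (expo2 p q) (expo2 p' q') = ?h (swap0 0 (expo2 p' q')) + ?h (swap0 1 (expo2 p' q'))"
    by (simp add: jop_def symmetrize_def k)
  also have "\<dots> = 2 * tau * of_nat (p - q)"
    unfolding s using assms by (simp add: dunkl_expo2)
  finally show ?thesis .
qed

lemma square_sum_expo2: "square_sum (expo2 p q) = p\<^sup>2 + q\<^sup>2"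
  using square_sum_superset[OF _ keys_expo2, of p q] by (simp add: lessThan_2 lookup_expo2)

lemma weight_sum_expo2: "weight_sum (expo2 p q) = q"
proof -
  have "weight_sum (expo2 p q) = (\<Sum>i\<in>{..<2}. i * lookup (expo2 p q) i)"
    unfolding weight_sum_def using keys_expo2 by (intro sum.mono_neutral_left) (auto simp: in_keys_iff)
  then show ?thesis by (simp add: lessThan_2 lookup_expo2)
qed

text \<open>The first two parts of n already reach its whole size. So the recursion, stated for
  infinitely many variables, runs only over partitions with two parts here.\<close>

lemma majorizes_expo2_keys:
  assumes "majorizes n m" "m \<in> partitions_upto 2" "n \<in> int_partitions"
  shows "n \<in> partitions_upto 2"
proof -
  have m: "(\<Sum>i<2. lookup m i) = partition_size m"
    using partition_size_superset[OF _ two_parts(4)[OF assms(2)]] by simp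
  have "partition_size n \<le> (\<Sum>i<2. lookup n i)"
    using assms(1) m unfolding majorizes_def weakly_majorizes_def by metis
  moreover have "partition_size n = (\<Sum>i<2. lookup n i) + (\<Sum>i\<in>keys n - {..<2}. lookup n i)"
    using partition_size_superset[of "{..<2} \<union> keys n" n] sum.union_disjoint[of "{..<2}" "keys n - {..<2}" "lookup n"] by auto
  ultimately have "(\<Sum>i\<in>keys n - {..<2}. lookup n i) = 0" by simp
  then have "keys n \<subseteq> {..<2}" by (auto simp: in_keys_iff)
  then show ?thesis using assms(3) by (simp add: partitions_upto_def)
qed

text \<open>Solves the recursion for k = 1 by induction on the number j of boxes moved from the
  first row to the second. Only partitions between l and \<open>M j\<close> contribute, their sum is
  evaluated by \<open>upoch_telescope\<close>, and the eigenvalues differ by 2 j (r - j +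
  tau).\<close>

lemma jack_two:
  assumes "2 * j \<le> r"
  shows "jack (expo2 (a + r) a) (expo2 (a + r - j) (a + j)) = upoch tau j * upoch tau (r - j) / upoch tau r"
  using assms
proof (induction j rule: less_induct)
  case (less j)
  define l where "l = expo2 (a + r) a"
  define M where "M i = expo2 (a + r - i) (a + i)" for i
  define d where "d = 2 * a + r"
  have Mb: "M i \<in> bounded_parts 2 d" if "2 * i \<le> r" for i
  proof -
    have "a + r - i + (a + i) = d" using that by (simp add: d_def)
    then show ?thesis using expo2_partition[of "a + i" "a + r - i"] that by (simp add: M_def)
  qed
  have lM: "l = M 0" by (simp add: l_def M_def)
  have lp: "l \<in> parts_of_size d" and li: "l \<in> int_partitions" using Mb[of 0] lM parts_of_sizeD(1) by auto
  have inj: "inj_on M {..j}"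
  proof (rule inj_onI)
    fix i i' assume "M i = M i'"
    then have "lookup (M i) 1 = lookup (M i') 1" by simp
    then show "i = i'" by (simp add: M_def lookup_expo2)
  qed
  have mj: "M j \<in> parts_of_size d" using Mb less.prems by blast
  let ?K = "\<lambda>i. jack l (M i)"
  have up: "0 < upoch tau i" for i using tau_pos by (rule upoch_pos)
  show ?case
  proof (cases "j = 0")
    case True
    then show ?thesis using jack_diag[OF li] up[of r] by (simp add: l_def less_imp_neq[symmetric])
  next
    case False
    have sub: "M ` {..j} \<subseteq> parts_of_size d" using Mb less.prems by auto
    have z: "jack l n * jop_entry 1 n (M j) = 0" if n: "n \<in> parts_of_size d - M ` {..j}" for n
    proof (rule ccontr)
      assume ne: "jack l n * jop_entry 1 n (M j) \<noteq> 0"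
      have ni: "n \<in> int_partitions" using n parts_of_sizeD(1) by blast
      have maj: "majorizes l n" "majorizes n (M j)"
        using ne jack_support[OF li ni] jop_entry_majorizes[OF ni] by auto
      have Mj: "M j \<in> partitions_upto 2" "l \<in> partitions_upto 2" using Mb[of j] Mb[of 0] lM less.prems by auto
      have n2: "n \<in> partitions_upto 2" by (rule majorizes_expo2_keys[OF maj(2) Mj(1) ni])
      have s: "lookup n 0 + lookup n 1 = d" using two_parts(3)[OF n2] n by (simp add: parts_of_sizeD(2)[of n d])
      have "lookup n 0 \<le> a + r" "a + r - j \<le> lookup n 0"
        using maj majorizes_two[OF Mj(2) n2] majorizes_two[OF n2 Mj(1)] by (auto simp: l_def M_def lookup_expo2)
      then have i: "a + r - lookup n 0 \<le> j" "a + r - (a + r - lookup n 0) = lookup n 0"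
        "a + (a + r - lookup n 0) = lookup n 1" using s by (simp_all add: d_def)
      have "M (a + r - lookup n 0) = n" unfolding M_def i(2,3) using two_parts(1)[OF n2] by simp
      then have "n \<in> M ` {..j}" using i(1) by (metis atMost_iff imageI)
      then show False using n by blast
    qed
    have "jop_entry 1 l l * ?K j = (\<Sum>n\<in>parts_of_size d. jack l n * jop_entry 1 n (M j))"
      using jack_eigen[OF lp mj, of 1] by simp
    also have "\<dots> = (\<Sum>n\<in>M ` {..j}. jack l n * jop_entry 1 n (M j))"
      using z by (intro sum.mono_neutral_right sub finite_parts_of_size) auto
    also have "\<dots> = (\<Sum>i\<le>j. ?K i * jop_entry 1 (M i) (M j))"
      by (subst sum.reindex[OF inj]) simp
    also have "\<dots> = ?K j * jop_entry 1 (M j) (M j) + (\<Sum>i<j. ?K i * jop_entry 1 (M i) (M j))"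
      by (simp add: lessThan_Suc_atMost[symmetric])
    finally have e: "?K j * (jop_entry 1 l l - jop_entry 1 (M j) (M j)) = (\<Sum>i<j. ?K i * jop_entry 1 (M i) (M j))"
      by (simp add: algebra_simps)
    have diff: "jop_entry 1 l l - jop_entry 1 (M j) (M j) = 2 * of_nat j * (of_nat (r - j) + tau)"
    proof -
      \<comment> \<open>Removes the truncated subtractions before the squares are expanded.\<close>
      obtain k where r: "r = k + j" using less.prems by (metis add.commute le_add2 le_iff_add mult_2 order_trans)
      have "(of_nat ((a + r)\<^sup>2 + a\<^sup>2) :: ratfun) - of_nat ((a + r - j)\<^sup>2 + (a + j)\<^sup>2) = 2 * of_nat j * of_nat (r - j)"
        unfolding r by (simp add: power2_eq_square algebra_simps)
      then show ?thesis
        using jop1_diag[OF li, of tau] jop1_diag[OF parts_of_sizeD(1)[OF mj], of tau]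
        by (simp add: l_def M_def square_sum_expo2 weight_sum_expo2 algebra_simps)
    qed
    have "(\<Sum>i<j. ?K i * jop_entry 1 (M i) (M j)) =
       (\<Sum>i<j. 2 / upoch tau r * (tau * (of_nat r - 2 * of_nat i) * (upoch tau i * upoch tau (r - i))))"
    proof (rule sum.cong[OF refl])
      fix i assume i: "i \<in> {..<j}"
      have K: "?K i = upoch tau i * upoch tau (r - i) / upoch tau r"
        using less.IH[of i] i less.prems by (simp add: l_def M_def)
      have "jop_entry 1 (M i) (M j) = 2 * tau * of_nat (a + r - i - (a + i))"
        unfolding M_def using i less.prems by (intro jop_entry_expo2) auto
      also have "of_nat (a + r - i - (a + i)) = (of_nat r - 2 * of_nat i :: ratfun)"
      proof -
        have "a + r - i - (a + i) = r - 2 * i" by simp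
        moreover have "2 * i \<le> r" using i less.prems by auto
        ultimately show ?thesis by (simp only: of_nat_diff of_nat_mult of_nat_numeral)
      qed
      finally have "jop_entry 1 (M i) (M j) = 2 * tau * (of_nat r - 2 * of_nat i)" .
      then show "?K i * jop_entry 1 (M i) (M j) = 2 / upoch tau r * (tau * (of_nat r - 2 * of_nat i) * (upoch tau i * upoch tau (r - i)))"
        unfolding K by simp
    qed
    also have "\<dots> = 2 / upoch tau r * (upoch tau j * upoch tau (r - j) * of_nat j * (of_nat (r - j) + tau))"
      unfolding sum_distrib_left[symmetric] using less.prems by (subst upoch_telescope) auto
    also have "\<dots> = (upoch tau j * upoch tau (r - j) / upoch tau r) * (2 * of_nat j * (of_nat (r - j) + tau))"
      by simp
    finally have "?K j * (2 * of_nat j * (of_nat (r - j) + tau)) =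
       (upoch tau j * upoch tau (r - j) / upoch tau r) * (2 * of_nat j * (of_nat (r - j) + tau))"
      using e diff by simp
    moreover have "(2 * of_nat j * (of_nat (r - j) + tau)) \<noteq> (0 :: ratfun)"
    proof -
      have "(0 :: ratfun) < 2 * of_nat j * (of_nat (r - j) + tau)"
        using False tau_pos by (intro mult_pos_pos add_nonneg_pos) auto
      then show ?thesis by (metis less_irrefl)
    qed
    ultimately have "?K j = upoch tau j * upoch tau (r - j) / upoch tau r" using mult_right_cancel by blast
    then show ?thesis by (simp add: l_def M_def)
  qed
qed

section \<open>One-row polynomials in two variables and their recursion\<close>

lemma lookup_single_mult:
  "lookup (Poly_Mapping.single s c * f) b = (if \<forall>i. lookup s i \<le> lookup b i then c * lookup f (b - s) else 0)" for b s :: expo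
proof -
  have "lookup (Poly_Mapping.single s c * f) b = (\<Sum>(p, q)\<in>{(p, q). p + q = b}. (if p = s then c * lookup f q else 0))"
    unfolding lookup_mult_pairs by (intro sum.cong) (auto simp: lookup_single when_def)
  also have "\<dots> = (\<Sum>(p, q)\<in>{(p, q). p + q = b} \<inter> {s} \<times> UNIV. c * lookup f q)"
    using finite_expo_pairs[of b] by (intro sum.mono_neutral_cong_right) (auto split: if_splits)
  also have "\<dots> = (if \<forall>i. lookup s i \<le> lookup b i then c * lookup f (b - s) else 0)"
  proof (cases "\<forall>i. lookup s i \<le> lookup b i")
    case True
    then have "s + (b - s) = b"
      by (intro poly_mapping_eqI) (simp add: lookup_add lookup_expo_minus)
    then have "{(p, q). p + q = b} \<inter> {s} \<times> UNIV = {(s, b - s)}" by auto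
    then show ?thesis using True by simp
  next
    case False
    then have "{(p, q). p + q = b} \<inter> {s} \<times> UNIV = {}" by (auto simp: lookup_add)
    then show ?thesis using False by (simp only: sum.empty if_False)
  qed
  finally show ?thesis .
qed

abbreviation xy :: "nat \<Rightarrow> nat \<Rightarrow> 'a::comm_semiring_1 mvpoly" where
  "xy p q \<equiv> Poly_Mapping.single (expo2 p q) 1"

lemma expo2_le: "(\<forall>i. lookup (expo2 p q) i \<le> lookup b i) \<longleftrightarrow> p \<le> lookup b 0 \<and> q \<le> lookup b 1"
  unfolding lookup_expo2 by (metis zero_le zero_neq_one)

lemma lookup_xy_mult:
  "lookup (xy p q * f) b = (if p \<le> lookup b 0 \<and> q \<le> lookup b 1 then lookup f (b - expo2 p q) else 0)"
  unfolding lookup_single_mult expo2_le by simp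

lemma xy_mult: "xy p q * xy p' q' = xy (p + p') (q + q')"
proof -
  have "expo2 p q + expo2 p' q' = expo2 (p + p') (q + q')"
    by (rule poly_mapping_eqI) (simp add: lookup_add lookup_expo2)
  then show ?thesis by (simp add: mult_single)
qed

lemma mono_poly_sum: "mono_poly n m = (\<Sum>a\<in>orbit n m. Poly_Mapping.single a 1)"
proof (rule poly_mapping_eqI)
  fix k
  have "(\<Sum>a\<in>orbit n m. 1 when a = k) = (\<Sum>a\<in>orbit n m. if a = k then 1 else (0 :: 'a))"
    by (intro sum.cong) (auto simp: when_def)
  then show "lookup (mono_poly n m) k = lookup (\<Sum>a\<in>orbit n m. Poly_Mapping.single a (1 :: 'a)) k"
    by (simp add: lookup_mono_poly lookup_sum lookup_single finite_orbit)
qed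

lemma mean_11: "muirhead_mean 2 (expo2 1 1) = (xy 1 1 :: 'a::field_char_0 mvpoly)"
proof -
  have "orbit 2 (expo2 1 1) = {expo2 1 1}"
    using expo2_partition[of 1 1] by (subst orbit_two) (auto simp: lookup_expo2)
  then show ?thesis
    unfolding muirhead_mean_def normalize_at_one_def mv_eval_mono_poly_1 by (simp add: mono_poly_sum)
qed

lemma mean_20: "muirhead_mean 2 (expo2 2 0) = mv_const (1 / 2) * (xy 2 0 + xy 0 2 :: 'a::field_char_0 mvpoly)"
proof -
  have "orbit 2 (expo2 2 0) = {expo2 2 0, expo2 0 2}"
    using expo2_partition[of 0 2] by (subst orbit_two) (auto simp: lookup_expo2)
  moreover have "expo2 2 0 \<noteq> expo2 0 2" by (metis lookup_expo2 zero_neq_numeral)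
  ultimately show ?thesis
    unfolding muirhead_mean_def normalize_at_one_def mv_eval_mono_poly_1 by (simp add: mono_poly_sum)
qed

text \<open>\<open>qcoeff c j k\<close> is the coefficient of \<open>x\<^sub>0\<^sup>j x\<^sub>1\<^sup>k\<close> in the one-row Jack polynomial in two variables
  with parameter \<open>c\<close>, normalized at \<open>(1, 1)\<close>; up to normalization these are Gegenbauer polynomials.\<close>

definition qcoeff :: "'a::field_char_0 \<Rightarrow> nat \<Rightarrow> nat \<Rightarrow> 'a" where
  "qcoeff c j k = upoch c j * upoch c k / upoch (2 * c) (j + k)"

definition qpoly :: "'a::field_char_0 \<Rightarrow> nat \<Rightarrow> 'a mvpoly" where
  "qpoly c r = sym_poly 2 r (\<lambda>m. qcoeff c (lookup m 0) (lookup m 1))"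

lemma qcoeff_commute: "qcoeff c j k = qcoeff c k j"
  by (simp add: qcoeff_def mult.commute add.commute)

lemma sort_two:
  assumes "keys b \<subseteq> {..<2}"
  shows "sort_parts b \<in> partitions_upto 2"
    "(lookup (sort_parts b) 0 = lookup b 0 \<and> lookup (sort_parts b) 1 = lookup b 1) \<or>
     (lookup (sort_parts b) 0 = lookup b 1 \<and> lookup (sort_parts b) 1 = lookup b 0)"
proof -
  show s: "sort_parts b \<in> partitions_upto 2"
  proof (rule ccontr)
    assume "sort_parts b \<notin> partitions_upto 2"
    then have "orbit 2 (sort_parts b) = {}" by (rule orbit_empty[OF sort_parts(1)])
    moreover have "b \<in> orbit 2 (sort_parts b)" using assms sort_parts(2)[of b] by (simp add: orbit_def)
    ultimately show False by blast
  qed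
  have "b \<in> orbit 2 (sort_parts b)" using assms sort_parts(2)[of b] by (simp add: orbit_def)
  then have "b = expo2 (lookup (sort_parts b) 0) (lookup (sort_parts b) 1) \<or>
      b = expo2 (lookup (sort_parts b) 1) (lookup (sort_parts b) 0)"
    unfolding orbit_two[OF s] by blast
  then show "(lookup (sort_parts b) 0 = lookup b 0 \<and> lookup (sort_parts b) 1 = lookup b 1) \<or>
     (lookup (sort_parts b) 0 = lookup b 1 \<and> lookup (sort_parts b) 1 = lookup b 0)"
    by (metis lookup_expo2 zero_neq_one)
qed

lemma lookup_qpoly:
  "lookup (qpoly c r) b = (if keys b \<subseteq> {..<2} \<and> lookup b 0 + lookup b 1 = r then qcoeff c (lookup b 0) (lookup b 1) else 0)"
proof (cases "keys b \<subseteq> {..<2}")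
  case True
  have "qcoeff c (lookup (sort_parts b) 0) (lookup (sort_parts b) 1) = qcoeff c (lookup b 0) (lookup b 1)"
    using sort_two(2)[OF True] qcoeff_commute[of c "lookup b 0" "lookup b 1"] by auto
  then show ?thesis using True by (simp add: qpoly_def lookup_sym_poly size_two[OF True])
qed (simp add: qpoly_def lookup_sym_poly)

lemma keys_minus_expo2: "keys (b - expo2 p q) \<subseteq> {..<2} \<longleftrightarrow> keys b \<subseteq> {..<2}"
proof -
  have "i \<in> keys (b - expo2 p q) \<longleftrightarrow> i \<in> keys b" if "i \<notin> {..<2}" for i
    using that by (auto simp: lookup_expo_minus lookup_expo2 in_keys_iff)
  then show ?thesis by blast
qed

lemma lookup_xy_qpoly:
  "lookup (xy p q * qpoly c r) b = (if p \<le> lookup b 0 \<and> q \<le> lookup b 1 \<and> keys b \<subseteq> {..<2} \<and>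
     lookup b 0 + lookup b 1 = r + p + q then qcoeff c (lookup b 0 - p) (lookup b 1 - q) else 0)"
  unfolding lookup_xy_mult lookup_qpoly keys_minus_expo2
  by (auto simp: lookup_expo_minus lookup_expo2)

text \<open>Absorbs the out-of-range value 0 into a closed formula, whose factor j vanishes at j =
  0. This and the next three lemmas reduce all shifted terms of the recursion to
  \<open>upoch c j\<close>.\<close>

lemma upoch_minus_one: "c + of_nat j \<noteq> 1 \<Longrightarrow> (if 1 \<le> j then upoch c (j - 1) else 0) = of_nat j * upoch c j / (c + of_nat j - 1)"
  using upoch_Suc[of "j - 1" c] by (cases j) (auto simp: field_simps)

lemma upoch_shifted: "c \<noteq> 0 \<Longrightarrow> upoch (c + 1) j = (c + of_nat j) * upoch c j / c"
  using upoch_shift[of c j] by (simp add: field_simps)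

lemma upoch_shifted_minus_one:
  "c \<noteq> 0 \<Longrightarrow> (if 1 \<le> j then upoch (c + 1) (j - 1) else 0) = of_nat j * upoch c j / c"
  using upoch_Suc[of "j - 1" c] upoch_shifted[of c "j - 1"] by (cases j) (auto simp: field_simps)

lemma upoch_shifted_minus_two:
  assumes "c \<noteq> 0" "c + of_nat j \<noteq> 1"
  shows "(if 2 \<le> j then upoch (c + 1) (j - 2) else 0) = of_nat j * (of_nat j - 1) * upoch c j / (c * (c + of_nat j - 1))"
proof (cases "2 \<le> j")
  case True
  then obtain i where j: "j = Suc (Suc i)" by (metis add_2_eq_Suc le_Suc_ex)
  have "upoch (c + 1) i = of_nat (Suc i) * upoch c (Suc i) / c"
    using upoch_shifted_minus_one[OF assms(1), of "Suc i"] by simp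
  also have "upoch c (Suc i) = of_nat j * upoch c j / (c + of_nat j - 1)"
    using upoch_minus_one[OF assms(2)] j by simp
  finally show ?thesis using j by (simp add: field_simps)
next
  case False
  then have "j = 0 \<or> j = 1" by auto
  then show ?thesis by auto
qed

text \<open>From (2c)_(r+2) = 2c (2c + 1) (2c + 2)_r.\<close>

lemma upoch_double_minus_two:
  assumes "c \<noteq> 0" "2 * c + 1 \<noteq> 0"
  shows "upoch (2 * (c + 1)) r = of_nat (r + 2) * of_nat (r + 1) * upoch (2 * c) (r + 2) / (2 * c * (2 * c + 1))"
proof -
  have "pochhammer (2 * c) (r + 2) = 2 * c * ((2 * c + 1) * pochhammer (2 * (c + 1)) r)"
    by (simp add: pochhammer_rec algebra_simps numeral_2_eq_2)
  then have "pochhammer (2 * (c + 1)) r * (2 * c * (2 * c + 1)) = pochhammer (2 * c) (r + 2)"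
    by (simp only: mult_ac)
  then have "pochhammer (2 * (c + 1)) r = pochhammer (2 * c) (r + 2) / (2 * c * (2 * c + 1))"
    using assms by (intro eq_divide_imp) auto
  moreover have "(fact (r + 2) :: 'a) = of_nat (r + 2) * of_nat (r + 1) * fact r"
    by (simp add: algebra_simps)
  moreover have "of_nat (r + 2) * of_nat (r + 1) \<noteq> (0 :: 'a)"
    by (simp del: of_nat_add of_nat_Suc)
  ultimately show ?thesis by (simp add: upoch_def del: of_nat_add fact_Suc)
qed

text \<open>What is left of \<open>qcoeff_recursion\<close> once all factorials are cancelled; J and
  K stand for the two exponents.\<close>

lemma gegenbauer_identity:
  fixes c J K :: "'a::field_char_0"
  shows "c * ((J + K) * (J + K - 1) * (c + J - 1) * (c + K - 1) - J * K * (2 * c + (J + K) - 2) * (2 * c + (J + K) - 1)) =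
    (c + (J + K) - 1) * ((c + J) * K * (K - 1) * (c + J - 1) - 2 * J * K * (c + J - 1) * (c + K - 1) + J * (J - 1) * (c + K) * (c + K - 1))"
  by (simp add: algebra_simps)

text \<open>Coefficient of x^j y^k in the identity of Q_(r+2) - x y Q_r with c_r (x - y)^2 / 2 times
  the polynomial for c + 1. The assumption 1 < c keeps denominators such as c + j - 1 away from 0;
  tau satisfies it because it exceeds every constant.\<close>

lemma qcoeff_recursion:
  fixes c :: "'a::linordered_field"
  assumes c: "0 < c" "1 < c" and r: "j + k = r + 2"
  shows "qcoeff c j k - (if 1 \<le> j \<and> 1 \<le> k then qcoeff c (j - 1) (k - 1) else 0) =
    (c + of_nat (r + 1)) / (2 * (2 * c + 1)) *
      ((if 2 \<le> j then qcoeff (c + 1) (j - 2) k else 0) + (if 2 \<le> k then qcoeff (c + 1) j (k - 2) else 0)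
       - 2 * (if 1 \<le> j \<and> 1 \<le> k then qcoeff (c + 1) (j - 1) (k - 1) else 0))"
proof -
  define J K where "J = (of_nat j :: 'a)" and "K = (of_nat k :: 'a)"
  define U where "U = upoch c j * upoch c k"
  define S where "S = upoch (2 * c) (r + 2)"
  have JK: "0 \<le> J" "0 \<le> K" "J + K = of_nat r + 2" unfolding J_def K_def using r by (auto simp flip: of_nat_add)
  have rn: "(0 :: 'a) \<le> of_nat r" by simp
  have "0 < c + J - 1" "0 < c + K - 1" "0 < 2 * c + (J + K) - 2" "0 < 2 * c + (J + K) - 1" "0 < J + K" "0 < J + K - 1" "0 < 2 * c + 1"
    using c JK rn by linarith+
  moreover have "0 < S" unfolding S_def using c(1) by (intro upoch_pos) simp
  ultimately have nz: "c \<noteq> 0" "2 * c + 1 \<noteq> 0" "c + J - 1 \<noteq> 0" "c + K - 1 \<noteq> 0" "S \<noteq> 0"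
    "2 * c + (J + K) - 2 \<noteq> 0" "2 * c + (J + K) - 1 \<noteq> 0" "J + K \<noteq> 0" "J + K - 1 \<noteq> 0"
    using c(1) by (simp_all only: less_imp_neq[symmetric] not_False_eq_True)
  have one: "c + of_nat j \<noteq> 1" "c + of_nat k \<noteq> 1" using nz by (auto simp: J_def K_def)
  have S1: "upoch (2 * (c + 1)) r = (J + K) * (J + K - 1) * S / (2 * c * (2 * c + 1))"
    using upoch_double_minus_two[OF nz(1,2), of r] JK(3) by (simp add: S_def algebra_simps)
  have S2: "upoch (2 * c) r = (J + K) * (J + K - 1) * S / ((2 * c + (J + K) - 1) * (2 * c + (J + K) - 2))"
  proof -
    have "of_nat (Suc (Suc r)) * upoch (2 * c) (Suc (Suc r)) = (2 * c + of_nat (Suc r)) * upoch (2 * c) (Suc r)"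
      "of_nat (Suc r) * upoch (2 * c) (Suc r) = (2 * c + of_nat r) * upoch (2 * c) r" by (rule upoch_Suc)+
    moreover have "of_nat (Suc (Suc r)) = J + K" "of_nat (Suc r) = J + K - 1" "of_nat r = J + K - 2"
      using JK(3) by simp_all
    ultimately have 1: "(J + K) * S = (2 * c + (J + K - 1)) * upoch (2 * c) (Suc r)"
      "(J + K - 1) * upoch (2 * c) (Suc r) = (2 * c + (J + K - 2)) * upoch (2 * c) r"
      by (simp_all only: S_def add_2_eq_Suc')
    have "(J + K) * (J + K - 1) * S = (J + K - 1) * ((J + K) * S)" by (simp only: mult_ac)
    also have "\<dots> = (2 * c + (J + K - 1)) * ((J + K - 1) * upoch (2 * c) (Suc r))" unfolding 1(1) by (simp only: mult_ac)
    also have "\<dots> = (2 * c + (J + K) - 1) * (2 * c + (J + K) - 2) * upoch (2 * c) r"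
      unfolding 1(2) by (simp only: add_diff_eq mult.assoc)
    finally show ?thesis using nz by (simp add: nonzero_eq_divide_eq mult.commute)
  qed
  have q0: "qcoeff c j k = U / S" by (simp add: qcoeff_def U_def S_def r)
  have q1: "(if 1 \<le> j \<and> 1 \<le> k then qcoeff c (j - 1) (k - 1) else 0) =
     (J / (c + J - 1)) * (K / (c + K - 1)) * U / upoch (2 * c) r"
  proof -
    have "(if 1 \<le> j \<and> 1 \<le> k then qcoeff c (j - 1) (k - 1) else 0) =
       (if 1 \<le> j then upoch c (j - 1) else 0) * (if 1 \<le> k then upoch c (k - 1) else 0) / upoch (2 * c) r"
      using r by (auto simp: qcoeff_def)
    then show ?thesis unfolding upoch_minus_one[OF one(1)] upoch_minus_one[OF one(2)] by (simp add: U_def J_def K_def)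
  qed
  have q2: "(if 1 \<le> j \<and> 1 \<le> k then qcoeff (c + 1) (j - 1) (k - 1) else 0) = (J / c) * (K / c) * U / upoch (2 * (c + 1)) r"
  proof -
    have "(if 1 \<le> j \<and> 1 \<le> k then qcoeff (c + 1) (j - 1) (k - 1) else 0) =
       (if 1 \<le> j then upoch (c + 1) (j - 1) else 0) * (if 1 \<le> k then upoch (c + 1) (k - 1) else 0) / upoch (2 * (c + 1)) r"
      using r by (auto simp: qcoeff_def)
    then show ?thesis unfolding upoch_shifted_minus_one[OF nz(1)] by (simp add: U_def J_def K_def)
  qed
  have q3: "(if 2 \<le> j then qcoeff (c + 1) (j - 2) k else 0) =
     (J * (J - 1) / (c * (c + J - 1))) * ((c + K) / c) * U / upoch (2 * (c + 1)) r"
  proof -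
    have "(if 2 \<le> j then qcoeff (c + 1) (j - 2) k else 0) =
       (if 2 \<le> j then upoch (c + 1) (j - 2) else 0) * upoch (c + 1) k / upoch (2 * (c + 1)) r"
      using r by (auto simp: qcoeff_def)
    then show ?thesis unfolding upoch_shifted_minus_two[OF nz(1) one(1)] upoch_shifted[OF nz(1), of k] by (simp add: U_def J_def K_def)
  qed
  have q4: "(if 2 \<le> k then qcoeff (c + 1) j (k - 2) else 0) =
     (K * (K - 1) / (c * (c + K - 1))) * ((c + J) / c) * U / upoch (2 * (c + 1)) r"
  proof -
    have "(if 2 \<le> k then qcoeff (c + 1) j (k - 2) else 0) =
       (if 2 \<le> k then upoch (c + 1) (k - 2) else 0) * upoch (c + 1) j / upoch (2 * (c + 1)) r"
      using r by (auto simp: qcoeff_def)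
    then show ?thesis unfolding upoch_shifted_minus_two[OF nz(1) one(2)] upoch_shifted[OF nz(1), of j] by (simp add: U_def J_def K_def)
  qed
  define A B where "A = c + J - 1" and "B = c + K - 1"
  define P where "P = (J + K) * (J + K - 1)"
  define D where "D = (2 * c + (J + K) - 1) * (2 * c + (J + K) - 2)"
  have nz': "A \<noteq> 0" "B \<noteq> 0" "P \<noteq> 0" "D \<noteq> 0" using nz by (auto simp: A_def B_def P_def D_def)
  have id: "c * (P * A * B - J * K * D) = (c + (J + K) - 1) * ((c + J) * K * (K - 1) * A - 2 * J * K * A * B + J * (J - 1) * (c + K) * B)"
    using gegenbauer_identity[of c J K] by (simp add: A_def B_def P_def D_def mult_ac)
  \<comment> \<open>Both sides acquire the common factor U / (c P A B S), so that only the
    polynomial identity \<open>id\<close> remains.\<close>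
  have L: "U / S - (J / A) * (K / B) * U / (P * S / D) = (c * (P * A * B - J * K * D)) * (U / (c * P * A * B * S))"
    using nz(1,5) nz' by (simp add: divide_simps) (simp add: algebra_simps)
  have R: "x / (2 * (2 * c + 1)) * ((J * (J - 1) / (c * A)) * ((c + K) / c) * U / (P * S / (2 * c * (2 * c + 1))) +
      (K * (K - 1) / (c * B)) * ((c + J) / c) * U / (P * S / (2 * c * (2 * c + 1))) -
      2 * ((J / c) * (K / c) * U / (P * S / (2 * c * (2 * c + 1))))) =
    (x * ((c + J) * K * (K - 1) * A - 2 * J * K * A * B + J * (J - 1) * (c + K) * B)) * (U / (c * P * A * B * S))" for x
    using nz(1,2,5) nz' by (simp add: divide_simps) (simp add: algebra_simps)
  have x: "c + of_nat (r + 1) = c + (J + K) - 1" using JK(3) by simp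
  show ?thesis
    unfolding q0 q1 q2 q3 q4 S1 S2 x unfolding A_def[symmetric] B_def[symmetric] P_def[symmetric] D_def[symmetric]
    unfolding L R id ..
qed

lemma tau_gt_1: "1 < tau"
proof -
  have "tau - 1 = Fract [:-1, 1:] 1" by (simp add: tau_def One_fract_def one_pCons)
  moreover have "0 < Fract [:-1, 1 :: rat:] 1" by (simp add: zero_less_Fract_iff less_poly_def pos_poly_def)
  ultimately show ?thesis by (metis diff_gt_0_iff_gt)
qed

lemma qpoly_recursion:
  "qpoly tau (r + 2) - xy 1 1 * qpoly tau r = mv_const ((tau + of_nat (r + 1)) / (2 * tau + 1)) *
     ((muirhead_mean 2 (expo2 2 0) - muirhead_mean 2 (expo2 1 1)) * qpoly (tau + 1) r)"
proof -
  \<comment> \<open>Half of the factor in the recursion; the other half comes from the 1/2 in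
    \<open>mean_20\<close>.\<close>
  define w where "w = (tau + of_nat (r + 1)) / (2 * (2 * tau + 1))"
  let ?Q = "qpoly (tau + 1) r"
  have halves: "x / y = 2 * (x / (2 * y))" for x y :: ratfun by simp
  have w2: "(tau + of_nat (r + 1)) / (2 * tau + 1) = 2 * w" unfolding w_def by (rule halves)
  have "mv_const (2 * w) * ((mv_const (1 / 2) * (xy 2 0 + xy 0 2) - xy 1 1) * ?Q) =
     mv_const (2 * w) * mv_const (1 / 2) * (xy 2 0 * ?Q + xy 0 2 * ?Q) - mv_const (2 * w) * (xy 1 1 * ?Q)"
    by (simp add: algebra_simps)
  also have "mv_const (2 * w) * mv_const (1 / 2) = mv_const w"
    by (simp add: mv_const_mult[symmetric])
  finally have R: "mv_const (2 * w) * ((muirhead_mean 2 (expo2 2 0) - muirhead_mean 2 (expo2 1 1)) * ?Q) =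
     mv_const w * (xy 2 0 * ?Q + xy 0 2 * ?Q) - mv_const (2 * w) * (xy 1 1 * ?Q)"
    unfolding mean_20 mean_11 .
  show ?thesis
    unfolding w2 R
  proof (rule poly_mapping_eqI)
    fix b
    show "lookup (qpoly tau (r + 2) - xy 1 1 * qpoly tau r) b =
      lookup (mv_const w * (xy 2 0 * ?Q + xy 0 2 * ?Q) - mv_const (2 * w) * (xy 1 1 * ?Q)) b"
    proof (cases "keys b \<subseteq> {..<2} \<and> lookup b 0 + lookup b 1 = r + 2")
      case True
      let ?j = "lookup b 0" and ?k = "lookup b 1"
      have e: "r + 1 + 1 = r + 2" "r + 2 + 0 = r + 2" "r + 0 + 2 = r + 2" by simp_all
      have "lookup (qpoly tau (r + 2) - xy 1 1 * qpoly tau r) b =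
         qcoeff tau ?j ?k - (if 1 \<le> ?j \<and> 1 \<le> ?k then qcoeff tau (?j - 1) (?k - 1) else 0)"
        using True by (simp only: lookup_minus lookup_qpoly lookup_xy_qpoly e) simp
      also have "\<dots> = w * ((if 2 \<le> ?j then qcoeff (tau + 1) (?j - 2) ?k else 0) + (if 2 \<le> ?k then qcoeff (tau + 1) ?j (?k - 2) else 0)
       - 2 * (if 1 \<le> ?j \<and> 1 \<le> ?k then qcoeff (tau + 1) (?j - 1) (?k - 1) else 0))"
        unfolding w_def using True by (intro qcoeff_recursion tau_pos tau_gt_1) simp
      also have "\<dots> = lookup (mv_const w * (xy 2 0 * ?Q + xy 0 2 * ?Q) - mv_const (2 * w) * (xy 1 1 * ?Q)) b"
        using True by (simp only: lookup_minus lookup_add lookup_const_mult lookup_xy_qpoly e) (simp add: algebra_simps)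
      finally show ?thesis .
    next
      case False
      then show ?thesis by (auto simp: lookup_minus lookup_add lookup_const_mult lookup_qpoly lookup_xy_qpoly)
    qed
  qed
qed

text \<open>The denominators in \<open>qcoeff\<close> are the sums of \<open>upoch_sum\<close>,
  which normalizes the polynomial at (1, 1).\<close>

lemma qpoly_value: "mv_eval (\<lambda>_. 1) (qpoly tau r) = 1"
proof -
  let ?g = "\<lambda>j. expo2 j (r - j)"
  have "keys (qpoly tau r) \<subseteq> ?g ` {..r}"
  proof
    fix b assume "b \<in> keys (qpoly tau r)"
    then have b: "keys b \<subseteq> {..<2}" "lookup b 0 + lookup b 1 = r"
      by (auto simp: in_keys_iff lookup_qpoly split: if_splits)
    then have "b = ?g (lookup b 0)" using expo2_eqI[OF b(1)] by auto
    then show "b \<in> ?g ` {..r}" using b(2) by (intro image_eqI[of b ?g "lookup b 0"]) auto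
  qed
  then have "mv_eval (\<lambda>_. 1) (qpoly tau r) = (\<Sum>b\<in>?g ` {..r}. lookup (qpoly tau r) b)"
    by (subst mv_eval_superset[of "?g ` {..r}"]) auto
  also have "\<dots> = (\<Sum>j\<le>r. lookup (qpoly tau r) (?g j))"
  proof (rule sum.reindex[THEN trans])
    show "inj_on ?g {..r}" by (rule inj_onI) (metis lookup_expo2)
  qed simp
  also have "\<dots> = (\<Sum>j\<le>r. upoch tau j * upoch tau (r - j) / upoch (2 * tau) r)"
    by (intro sum.cong) (auto simp: lookup_qpoly lookup_expo2 keys_expo2 qcoeff_def)
  also have "\<dots> = 1"
  proof -
    have "0 < upoch (2 * tau) r" using tau_pos by (intro upoch_pos) simp
    then show ?thesis by (simp add: sum_divide_distrib[symmetric] upoch_sum)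
  qed
  finally show ?thesis .
qed

lemma xy_value: "mv_eval (\<lambda>_. 1) (xy p q) = 1"
  by (simp add: mv_eval_single)

lemma jack_two_lookup:
  assumes b: "keys b \<subseteq> {..<2}" "lookup b 0 + lookup b 1 = 2 * a + r"
  shows "jack (expo2 (a + r) a) (sort_parts b) = upoch (2 * tau) r / upoch tau r *
    (if a \<le> lookup b 0 \<and> a \<le> lookup b 1 then qcoeff tau (lookup b 0 - a) (lookup b 1 - a) else 0)"
proof -
  let ?l = "expo2 (a + r) a" and ?s = "sort_parts b"
  have l: "?l \<in> bounded_parts 2 (a + r + a)" using expo2_partition[of a "a + r"] by simp
  have s: "?s \<in> partitions_upto 2" by (rule sort_two(1)[OF b(1)])
  note st = sort_two(2)[OF b(1)]
  have s01: "lookup ?s 1 \<le> lookup ?s 0" "lookup ?s 0 + lookup ?s 1 = 2 * a + r"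
    using two_parts(2)[OF s] st b(2) by auto
  show ?thesis
  proof (cases "a \<le> lookup ?s 1")
    case True
    define j where "j = lookup ?s 1 - a"
    have j: "2 * j \<le> r" "lookup ?s 1 = a + j" "lookup ?s 0 = a + r - j"
      using True s01 by (auto simp: j_def)
    have se: "?s = expo2 (a + r - j) (a + j)" using two_parts(1)[OF s] j by simp
    have "0 < upoch (2 * tau) r" using tau_pos by (intro upoch_pos) simp
    then have nz: "upoch (2 * tau) r \<noteq> 0" by simp
    have "qcoeff tau (lookup b 0 - a) (lookup b 1 - a) = qcoeff tau (r - j) j"
    proof (cases "lookup ?s 0 = lookup b 0 \<and> lookup ?s 1 = lookup b 1")
      case True
      then have "lookup b 0 = a + r - j" "lookup b 1 = a + j" using j(2,3) by metis+
      then have "lookup b 0 - a = r - j" "lookup b 1 - a = j" by simp_all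
      then show ?thesis by simp
    next
      case False
      then have "lookup b 1 - a = r - j" "lookup b 0 - a = j" using st j by auto
      then show ?thesis using qcoeff_commute by simp
    qed
    also have "\<dots> = upoch tau j * upoch tau (r - j) / upoch (2 * tau) r"
      using j(1) by (simp add: qcoeff_def mult.commute)
    finally have "upoch (2 * tau) r / upoch tau r * qcoeff tau (lookup b 0 - a) (lookup b 1 - a) = upoch tau j * upoch tau (r - j) / upoch tau r"
      using nz by simp
    moreover have "a \<le> lookup b 0 \<and> a \<le> lookup b 1" using st True s01 by auto
    moreover have "jack ?l ?s = upoch tau j * upoch tau (r - j) / upoch tau r"
      unfolding se by (rule jack_two[OF j(1)])
    ultimately show ?thesis by (simp only: if_True simp_thms)
  next
    case False
    have "\<not> majorizes ?l ?s"
    proof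
      assume "majorizes ?l ?s"
      then have "lookup ?s 0 \<le> a + r" using majorizes_two[of ?l ?s] l s by (simp add: lookup_expo2)
      then show False using False s01 by simp
    qed
    moreover have "?l \<in> int_partitions" using l by (simp add: partitions_upto_def)
    ultimately have "jack ?l ?s = 0" using jack_support[of ?l ?s] sort_parts(1)[of b] by blast
    moreover have "\<not> (a \<le> lookup b 0 \<and> a \<le> lookup b 1)" using st False by auto
    ultimately show ?thesis by (simp only: if_False mult_zero_right)
  qed
qed

text \<open>The coefficients in \<open>jack_two\<close> do not depend on a, so the polynomial of (a
  + r, a) is (x y)^a times the one-row polynomial. The scalar \<open>?x\<close> converts leading
  coefficient 1 into value 1 at (1, 1).\<close>

lemma normalized_jack_two: "normalize_at_one (jack_poly 2 (expo2 (a + r) a)) = xy a a * qpoly tau r"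
proof -
  let ?x = "upoch (2 * tau) r / upoch tau r" and ?g = "xy a a * qpoly tau r"
  have l: "expo2 (a + r) a \<in> parts_of_size (2 * a + r)"
  proof -
    have "a + r + a = 2 * a + r" by simp
    with expo2_partition[of a "a + r"] show ?thesis by (simp only: le_add1) blast
  qed
  have "0 < upoch (2 * tau) r" "0 < upoch tau r" using tau_pos by (auto intro!: upoch_pos)
  then have x: "?x \<noteq> 0" by simp
  have "jack_poly 2 (expo2 (a + r) a) = mv_const ?x * ?g"
    unfolding jack_poly_sym_poly[OF l]
  proof (rule poly_mapping_eqI)
    fix b
    show "lookup (sym_poly 2 (2 * a + r) (jack (expo2 (a + r) a))) b = lookup (mv_const ?x * ?g) b"
    proof (cases "keys b \<subseteq> {..<2} \<and> lookup b 0 + lookup b 1 = 2 * a + r")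
      case True
      then have "r + a + a = lookup b 0 + lookup b 1" "partition_size b = 2 * a + r" using size_two[of b] by auto
      then show ?thesis
        using True jack_two_lookup[of b a r] by (simp add: lookup_sym_poly lookup_const_mult lookup_xy_qpoly)
    next
      case False
      then show ?thesis using size_two[of b] by (auto simp: lookup_sym_poly lookup_const_mult lookup_xy_qpoly)
    qed
  qed
  moreover have "mv_eval (\<lambda>_. 1) (mv_const ?x * ?g) = ?x"
    by (simp only: mv_eval_mult mv_eval_const xy_value qpoly_value mult_1_right)
  moreover have "mv_const (1 / ?x) * (mv_const ?x * ?g) = ?g"
    using x by (simp add: mult.assoc[symmetric] mv_const_mult[symmetric])
  ultimately show ?thesis by (simp only: normalize_at_one_def)
qed

section \<open>Differences of two-variable Jack polynomials in the Muirhead semiring\<close>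

lemma tame_pochhammer:
  assumes "1 \<le> s"
  shows "pochhammer (tau + 1) j / pochhammer (2 * tau + of_nat s) j \<in> tame"
proof (induction j)
  case 0
  then show ?case using tame_1 by simp
next
  case (Suc j)
  have "pochhammer (tau + 1) (Suc j) / pochhammer (2 * tau + of_nat s) (Suc j) =
     (pochhammer (tau + 1) j / pochhammer (2 * tau + of_nat s) j) *
     ((of_nat (Suc j) + of_nat 1 * tau) / (of_nat (s + j) + of_nat 2 * tau))"
    by (simp add: pochhammer_Suc add_ac mult_ac)
  then show ?case using Suc assms by (simp only:) (intro tame.mult tame.frac, auto)
qed

text \<open>The denominator (2 tau + 2)_(j+k) splits into blocks of lengths j and k, so that each
  linear factor of the numerator meets one of the denominator; the factorials form a binomial
  coefficient. The shift to tau + 1 avoids a denominator factor 2 tau, which vanishes at 0.\<close>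

lemma tame_qcoeff: "qcoeff (tau + 1) j k \<in> tame"
proof -
  have f: "of_nat ((j + k) choose j) = (fact (j + k) / (fact j * fact k) :: ratfun)"
    by (simp add: binomial_fact)
  have "pochhammer (2 * (tau + 1)) (j + k) = pochhammer (2 * tau + of_nat 2) j * pochhammer (2 * tau + of_nat (2 + j)) k"
    unfolding pochhammer_product' by (simp add: algebra_simps)
  then have "qcoeff (tau + 1) j k = of_nat ((j + k) choose j) *
     ((pochhammer (tau + 1) j / pochhammer (2 * tau + of_nat 2) j) * (pochhammer (tau + 1) k / pochhammer (2 * tau + of_nat (2 + j)) k))"
    unfolding f qcoeff_def upoch_def by simp
  then show ?thesis by (simp only:) (intro tame.mult tame.of_nat tame_pochhammer, auto)
qed

lemma xy_power: "xy a a = prod_list (replicate a (muirhead_mean 2 (expo2 1 1) :: 'a::field_char_0 mvpoly))"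
proof (induction a)
  case 0
  have "expo2 0 0 = 0" by (simp add: expo2_def)
  then show ?case by simp
next
  case (Suc a)
  then show ?case unfolding mean_11 using xy_mult[of 1 1 a a, where 'a = 'a] by simp
qed

text \<open>By \<open>qpoly_recursion\<close> each summand is a tame scalar times a product of
  generators: a copies of M_(1,1), the difference M_(2) - M_(1,1), and one mean from the polynomial
  for tau + 1.\<close>

lemma qpoly_step: "xy a a * qpoly tau (r + 2) - xy (a + 1) (a + 1) * qpoly tau r \<in> muirhead_semiring 2 tame"
proof -
  let ?w = "(tau + of_nat (r + 1)) / (2 * tau + 1)"
  let ?G = "muirhead_mean 2 (expo2 2 0) - muirhead_mean 2 (expo2 1 1) :: ratfun mvpoly"
  let ?k = "\<lambda>m. qcoeff (tau + 1) (lookup m 0) (lookup m 1)"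
  let ?c = "\<lambda>m. ?w * (?k m * of_nat (card (orbit 2 m)))"
  let ?L = "\<lambda>m. replicate a (muirhead_mean 2 (expo2 1 1)) @ [?G, muirhead_mean 2 m]"
  have "xy (a + 1) (a + 1) = xy a a * (xy 1 1 :: ratfun mvpoly)" by (simp add: xy_mult)
  then have "xy a a * qpoly tau (r + 2) - xy (a + 1) (a + 1) * qpoly tau r = xy a a * (qpoly tau (r + 2) - xy 1 1 * qpoly tau r)"
    by (simp add: algebra_simps)
  also have "\<dots> = xy a a * (mv_const ?w * (?G * qpoly (tau + 1) r))" by (simp only: qpoly_recursion)
  also have "\<dots> = (\<Sum>m\<in>parts_of_size r. xy a a * (mv_const ?w * (?G * (mv_const (?k m) * mono_poly 2 m))))"
    by (simp add: qpoly_def sym_poly_def sum_distrib_left)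
  also have "\<dots> \<in> muirhead_semiring 2 tame"
  proof (rule semiring_sum)
    fix m assume "m \<in> parts_of_size r"
    then have mi: "m \<in> int_partitions" by (rule parts_of_sizeD)
    show "xy a a * (mv_const ?w * (?G * (mv_const (?k m) * mono_poly 2 m))) \<in> muirhead_semiring 2 tame"
    proof (cases "m \<in> partitions_upto 2")
      case False
      then show ?thesis unfolding mono_poly_mean[OF mi] using semiring_0 by simp
    next
      case True
      have "xy a a * (mv_const ?w * (?G * (mv_const (?k m) * mono_poly 2 m))) = mv_const (?c m) * prod_list (?L m)"
        unfolding mono_poly_mean[OF mi] xy_power mv_const_mult using True by (simp add: mult_ac)
      moreover have "?c m \<in> tame"
      proof -
        have "(of_nat (r + 1) + of_nat 1 * tau) / (of_nat 1 + of_nat 2 * tau) \<in> tame" by (rule tame.frac) auto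
        then have "?w \<in> tame" by (simp add: add.commute)
        then show ?thesis by (intro tame.mult tame_qcoeff tame.of_nat)
      qed
      moreover have "set (?L m) \<subseteq> muirhead_generators 2"
      proof -
        have p: "expo2 1 1 \<in> partitions_upto 2" "expo2 2 0 \<in> partitions_upto 2"
          using expo2_partition[of 1 1] expo2_partition[of 0 2] by auto
        have "majorizes (expo2 2 0) (expo2 1 1)"
          using majorizes_two[OF p(2,1)] by (simp add: size_expo2 lookup_expo2)
        then show ?thesis using p True by (auto simp: muirhead_generators_def)
      qed
      ultimately show ?thesis using semiring_product by metis
    qed
  qed
  finally show ?thesis .
qed

lemma qpoly_chain: "xy a a * qpoly tau (r + 2 * i) - xy (a + i) (a + i) * qpoly tau r \<in> muirhead_semiring 2 tame"
proof (induction i arbitrary: r)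
  case 0
  then show ?case using semiring_0 by simp
next
  case (Suc i)
  have "xy a a * qpoly tau (r + 2 * Suc i) - xy (a + Suc i) (a + Suc i) * qpoly tau r =
     (xy a a * qpoly tau ((r + 2) + 2 * i) - xy (a + i) (a + i) * qpoly tau (r + 2)) +
     (xy (a + i) (a + i) * qpoly tau (r + 2) - xy (a + i + 1) (a + i + 1) * qpoly tau r)"
    by (simp add: add_ac)
  then show ?case using semiring_add[OF Suc[of "r + 2"] qpoly_step[of "a + i" r]] by simp
qed

lemma majorizes_imp_tame_semiring:
  assumes l: "l \<in> partitions_upto 2" and m: "m \<in> partitions_upto 2" and maj: "majorizes l m"
  shows "normalize_at_one (jack_poly 2 l) - normalize_at_one (jack_poly 2 m) \<in> muirhead_semiring 2 tame"
proof -
  \<comment> \<open>The partition m arises from l by moving i boxes from the first row to the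
    second, and r is the difference of the two parts of m.\<close>
  define a where "a = lookup l 1"
  define i where "i = lookup m 1 - a"
  define r where "r = lookup m 0 - lookup m 1"
  have s: "lookup l 0 + lookup l 1 = lookup m 0 + lookup m 1" "lookup m 0 \<le> lookup l 0"
    using maj two_parts(3)[OF l] two_parts(3)[OF m] by (auto simp: majorizes_two[OF l m])
  have "lookup l 0 = a + (r + 2 * i)" "lookup m 0 = (a + i) + r" "lookup m 1 = a + i"
    using s two_parts(2)[OF l] two_parts(2)[OF m] by (auto simp: a_def i_def r_def)
  then have "l = expo2 (a + (r + 2 * i)) a" "m = expo2 ((a + i) + r) (a + i)"
    using two_parts(1)[OF l] two_parts(1)[OF m] by (simp_all add: a_def)
  then show ?thesis using qpoly_chain[of a r i] by (simp only: normalized_jack_two)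
qed

lemma semiring_mono: "C \<subseteq> D \<Longrightarrow> muirhead_semiring n C \<subseteq> muirhead_semiring n D"
proof
  fix f assume "C \<subseteq> D" "f \<in> muirhead_semiring n C"
  obtain k :: nat and c gs where f: "f = (\<Sum>j<k. mv_const (c j) * prod_list (gs j))"
    "\<forall>j<k. c j \<in> C \<and> set (gs j) \<subseteq> muirhead_generators n" by (rule semiringE[OF \<open>f \<in> muirhead_semiring n C\<close>])
  show "f \<in> muirhead_semiring n D"
    unfolding f(1) using f(2) \<open>C \<subseteq> D\<close> by (intro semiring_sum semiring_product) auto
qed

lemma majorizes_imp_C1:
  assumes "l \<in> partitions_upto 2" "m \<in> partitions_upto 2" "majorizes l m"
  shows "C1 2 l m"
  using majorizes_imp_tame_semiring[OF assms] semiring_mono[of tame F_nonneg 2] tame_F_nonneg by (auto simp: C1_def)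

text \<open>The certificate for generic tau is specialized; uniqueness of coefficientwise limits
  identifies its limit with the specialized difference.\<close>

lemma majorizes_imp_C2:
  assumes l: "l \<in> partitions_upto 2" and m: "m \<in> partitions_upto 2" and maj: "majorizes l m"
  shows "C2 2 l m"
  unfolding C2_def
proof
  fix t
  obtain g where g: "g \<in> muirhead_semiring 2 {c. 0 \<le> c}"
    "spec_poly t (normalize_at_one (jack_poly 2 l) - normalize_at_one (jack_poly 2 m)) g"
    using spec_poly_semiring[OF majorizes_imp_tame_semiring[OF assms], of t] by blast
  have "spec_poly t (normalize_at_one (jack_poly 2 l) - normalize_at_one (jack_poly 2 m))
      (normalize_at_one (jack_poly_at 2 t l) - normalize_at_one (jack_poly_at 2 t m))"
  proof (intro spec_poly_diff)
    show "spec_poly t (normalize_at_one (jack_poly 2 l)) (normalize_at_one (jack_poly_at 2 t l))"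
      using l by (intro spec_poly_normalized_jack[where l=l and n=2 and d="partition_size l"]) (auto simp: parts_of_size_def partitions_upto_def)
    show "spec_poly t (normalize_at_one (jack_poly 2 m)) (normalize_at_one (jack_poly_at 2 t m))"
      using m by (intro spec_poly_normalized_jack[where l=m and n=2 and d="partition_size m"]) (auto simp: parts_of_size_def partitions_upto_def)
  qed
  then show "normalize_at_one (jack_poly_at 2 t l) - normalize_at_one (jack_poly_at 2 t m) \<in> muirhead_semiring 2 {c. 0 \<le> c}"
    using spec_poly_unique[OF g(2)] g(1) by simp
qed

section \<open>The equivalences\<close>

lemma one_column_assertions:
  assumes l: "l \<in> partitions_upto n" and d: "partition_size l \<le> n" and m: "m = one_column (partition_size l)"
  shows "A1 n l m" "A2 n l m" "A3 n l m" "A4 n l m" "B1 n l m" "B2 n l m" "B3 n l m" "B4 n l m"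
    "C1 n l m" "C2 n l m" "C3 n l m" "C4 n l m"
proof -
  have lb: "l \<in> bounded_parts n (partition_size l)"
    using l by (auto simp: parts_of_size_def partitions_upto_def)
  note at = one_column_diff_at[OF lb d, folded m] and gen = one_column_diff_generic[OF lb d, folded m]
  show "A1 n l m" "A2 n l m" "B1 n l m" "B2 n l m" using at gen by (auto simp: A1_def A2_def B1_def B2_def)
  \<comment> \<open>Both open regions in \<open>A3\<close> lie in the nonnegative orthant.\<close>
  have "0 \<le> diff_at n t l m x" if "(\<forall>i<n. 0 < x i \<and> x i < 1) \<or> (\<forall>i<n. 1 < x i)" for t x
  proof (rule at, intro allI impI)
    fix i assume "i < n"
    then show "0 \<le> x i" using that by (auto intro: less_imp_le order_less_trans[of 0 1])
  qed
  then show "A3 n l m" by (auto simp: A3_def)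
  show "B3 n l m" using at by (auto simp: B3_def)
  have maj: "majorizes l m" unfolding m using lb by (intro majorizes_one_column) blast
  then show "A4 n l m" "B4 n l m" "C4 n l m" by (auto simp: A4_def B4_def C4_def majorizes_def)
  show "C1 n l m" "C2 n l m" using one_column_C1[OF lb d] one_column_C2[OF lb d] m by simp_all
  then show "C3 n l m" by (auto simp: C2_def C3_def)
qed

lemma two_variable_assertions:
  assumes "l \<in> partitions_upto 2" "m \<in> partitions_upto 2"
  shows "(C1 2 l m \<longleftrightarrow> C2 2 l m) \<and> (C2 2 l m \<longleftrightarrow> C3 2 l m) \<and> (C3 2 l m \<longleftrightarrow> C4 2 l m)"
proof -
  have "C2 2 l m \<Longrightarrow> C3 2 l m" by (auto simp: C2_def C3_def)
  moreover have "C4 2 l m \<Longrightarrow> C1 2 l m" "C4 2 l m \<Longrightarrow> C2 2 l m" "C1 2 l m \<Longrightarrow> C4 2 l m" "C3 2 l m \<Longrightarrow> C4 2 l m"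
    using majorizes_imp_C1[OF assms] majorizes_imp_C2[OF assms] C1_imp_C4[OF assms] C3_imp_C4[OF assms]
    unfolding C4_def by blast+
  ultimately show ?thesis by blast
qed

theorem theorem4p4:
  shows "(\<forall>n l m. n \<ge> 1 \<and> l \<in> partitions_upto n \<and> partition_size l \<le> n \<and> m = one_column (partition_size l) \<longrightarrow>
            ((A1 n l m \<longleftrightarrow> A2 n l m) \<and> (A2 n l m \<longleftrightarrow> A3 n l m) \<and> (A3 n l m \<longleftrightarrow> A4 n l m)) \<and>
            ((B1 n l m \<longleftrightarrow> B2 n l m) \<and> (B2 n l m \<longleftrightarrow> B3 n l m) \<and> (B3 n l m \<longleftrightarrow> B4 n l m)) \<and>
            ((C1 n l m \<longleftrightarrow> C2 n l m) \<and> (C2 n l m \<longleftrightarrow> C3 n l m) \<and> (C3 n l m \<longleftrightarrow> C4 n l m)))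
       \<and> (\<forall>l m. l \<in> partitions_upto 2 \<and> m \<in> partitions_upto 2 \<longrightarrow>
            (C1 2 l m \<longleftrightarrow> C2 2 l m) \<and> (C2 2 l m \<longleftrightarrow> C3 2 l m) \<and> (C3 2 l m \<longleftrightarrow> C4 2 l m))"
proof (intro conjI allI impI)
  fix l m assume "l \<in> partitions_upto 2 \<and> m \<in> partitions_upto 2"
  then show "C1 2 l m \<longleftrightarrow> C2 2 l m" "C2 2 l m \<longleftrightarrow> C3 2 l m" "C3 2 l m \<longleftrightarrow> C4 2 l m"
    using two_variable_assertions by blast+
qed (simp_all add: one_column_assertions)

end
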